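(* Let $N\ge2$. For every $u\in C_0^\infty(\mathbb{R}^N)$ with $\int_{\mathbb{S}^{N-1}}u(r\omega)\,dS_\omega=0$ for all $r\ge0$, the inequality $$\frac{N^2}{4}\int_{\mathbb{R}^N}\frac{|u|^2}{|x|^2}\,dx\le\int_{\mathbb{R}^N}|\nabla u|^2\,dx$$ holds. Moreover, $\frac{N^2}{4}$ is the best constant in this inequality, and it is not attained.
   Context: $\mathbb{S}^{N-1}$ is the unit sphere of $\mathbb{R}^N$, $dS_\omega$ its surface measure, and $C_0^\infty$ denotes smooth real-valued functions with compact support. "Best constant" means the largest constant for which the inequality holds for all admissible $u$; "not attained" means that equality does not hold for any admissible $u\neq0$. *)

theory Defs
  imports "HOL-Analysis.Analysis"
begin

(* Continuity of all iterated directional derivatives is the usual C^k in finite dimensions. *)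

primrec C_k :: "nat \<Rightarrow> ('a::euclidean_space \<Rightarrow> 'b::real_normed_vector) \<Rightarrow> bool" where
  "C_k 0 f \<longleftrightarrow> continuous_on UNIV f"
| "C_k (Suc k) f \<longleftrightarrow> (\<forall>x. f differentiable (at x)) \<and>
     (\<forall>v. C_k k (\<lambda>x. frechet_derivative f (at x) v))"

definition C0_infinity :: "('a::euclidean_space \<Rightarrow> real) set" where
  "C0_infinity = {u. (\<forall>k. C_k k u) \<and> compact (closure {x. u x \<noteq> 0})}"

definition gradient :: "(real ^ 'n \<Rightarrow> real) \<Rightarrow> real ^ 'n \<Rightarrow> real ^ 'n" where
  "gradient u x = (\<chi> i. frechet_derivative u (at x) (axis i 1))"

(* Surface measure on the unit sphere: the area of A is N times the volume of the cone
   {t w | 0 < t <= 1, w in A}, expressed as N times the image of Lebesgue measure on the punctured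
   unit ball under x |-> x / |x|; see emeasure_sphere_measure below. *)

definition sphere_measure :: "(real ^ 'n) measure" where
  "sphere_measure = scale_measure (of_nat CARD('n))
     (distr (restrict_space lborel (cball 0 1 - {0})) (restrict_space borel (sphere 0 1))
       (\<lambda>x. x /\<^sub>R norm x))"

lemma space_sphere_measure: "space (sphere_measure :: (real ^ 'n) measure) = sphere 0 1"
  by (simp add: sphere_measure_def space_scale_measure space_restrict_space)

lemma sets_sphere_measure:
  "sets (sphere_measure :: (real ^ 'n) measure) = sets (restrict_space borel (sphere 0 1))"
  by (simp add: sphere_measure_def)

lemma emeasure_sphere_measure:
  fixes A :: "(real ^ 'n) set"
  assumes A: "A \<in> sets sphere_measure"
  shows "emeasure sphere_measure A =
    of_nat CARD('n) * emeasure lborel {t *\<^sub>R w | t w. 0 < t \<and> t \<le> 1 \<and> w \<in> A}"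
proof -
  let ?B = "cball 0 1 - {0} :: (real ^ 'n) set"
  have B: "?B \<in> sets borel" by simp
  have AS: "A \<in> sets (restrict_space borel (sphere 0 1))"
    using A by (simp add: sets_sphere_measure)
  then have A1: "w \<in> A \<Longrightarrow> norm w = 1" for w
    by (auto simp: sets_restrict_space)
  have "(\<lambda>x. x /\<^sub>R norm x) \<in> restrict_space lborel ?B \<rightarrow>\<^sub>M borel"
    by (intro measurable_restrict_space1) simp
  then have meas: "(\<lambda>x. x /\<^sub>R norm x) \<in>
      restrict_space lborel ?B \<rightarrow>\<^sub>M restrict_space borel (sphere 0 1)"
    by (intro measurable_restrict_space2) (auto simp: space_restrict_space)
  have cone: "(\<lambda>x. x /\<^sub>R norm x) -` A \<inter> space (restrict_space lborel ?B) =
      {t *\<^sub>R w | t w. 0 < t \<and> t \<le> 1 \<and> w \<in> A}" (is "?L = ?R")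
  proof (intro set_eqI iffI)
    fix x assume x: "x \<in> ?L"
    then have "x = norm x *\<^sub>R (x /\<^sub>R norm x)" "0 < norm x" "norm x \<le> 1" "x /\<^sub>R norm x \<in> A"
      by (auto simp: space_restrict_space)
    then show "x \<in> ?R" by blast
  next
    fix x assume "x \<in> ?R"
    then obtain t w where x: "x = t *\<^sub>R w" and t: "0 < t" "t \<le> 1" and w: "w \<in> A" by blast
    have "w \<noteq> 0" using A1[OF w] by auto
    then show "x \<in> ?L"
      using t w A1[OF w] by (auto simp: x space_restrict_space)
  qed
  have "emeasure sphere_measure A =
      of_nat CARD('n) * emeasure (restrict_space lborel ?B) ?R"
    unfolding sphere_measure_def emeasure_scale_measure emeasure_distr[OF meas AS] cone ..
  also have "emeasure (restrict_space lborel ?B) ?R = emeasure lborel ?R"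
    by (rule emeasure_restrict_space) (use B cone in \<open>auto simp: space_restrict_space\<close>)
  finally show ?thesis .
qed

definition admissible :: "(real ^ 'n \<Rightarrow> real) set" where
  "admissible = {u \<in> C0_infinity.
     \<forall>r\<ge>0. (\<integral>\<omega>. u (r *\<^sub>R \<omega>) \<partial>sphere_measure) = 0}"

(* The quotient is 0 at x = 0, a null set. *)

definition hardy_integral :: "(real ^ 'n \<Rightarrow> real) \<Rightarrow> real" where
  "hardy_integral u = (\<integral>x. \<bar>u x\<bar>\<^sup>2 / (norm x)\<^sup>2 \<partial>lborel)"

definition dirichlet_integral :: "(real ^ 'n \<Rightarrow> real) \<Rightarrow> real" where
  "dirichlet_integral u = (\<integral>x. (norm (gradient u x))\<^sup>2 \<partial>lborel)"

end

theory Submission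
  imports Defs "HOL-Probability.Distributions" "HOL-Real_Asymp.Real_Asymp"
    "HOL-Computational_Algebra.Polynomial"
begin

text \<open>The Dirichlet integral splits into a radial and a tangential part. The radial part is
  handled by the one-dimensional Hardy inequality with constant $(N-2)^2/4$ and an explicit
  square remainder. The tangential part is bounded below by $N-1$ times the Hardy integral:
  this is the sharp Poincare inequality for functions of mean zero on the sphere, and
  $(N-2)^2/4 + (N-1) = N^2/4$. Spherical harmonics are avoided by applying the Gaussian
  Poincare inequality to the 1-homogeneous function $|x| u(r x/|x|)$: its Gaussian
  energy is the integral of $u^2$ plus the tangential energy on the sphere of radius $r$, while its
  Gaussian variance is $N$ times the integral of $u^2$. The Gaussian Poincare inequality itself follows from integration
  by parts along the rotations $(x,y) \mapsto (x \cos t + y \sin t, - x \sin t + y \cos t)$,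
  which preserve the product of two Gaussian measures. Equality forces the radial remainder to
  vanish, so that $|x|^{(N-2)/2} u$ is constant along rays and $u = 0$. Optimality of the
  constant is seen on logarithmic dilates $x_i |x|^{-N/2} v(\epsilon \ln |x|)$ of a bump function.\<close>

section \<open>Integration lemmas and the Gaussian density\<close>

text \<open>Linear functions give equality in the Gaussian Poincare inequality, and on the sphere
  they restrict to the first spherical harmonics, the extremals of the sphere inequality; hence the
  detour through Gaussian measure loses no constant. Its price is a kink of the 1-homogeneous
  function at 0, so the calculus lemmas admit a finite exceptional set. The factor N between
  variance and energy is the Gaussian second moment. Integrals over spheres are replaced by
  integrals over the whole space of functions of the direction against a radial weight; for
  different weights these are proportional, and the surface measure enters only through the mean
  value condition. At r = 0 that condition gives u(0) = 0, so that \<open>u / |x|\<close> is bounded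
  and all integrals are finite, N = 2 included. For optimality, \<open>x_i |x|^(-N/2)\<close> is
  homogeneous of degree \<open>-(N-2)/2\<close>, the degree annihilated by the radial remainder;
  only the derivative of the slowly varying cutoff survives, with a factor epsilon.\<close>

lemma FTC_lborel:
  fixes f f' :: "real \<Rightarrow> real"
  assumes ab: "a \<le> b" and S: "finite S" and cont: "continuous_on {a..b} f"
    and deriv: "\<And>t. t \<in> {a<..<b} - S \<Longrightarrow> (f has_real_derivative f' t) (at t)"
    and meas[measurable]: "f' \<in> borel_measurable borel"
    and bd: "\<And>t. t \<in> {a..b} \<Longrightarrow> \<bar>f' t\<bar> \<le> B"
  shows "(\<integral>t. indicator {a..b} t * f' t \<partial>lborel) = f b - f a"
proof -
  \<comment> \<open>The gauge integral needs no integrability of \<open>f'\<close>. The bound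
    \<open>B\<close> then makes \<open>f'\<close> Lebesgue integrable, and the two integrals
    agree.\<close>
  have 1: "(f' has_integral (f b - f a)) {a..b}"
    using fundamental_theorem_of_calculus_interior_strong[OF S ab _ cont, of f'] deriv
    by (auto simp: has_real_derivative_iff_has_vector_derivative)
  have B: "0 \<le> B" using bd[of a] ab by auto
  have int: "integrable lborel (\<lambda>t. indicator {a..b} t * f' t)"
  proof (rule Bochner_Integration.integrable_bound)
    show "integrable lborel (\<lambda>t. B * indicator {a..b} t :: real)"
      by (intro integrable_mult_right) (simp add: integrable_indicator_iff emeasure_lborel_Icc_eq)
    show "AE x in lborel. norm (indicator {a..b} x * f' x) \<le> norm (B * indicator {a..b} x)"
      using B bd by (auto split: split_indicator)
  qed simp
  have "((\<lambda>t. indicator {a..b} t * f' t) has_integral (\<integral>t. indicator {a..b} t * f' t \<partial>lborel)) UNIV"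
    by (rule has_integral_integral_lborel[OF int])
  moreover have "((\<lambda>t. indicator {a..b} t * f' t) has_integral (f b - f a)) UNIV"
  proof -
    have "(\<lambda>t. indicator {a..b} t * f' t) = (\<lambda>t. if t \<in> {a..b} then f' t else 0)"
      by (auto simp: fun_eq_iff)
    then show ?thesis using 1 by (simp only: has_integral_restrict_UNIV)
  qed
  ultimately show ?thesis by (rule has_integral_unique)
qed

text \<open>Stands in for differentiation under the integral sign: a difference of integrals is
  written pointwise as an integral over a parameter \<open>t\<close>, and the order is exchanged. It
  serves for translations, rotations and dilations, where the bound \<open>B\<close> comes from
  invariance or scaling.\<close>

lemma integral_interval_commute:
  fixes H :: "real \<Rightarrow> 'a::euclidean_space \<Rightarrow> real"
  assumes meas0: "case_prod H \<in> borel_measurable borel"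
    and int: "\<And>t. t \<in> {a..b} \<Longrightarrow> integrable lborel (H t)"
    and bd: "\<And>t. t \<in> {a..b} \<Longrightarrow> (\<integral>p. \<bar>H t p\<bar> \<partial>lborel) \<le> B"
  shows "(\<integral>p. (\<integral>t. indicator {a..b} t * H t p \<partial>lborel) \<partial>lborel) =
    (\<integral>t. indicator {a..b} t * (\<integral>p. H t p \<partial>lborel) \<partial>lborel)"
    and "integrable lborel (\<lambda>t. indicator {a..b} t * (\<integral>p. H t p \<partial>lborel))"
proof -
  have meas[measurable]: "(\<lambda>(t, p). H t p) \<in> borel_measurable (lborel \<Otimes>\<^sub>M lborel)"
    using meas0 by (simp add: lborel_prod)
  have m[measurable]: "H t \<in> borel_measurable lborel" for t
    using measurable_compose[OF measurable_Pair1' meas, of t] by simp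
  have "integrable (lborel \<Otimes>\<^sub>M lborel) (\<lambda>(t, p). indicator {a..b} t * H t p)"
  proof (rule lborel_pair.Fubini_integrable)
    have "integrable lborel (\<lambda>t. indicator {a..b} t * (\<integral>p. \<bar>H t p\<bar> \<partial>lborel))"
    proof (rule Bochner_Integration.integrable_bound)
      show "integrable lborel (\<lambda>t. B * indicator {a..b} t :: real)"
        by (intro integrable_mult_right) (simp add: integrable_indicator_iff emeasure_lborel_Icc_eq)
      show "AE t in lborel. norm (indicator {a..b} t * (\<integral>p. \<bar>H t p\<bar> \<partial>lborel)) \<le> norm (B * indicator {a..b} t)"
        using bd by (auto split: split_indicator intro!: order_trans[OF bd])
    qed measurable
    then show "integrable lborel (\<lambda>x. \<integral>y. norm (case (x, y) of (t, p) \<Rightarrow> indicator {a..b} t * H t p) \<partial>lborel)"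
      by (simp add: abs_mult)
    show "AE x in lborel. integrable lborel (\<lambda>y. case (x, y) of (t, p) \<Rightarrow> indicator {a..b} t * H t p)"
      using int by (auto split: split_indicator)
  qed measurable
  note I = this
  from lborel_pair.Fubini_integral[OF I]
  show "(\<integral>p. (\<integral>t. indicator {a..b} t * H t p \<partial>lborel) \<partial>lborel) =
    (\<integral>t. indicator {a..b} t * (\<integral>p. H t p \<partial>lborel) \<partial>lborel)"
    by simp
  from lborel_pair.integrable_fst[OF I]
  show "integrable lborel (\<lambda>t. indicator {a..b} t * (\<integral>p. H t p \<partial>lborel))"
    by simp
qed

text \<open>Unnormalised: the total mass cancels wherever it appears, so it only has to be finite
  and positive.\<close>

definition gauss :: "'a::euclidean_space \<Rightarrow> real" where
  "gauss x = exp (- (norm x)\<^sup>2 / 2)"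

lemma gauss_pos [simp]: "0 < gauss x" and gauss_nonneg [simp]: "0 \<le> gauss x"
  by (auto simp: gauss_def)

lemma continuous_on_gauss [continuous_intros]:
  "continuous_on S f \<Longrightarrow> continuous_on S (\<lambda>x. gauss (f x))"
  unfolding gauss_def by (intro continuous_intros) auto

lemma borel_measurable_gauss [measurable]: "gauss \<in> borel_measurable borel"
  by (intro borel_measurable_continuous_onI continuous_intros)

lemma gauss_Pair: "gauss (x, y) = gauss x * gauss y"
  by (simp add: gauss_def norm_Pair exp_add[symmetric] field_simps)

lemma has_derivative_gauss: "(gauss has_derivative (\<lambda>h. - (x \<bullet> h) * gauss x)) (at x)"
  unfolding gauss_def power2_norm_eq_inner
  by (auto intro!: derivative_eq_intros simp: inner_commute field_simps)

text \<open>The density is the square of \<open>exp (- |x|^2 / 4)\<close>: one factor absorbs the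
  polynomial, the other is a product of one-dimensional Gaussians.\<close>

lemma integrable_gauss_moment:
  "integrable lborel (\<lambda>x::'a::euclidean_space. (1 + norm x) ^ k * gauss x)"
proof -
  let ?g = "\<lambda>x::'a. \<Prod>b\<in>Basis. exp (- (x \<bullet> b)\<^sup>2 / 4)"
  have g: "?g x = exp (- (norm x)\<^sup>2 / 4)" for x :: 'a
  proof -
    have "(norm x)\<^sup>2 = (\<Sum>b\<in>Basis. (x \<bullet> b)\<^sup>2)"
      unfolding power2_norm_eq_inner euclidean_inner[of x x] by (simp add: power2_eq_square)
    then show ?thesis
      by (simp add: exp_sum[symmetric] sum_negf sum_divide_distrib[symmetric])
  qed
  have fin: "(\<integral>\<^sup>+x. exp (- (x::real)\<^sup>2 / 4) \<partial>lborel) < \<infinity>"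
  proof -
    \<comment> \<open>With variance 2 the normal density is
      \<open>exp (- x^2 / 4) / (2 sqrt pi)\<close>.\<close>
    have "integrable lborel (\<lambda>x. normal_density 0 (sqrt 2) x * (2 * sqrt pi))"
      by (intro integrable_mult_left integrable_normal_density) simp
    then have "integrable lborel (\<lambda>x::real. exp (- x\<^sup>2 / 4))"
      by (simp add: normal_density_def real_sqrt_mult)
    then show ?thesis by (simp add: integrable_iff_bounded)
  qed
  have "(\<integral>\<^sup>+x. ?g x \<partial>lborel) = (\<integral>\<^sup>+x. (\<Prod>b\<in>Basis. ennreal (exp (- ((x::'a) \<bullet> b)\<^sup>2 / 4))) \<partial>lborel)"
    by (simp add: prod_ennreal)
  also have "\<dots> = (\<Prod>b\<in>(Basis::'a set). (\<integral>\<^sup>+x. exp (- (x::real)\<^sup>2 / 4) \<partial>lborel))"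
    by (rule nn_integral_lborel_prod) auto
  also have "\<dots> < \<infinity>" using fin by (auto simp: ennreal_prod_eq_top power_less_top_ennreal)
  finally have "(\<integral>\<^sup>+x. ?g x \<partial>lborel) < \<infinity>" .
  then have intg: "integrable lborel ?g"
    by (intro integrableI_nonneg) (auto intro!: prod_nonneg)
  have "((\<lambda>r::real. (1 + r) ^ k * exp (- r\<^sup>2 / 4)) \<longlongrightarrow> 0) at_top"
    by real_asymp
  then have "eventually (\<lambda>r::real. (1 + r) ^ k * exp (- r\<^sup>2 / 4) \<le> 1) at_top"
    by (auto dest!: order_tendstoD(2)[where a=1] elim: eventually_mono)
  then obtain R where R: "\<And>r::real. r \<ge> R \<Longrightarrow> (1 + r) ^ k * exp (- r\<^sup>2 / 4) \<le> 1"
    by (auto simp: eventually_at_top_linorder)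
  define C where "C = max 1 ((1 + \<bar>R\<bar>) ^ k)"
  have C: "(1 + r) ^ k * exp (- r\<^sup>2 / 4) \<le> C" if "0 \<le> r" for r :: real
  proof (cases "r \<ge> R")
    case True then show ?thesis using R[of r] unfolding C_def by (intro max.coboundedI1)
  next
    case False
    have "(1 + r) ^ k * exp (- r\<^sup>2 / 4) \<le> (1 + \<bar>R\<bar>) ^ k * 1"
      using that False by (intro mult_mono power_mono) auto
    then show ?thesis by (auto simp: C_def)
  qed
  show ?thesis
  proof (rule Bochner_Integration.integrable_bound)
    show "integrable lborel (\<lambda>x::'a. C * ?g x)"
      by (intro integrable_mult_right intg)
    show "AE x in lborel. norm ((1 + norm x) ^ k * gauss x) \<le> norm (C * ?g x)"
    proof (rule AE_I2)
      fix x :: 'a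
      have "gauss x = exp (- (norm x)\<^sup>2 / 4) * exp (- (norm x)\<^sup>2 / 4)"
        by (simp add: gauss_def exp_add[symmetric])
      then have "(1 + norm x) ^ k * gauss x = ((1 + norm x) ^ k * exp (- (norm x)\<^sup>2 / 4)) * exp (- (norm x)\<^sup>2 / 4)"
        by simp
      also have "\<dots> \<le> C * exp (- (norm x)\<^sup>2 / 4)"
        by (intro mult_right_mono C) auto
      finally show "norm ((1 + norm x) ^ k * gauss x) \<le> norm (C * ?g x)"
        unfolding g by (simp add: C_def)
    qed
  qed simp
qed

lemma integrable_gauss_bound:
  fixes h :: "'a::euclidean_space \<Rightarrow> real"
  assumes [measurable]: "h \<in> borel_measurable borel"
    and "\<And>x. \<bar>h x\<bar> \<le> C * (1 + norm x) ^ k"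
  shows "integrable lborel (\<lambda>x. h x * gauss x)"
proof (rule Bochner_Integration.integrable_bound)
  show "integrable lborel (\<lambda>x::'a. C * ((1 + norm x) ^ k * gauss x))"
    by (intro integrable_mult_right integrable_gauss_moment)
  show "AE x in lborel. norm (h x * gauss x) \<le> norm (C * ((1 + norm x) ^ k * gauss x))"
  proof (rule AE_I2)
    fix x :: 'a
    have "\<bar>h x\<bar> * gauss x \<le> (C * (1 + norm x) ^ k) * gauss x"
      by (intro mult_right_mono assms(2)) simp
    also have "\<dots> \<le> \<bar>C * ((1 + norm x) ^ k * gauss x)\<bar>"
      by (simp add: mult.assoc)
    finally show "norm (h x * gauss x) \<le> norm (C * ((1 + norm x) ^ k * gauss x))"
      by (simp add: abs_mult)
  qed
qed simp

section \<open>Lebesgue measure under translations, dilations and rotations\<close>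

lemma integral_lborel_translate:
  fixes h :: "'a::euclidean_space \<Rightarrow> real"
  assumes [measurable]: "h \<in> borel_measurable borel"
  shows "(\<integral>x. h (x + v) \<partial>lborel) = (\<integral>x. h x \<partial>lborel)"
    and "integrable lborel (\<lambda>x. h (x + v)) \<longleftrightarrow> integrable lborel h"
proof -
  have D: "lborel = distr lborel borel ((+) v)" by (simp add: lborel_distr_plus)
  show "(\<integral>x. h (x + v) \<partial>lborel) = (\<integral>x. h x \<partial>lborel)"
    by (subst (2) D, subst integral_distr) (auto simp: add.commute)
  show "integrable lborel (\<lambda>x. h (x + v)) \<longleftrightarrow> integrable lborel h"
    by (subst (2) D, subst integrable_distr_eq) (auto simp: add.commute)
qed

lemma nn_integral_lborel_affine:
  fixes g :: "'a::euclidean_space \<Rightarrow> ennreal"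
  assumes [measurable]: "g \<in> borel_measurable borel" and c: "c \<noteq> 0"
  shows "(\<integral>\<^sup>+x. g x \<partial>lborel) = ennreal (\<bar>c\<bar> ^ DIM('a)) * (\<integral>\<^sup>+x. g (t + c *\<^sub>R x) \<partial>lborel)"
  by (subst lborel_affine[OF c, of t])
    (simp add: nn_integral_density nn_integral_distr nn_integral_cmult)

text \<open>Along this rotation the derivative of the first component in \<open>t\<close> is the
  second component, and at \<open>t = pi/2\<close> the first component has become
  \<open>snd p\<close>. The path of the first component thus joins two independent points.\<close>

definition rot :: "real \<Rightarrow> 'a \<times> 'a \<Rightarrow> 'a::euclidean_space \<times> 'a" where
  "rot t p = (cos t *\<^sub>R fst p + sin t *\<^sub>R snd p, - sin t *\<^sub>R fst p + cos t *\<^sub>R snd p)"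

lemma continuous_on_rot [continuous_intros]:
  fixes f :: "'b::t2_space \<Rightarrow> real"
  shows "continuous_on S f \<Longrightarrow> continuous_on S g \<Longrightarrow> continuous_on S (\<lambda>x. rot (f x) (g x))"
  unfolding rot_def by (intro continuous_intros)

lemma borel_measurable_rot [measurable]: "rot t \<in> borel_measurable borel"
  by (intro borel_measurable_continuous_onI continuous_intros)

lemma rot_rot: "rot s (rot t p) = rot (s + t) p"
  by (simp add: rot_def cos_add sin_add algebra_simps)

lemma rot_0 [simp]: "rot 0 p = p"
  by (simp add: rot_def)

lemma norm_rot [simp]: "norm (rot t p) = norm p"
proof -
  have *: "(c *\<^sub>R x + s *\<^sub>R y) \<bullet> (c *\<^sub>R x + s *\<^sub>R y) + (c *\<^sub>R y - s *\<^sub>R x) \<bullet> (c *\<^sub>R y - s *\<^sub>R x) =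
    (c\<^sup>2 + s\<^sup>2) * (x \<bullet> x + y \<bullet> y)" for c s :: real and x y :: 'a
    by (simp add: inner_add_left inner_add_right inner_diff_left inner_diff_right inner_commute
        algebra_simps power2_eq_square)
  show ?thesis
    using *[of "cos t" "fst p" "sin t" "snd p"]
    by (simp add: norm_eq_sqrt_inner rot_def inner_prod_def)
qed

lemma gauss_rot [simp]: "gauss (rot t p) = gauss p"
  by (simp add: gauss_def)

text \<open>If \<open>cos t\<close> is not 0, the rotation is carried out one variable at a time:
  first \<open>x\<close> is replaced by the new first component for fixed \<open>y\<close>, then
  \<open>y\<close> for fixed first component. The Jacobians \<open>|c| ^ DIM('a)\<close> and
  \<open>(1 / |c|) ^ DIM('a)\<close> cancel. If \<open>cos t = 0\<close>, the rotation is the square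
  of the one by \<open>t / 2\<close>, and \<open>cos t = 2 (cos (t / 2))^2 - 1\<close> shows that
  the first case applies to it.\<close>

lemma distr_rot: "distr lborel borel (rot t) = (lborel :: ('a::euclidean_space \<times> 'a) measure)"
proof -
  have 1: "distr lborel borel (rot t) = (lborel :: ('a \<times> 'a) measure)" if c0: "cos t \<noteq> 0" for t
  proof (rule measure_eqI)
    fix A :: "('a \<times> 'a) set" assume "A \<in> sets (distr lborel borel (rot t))"
    then have A: "A \<in> sets borel" by simp
    define h :: "'a \<times> 'a \<Rightarrow> ennreal" where "h = indicator A"
    have h: "h \<in> borel_measurable borel" using A by (simp add: h_def)
    define c s where "c = cos t" and "s = sin t"
    have cs: "c * c + s * s = 1" and c: "c \<noteq> 0"
      using sin_cos_squared_add2[of t] c0 by (auto simp: c_def s_def power2_eq_square)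
    have hc: "(\<lambda>x. h (f x)) \<in> borel_measurable borel" if "continuous_on UNIV f" for f :: "'b::euclidean_space \<Rightarrow> 'a \<times> 'a"
      using measurable_compose[OF borel_measurable_continuous_onI[OF that] h] .
    have swap: "(\<integral>\<^sup>+y. \<integral>\<^sup>+x. g (x, y) \<partial>lborel \<partial>lborel) = (\<integral>\<^sup>+p. g p \<partial>lborel)"
      "(\<integral>\<^sup>+x. \<integral>\<^sup>+y. g (x, y) \<partial>lborel \<partial>lborel) = (\<integral>\<^sup>+p. g p \<partial>lborel)"
      if "g \<in> borel_measurable borel" for g :: "'a \<times> 'a \<Rightarrow> ennreal"
      using that lborel_pair.nn_integral_snd[of g] lborel.nn_integral_fst[of g lborel]
      by (simp_all add: lborel_prod)
    have inv: "ennreal (\<bar>c\<bar> ^ DIM('a)) * (ennreal ((1 / \<bar>c\<bar>) ^ DIM('a)) * z) = z" for z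
      using c by (simp add: mult.assoc[symmetric] ennreal_mult[symmetric] power_mult_distrib[symmetric])
    have "ennreal (\<bar>c\<bar> ^ DIM('a)) * (\<integral>\<^sup>+p. h (rot t p) \<partial>lborel) =
      ennreal (\<bar>c\<bar> ^ DIM('a)) * (\<integral>\<^sup>+y. \<integral>\<^sup>+x. h (rot t (x, y)) \<partial>lborel \<partial>lborel)"
      by (subst swap) (auto intro!: hc continuous_intros)
    also have "\<dots> = (\<integral>\<^sup>+y. ennreal (\<bar>c\<bar> ^ DIM('a)) * (\<integral>\<^sup>+x. h (rot t (x, y)) \<partial>lborel) \<partial>lborel)"
    proof (rule nn_integral_cmult[symmetric])
      have "(\<lambda>(y, x). h (rot t (x, y))) \<in> borel_measurable (lborel \<Otimes>\<^sub>M lborel)"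
        unfolding lborel_prod using hc[of "\<lambda>q. rot t (snd q, fst q)"]
        by (simp add: case_prod_beta continuous_intros)
      then show "(\<lambda>y. \<integral>\<^sup>+x. h (rot t (x, y)) \<partial>lborel) \<in> borel_measurable lborel"
        by (rule lborel.borel_measurable_nn_integral)
    qed
    also have "\<dots> = (\<integral>\<^sup>+y. \<integral>\<^sup>+x. h (x, (1 / c) *\<^sub>R y - (s / c) *\<^sub>R x) \<partial>lborel \<partial>lborel)"
    proof (rule nn_integral_cong)
      fix y :: 'a
      define g where "g x = h (x, (1 / c) *\<^sub>R y - (s / c) *\<^sub>R x)" for x
      have "g (s *\<^sub>R y + c *\<^sub>R x) = h (rot t (x, y))" for x
      proof -
        have "(1 / c) *\<^sub>R y - (s / c) *\<^sub>R (s *\<^sub>R y + c *\<^sub>R x) = ((1 - s * s) / c) *\<^sub>R y - s *\<^sub>R x"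
          using c by (simp add: algebra_simps diff_divide_distrib)
        also have "(1 - s * s) / c = c" using cs c by (simp add: field_simps)
        finally have "(1 / c) *\<^sub>R y - (s / c) *\<^sub>R (s *\<^sub>R y + c *\<^sub>R x) = - s *\<^sub>R x + c *\<^sub>R y"
          by simp
        then show ?thesis
          unfolding g_def rot_def c_def s_def by (simp only: fst_conv snd_conv add.commute)
      qed
      then show "ennreal (\<bar>c\<bar> ^ DIM('a)) * (\<integral>\<^sup>+x. h (rot t (x, y)) \<partial>lborel) = (\<integral>\<^sup>+x. g x \<partial>lborel)"
        using nn_integral_lborel_affine[of g c "s *\<^sub>R y"] c
        unfolding g_def by (simp add: hc continuous_intros)
    qed
    also have "\<dots> = (\<integral>\<^sup>+x. \<integral>\<^sup>+y. h (x, (1 / c) *\<^sub>R y - (s / c) *\<^sub>R x) \<partial>lborel \<partial>lborel)"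
      using swap[of "\<lambda>(x, y). h (x, (1 / c) *\<^sub>R y - (s / c) *\<^sub>R x)"]
        hc[of "\<lambda>p. (fst p, (1 / c) *\<^sub>R snd p - (s / c) *\<^sub>R fst p)"]
      by (simp add: case_prod_beta continuous_intros)
    also have "\<dots> = (\<integral>\<^sup>+x. ennreal (\<bar>c\<bar> ^ DIM('a)) * (\<integral>\<^sup>+y. h (x, y) \<partial>lborel) \<partial>lborel)"
    proof (rule nn_integral_cong)
      fix x :: 'a
      show "(\<integral>\<^sup>+y. h (x, (1 / c) *\<^sub>R y - (s / c) *\<^sub>R x) \<partial>lborel) =
        ennreal (\<bar>c\<bar> ^ DIM('a)) * (\<integral>\<^sup>+y. h (x, y) \<partial>lborel)"
        using nn_integral_lborel_affine[of "\<lambda>y. h (x, y)" "1 / c" "- (s / c) *\<^sub>R x"] c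
        by (simp add: hc continuous_intros inv)
    qed
    also have "\<dots> = ennreal (\<bar>c\<bar> ^ DIM('a)) * (\<integral>\<^sup>+p. h p \<partial>lborel)"
    proof -
      have "(\<lambda>x. \<integral>\<^sup>+y. h (x, y) \<partial>lborel) \<in> borel_measurable lborel"
        using lborel.borel_measurable_nn_integral_fst[of h lborel] h by (simp add: lborel_prod)
      then show ?thesis using swap(2)[OF h] by (simp add: nn_integral_cmult)
    qed
    finally have "(\<integral>\<^sup>+p. h (rot t p) \<partial>lborel) = (\<integral>\<^sup>+p. h p \<partial>lborel)"
      using c by (simp add: ennreal_mult_cancel_left)
    then show "emeasure (distr lborel borel (rot t)) A = emeasure lborel A"
      using A nn_integral_distr[of "rot t" lborel borel h]
      by (simp add: h_def)
  qed simp
  show ?thesis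
  proof (cases "cos t = 0")
    case True
    then have c: "cos (t / 2) \<noteq> 0"
      using cos_double_cos[of "t / 2"] by auto
    have "rot t = rot (t / 2) \<circ> (rot (t / 2) :: 'a \<times> 'a \<Rightarrow> _)"
      by (auto simp: fun_eq_iff rot_rot)
    then have "distr lborel borel (rot t) = distr (distr lborel borel (rot (t / 2))) borel (rot (t / 2) :: 'a \<times> 'a \<Rightarrow> _)"
      by (simp add: distr_distr)
    then show ?thesis using 1[OF c] by simp
  qed (rule 1)
qed

lemma integral_rot:
  fixes h :: "'a::euclidean_space \<times> 'a \<Rightarrow> real"
  assumes [measurable]: "h \<in> borel_measurable borel"
  shows "(\<integral>p. h (rot t p) \<partial>lborel) = (\<integral>p. h p \<partial>lborel)"
    and "integrable lborel (\<lambda>p. h (rot t p)) \<longleftrightarrow> integrable lborel h"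
proof -
  show "(\<integral>p. h (rot t p) \<partial>lborel) = (\<integral>p. h p \<partial>lborel)"
    by (subst (2) distr_rot[of t, symmetric], subst integral_distr) auto
  show "integrable lborel (\<lambda>p. h (rot t p)) \<longleftrightarrow> integrable lborel h"
    by (subst (2) distr_rot[of t, symmetric], subst integrable_distr_eq) auto
qed

lemma gauss_le_1: "gauss x \<le> 1"
  by (simp add: gauss_def)

text \<open>The difference of the two integrands is the derivative \<open>k\<close> of
  \<open>G = F * gauss\<close> in direction \<open>v\<close>. By translation invariance
  \<open>k\<close> has the same integral as its average over the segment from \<open>b\<close> to
  \<open>b + v\<close>, and this average is \<open>G (b + v) - G b\<close>, whose integral is 0. For
  \<open>v\<close> not 0 each such segment meets \<open>S\<close> only finitely often.\<close>

lemma gauss_by_parts: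
  fixes F :: "'a::euclidean_space \<Rightarrow> real" and D :: "'a \<Rightarrow> 'a"
  assumes contF: "continuous_on UNIV F" and S: "finite S"
    and deriv: "\<And>b. b \<notin> S \<Longrightarrow> (F has_derivative (\<lambda>h. D b \<bullet> h)) (at b)"
    and D[measurable]: "D \<in> borel_measurable borel"
    and L: "\<And>b. norm (D b) \<le> L" and M: "\<And>b. \<bar>F b\<bar> \<le> M * (1 + norm b)"
  shows "(\<integral>b. F b * (b \<bullet> v) * gauss b \<partial>lborel) = (\<integral>b. (D b \<bullet> v) * gauss b \<partial>lborel)"
proof (cases "v = 0")
  case False
  have F[measurable]: "F \<in> borel_measurable borel"
    by (rule borel_measurable_continuous_onI[OF contF])
  have L0: "0 \<le> L" using L[of 0] norm_ge_zero order_trans by blast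
  have M0: "0 \<le> M" using M[of 0] by auto
  define K where "K = (L + M) * norm v"
  have K0: "0 \<le> K" using L0 M0 by (simp add: K_def)
  have b1: "\<bar>F b * (b \<bullet> v)\<bar> \<le> (M * norm v) * (1 + norm b) ^ 2" for b
  proof -
    have "\<bar>F b * (b \<bullet> v)\<bar> \<le> (M * (1 + norm b)) * (norm b * norm v)"
      unfolding abs_mult by (intro mult_mono M Cauchy_Schwarz_ineq2) (use M0 in auto)
    also have "\<dots> \<le> (M * (1 + norm b)) * ((1 + norm b) * norm v)"
      by (intro mult_left_mono mult_right_mono) (use M0 in auto)
    finally show ?thesis by (simp add: power2_eq_square algebra_simps)
  qed
  have b2: "\<bar>D b \<bullet> v\<bar> \<le> (L * norm v) * (1 + norm b) ^ 2" for b
  proof -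
    have "\<bar>D b \<bullet> v\<bar> \<le> L * norm v"
      using Cauchy_Schwarz_ineq2[of "D b" v] L[of b] by (meson mult_right_mono norm_ge_zero order_trans)
    also have "\<dots> \<le> (L * norm v) * (1 + norm b) ^ 2"
      by (rule mult_le_cancel_left1[THEN iffD2]) (use L0 in \<open>auto simp: one_le_power mult_less_0_iff\<close>)
    finally show ?thesis .
  qed
  have i1: "integrable lborel (\<lambda>b. F b * (b \<bullet> v) * gauss b)"
    by (rule integrable_gauss_bound[OF _ b1]) measurable
  have i2: "integrable lborel (\<lambda>b. (D b \<bullet> v) * gauss b)"
    by (rule integrable_gauss_bound[OF _ b2]) measurable
  define k where "k b = (D b \<bullet> v - F b * (b \<bullet> v)) * gauss b" for b
  have km[measurable]: "k \<in> borel_measurable borel" unfolding k_def by measurable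
  have ik: "integrable lborel k"
    unfolding k_def left_diff_distrib by (intro Bochner_Integration.integrable_diff i1 i2)
  have kb: "\<bar>k b\<bar> \<le> K * (1 + norm b) ^ 2" for b
  proof -
    have "\<bar>k b\<bar> \<le> \<bar>D b \<bullet> v - F b * (b \<bullet> v)\<bar> * 1"
      unfolding k_def abs_mult by (intro mult_left_mono) (auto simp: gauss_le_1)
    also have "\<dots> \<le> K * (1 + norm b) ^ 2"
      using b1[of b] b2[of b] by (simp add: K_def algebra_simps)
    finally show ?thesis .
  qed
  define G where "G b = F b * gauss b" for b
  have iG: "integrable lborel G"
    unfolding G_def by (rule integrable_gauss_bound[where C=M and k=1]) (use M in auto)
  have Gm[measurable]: "G \<in> borel_measurable borel" unfolding G_def by measurable
  have ftc: "(\<integral>t. indicator {0..1} t * k (b + t *\<^sub>R v) \<partial>lborel) = G (b + v) - G b" for b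
  proof -
    have "(\<integral>t. indicator {0..1} t * k (b + t *\<^sub>R v) \<partial>lborel) = G (b + 1 *\<^sub>R v) - G (b + 0 *\<^sub>R v)"
    proof (rule FTC_lborel[where f = "\<lambda>t. G (b + t *\<^sub>R v)" and S = "(\<lambda>t. b + t *\<^sub>R v) -` S"])
      show "finite ((\<lambda>t. b + t *\<^sub>R v) -` S)"
        by (rule finite_vimageI[OF S]) (use False in \<open>auto intro!: injI\<close>)
      show "continuous_on {0..1} (\<lambda>t. G (b + t *\<^sub>R v))"
        unfolding G_def
        by (intro continuous_intros continuous_on_compose2[OF contF]) auto
      show "((\<lambda>t. G (b + t *\<^sub>R v)) has_real_derivative k (b + t *\<^sub>R v)) (at t)"
        if "t \<in> {0<..<1} - (\<lambda>t. b + t *\<^sub>R v) -` S" for t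
      proof -
        have l: "((\<lambda>t. b + t *\<^sub>R v) has_derivative (\<lambda>h. h *\<^sub>R v)) (at t)"
          by (auto intro!: derivative_eq_intros)
        have 1: "((\<lambda>t. F (b + t *\<^sub>R v)) has_derivative (\<lambda>h. D (b + t *\<^sub>R v) \<bullet> (h *\<^sub>R v))) (at t)"
          using diff_chain_at[OF l deriv] that by (auto simp: o_def)
        have 2: "((\<lambda>t. gauss (b + t *\<^sub>R v)) has_derivative (\<lambda>h. - ((b + t *\<^sub>R v) \<bullet> (h *\<^sub>R v)) * gauss (b + t *\<^sub>R v))) (at t)"
          using diff_chain_at[OF l has_derivative_gauss] by (auto simp: o_def)
        show ?thesis
          unfolding G_def has_field_derivative_def
          by (rule has_derivative_eq_rhs[OF has_derivative_mult[OF 1 2]])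
            (auto simp: fun_eq_iff k_def algebra_simps)
      qed
      show "\<bar>k (b + t *\<^sub>R v)\<bar> \<le> K * (1 + (norm b + norm v)) ^ 2" if "t \<in> {0..1}" for t
      proof -
        have "norm (b + t *\<^sub>R v) \<le> norm b + \<bar>t\<bar> * norm v"
          using norm_triangle_ineq[of b "t *\<^sub>R v"] by simp
        also have "\<bar>t\<bar> * norm v \<le> norm v" using that by (auto intro: mult_left_le_one_le)
        finally have "K * (1 + norm (b + t *\<^sub>R v)) ^ 2 \<le> K * (1 + (norm b + norm v)) ^ 2"
          by (intro mult_left_mono power_mono) (use K0 in auto)
        then show ?thesis using kb order_trans by blast
      qed
    qed auto
    then show ?thesis by simp
  qed
  have "(\<integral>b. (\<integral>t. indicator {0..1} t * k (b + t *\<^sub>R v) \<partial>lborel) \<partial>lborel) =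
    (\<integral>t. indicator {0..1} t * (\<integral>b. k (b + t *\<^sub>R v) \<partial>lborel) \<partial>lborel)"
  proof (rule integral_interval_commute(1))
    have "(\<lambda>p::real \<times> 'a. snd p + fst p *\<^sub>R v) \<in> borel_measurable borel"
      by (intro borel_measurable_continuous_onI continuous_intros)
    from measurable_compose[OF this km]
    show "case_prod (\<lambda>t b. k (b + t *\<^sub>R v)) \<in> borel_measurable borel"
      by (simp add: case_prod_beta')
    show "integrable lborel (\<lambda>b. k (b + t *\<^sub>R v))" for t
      using integral_lborel_translate(2)[OF km] ik by simp
    show "(\<integral>p. \<bar>k (p + t *\<^sub>R v)\<bar> \<partial>lborel) \<le> (\<integral>p. \<bar>k p\<bar> \<partial>lborel)" for t
      using integral_lborel_translate(1)[of "\<lambda>p. \<bar>k p\<bar>" "t *\<^sub>R v"] by simp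
  qed
  also have "\<dots> = (\<integral>b. k b \<partial>lborel)"
    by (simp add: integral_lborel_translate(1)[OF km])
  also have "\<dots> = (\<integral>b. (D b \<bullet> v) * gauss b \<partial>lborel) - (\<integral>b. F b * (b \<bullet> v) * gauss b \<partial>lborel)"
    unfolding k_def left_diff_distrib by (intro Bochner_Integration.integral_diff i1 i2)
  finally have "\<dots> = (\<integral>b. G (b + v) - G b \<partial>lborel)"
    by (simp add: ftc)
  also have "\<dots> = 0"
    using iG by (subst Bochner_Integration.integral_diff)
      (auto simp: integral_lborel_translate[OF Gm])
  finally show ?thesis by simp
qed simp

lemma integral_gauss_pair:
  fixes h :: "'a::euclidean_space \<times> 'b::euclidean_space \<Rightarrow> real"
  assumes "integrable lborel (\<lambda>p. h p * gauss p)"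
  shows "(\<integral>p. h p * gauss p \<partial>lborel) = (\<integral>a. gauss a * (\<integral>b. h (a, b) * gauss b \<partial>lborel) \<partial>lborel)"
proof -
  have *: "integrable (lborel \<Otimes>\<^sub>M lborel) (\<lambda>p. h p * gauss p)"
    using assms by (simp add: lborel_prod)
  have e: "(\<integral>b. h (a, b) * gauss (a, b) \<partial>lborel) = gauss a * (\<integral>b. h (a, b) * gauss b \<partial>lborel)" for a
    unfolding gauss_Pair by (subst integral_mult_right_zero[symmetric]) (simp add: ac_simps)
  show "(\<integral>p. h p * gauss p \<partial>lborel) = (\<integral>a. gauss a * (\<integral>b. h (a, b) * gauss b \<partial>lborel) \<partial>lborel)"
    using lborel_pair.integral_fst'[OF *] by (simp add: e lborel_prod)
qed

lemma integrable_gauss: "integrable lborel gauss"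
  using integrable_gauss_moment[of 0] by simp

lemma integral_gauss_pos: "0 < (\<integral>x. gauss (x::'a::euclidean_space) \<partial>lborel)"
proof -
  have "(\<integral>x. gauss (x::'a) \<partial>lborel) \<noteq> 0"
  proof
    assume "(\<integral>x. gauss (x::'a) \<partial>lborel) = 0"
    then have "AE x::'a in lborel. gauss x = 0"
      by (subst (asm) integral_nonneg_eq_0_iff_AE) (auto simp: integrable_gauss)
    then have "AE x::'a in lborel. False"
      by (rule AE_mp) (auto intro!: AE_I2 simp: less_imp_neq[symmetric])
    then show False by (simp add: eventually_False ae_filter_eq_bot_iff)
  qed
  then show ?thesis
    by (simp add: less_le integral_nonneg_AE)
qed

section \<open>The Gaussian Poincare inequality\<close>

text \<open>The path \<open>x_t = fst (rot t (x, y))\<close> leads from \<open>x\<close> to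
  \<open>y\<close>, so \<open>F x * (F y - F x)\<close> is the integral over \<open>t\<close> of
  \<open>F x\<close> times the derivative of \<open>F x_t\<close>. Rotating back leaves that
  derivative as \<open>D (fst p)\<close> against \<open>snd p\<close>, and integration by parts in
  the second variable produces \<open>- sin t\<close> and another gradient. The pairing of the two
  gradients is at most the energy, and \<open>sin\<close> has integral 1 over
  \<open>{0..pi/2}\<close>, which gives the sharp constant 1. On the other side, mean zero removes
  \<open>F x * F y\<close> and leaves minus the second moment.\<close>

theorem gauss_Poincare:
  fixes F :: "'a::euclidean_space \<Rightarrow> real" and D :: "'a \<Rightarrow> 'a"
  assumes contF: "continuous_on UNIV F"
    and deriv: "\<And>b. b \<noteq> 0 \<Longrightarrow> (F has_derivative (\<lambda>h. D b \<bullet> h)) (at b)"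
    and D[measurable]: "D \<in> borel_measurable borel"
    and L: "\<And>b. norm (D b) \<le> L" and M: "\<And>b. \<bar>F b\<bar> \<le> M * (1 + norm b)"
    and mean0: "(\<integral>x. F x * gauss x \<partial>lborel) = 0"
  shows "(\<integral>x. (F x)\<^sup>2 * gauss x \<partial>lborel) \<le> (\<integral>x. (norm (D x))\<^sup>2 * gauss x \<partial>lborel)"
proof -
  have F[measurable]: "F \<in> borel_measurable borel"
    by (rule borel_measurable_continuous_onI[OF contF])
  have L0: "0 \<le> L" using L[of 0] norm_ge_zero order_trans by blast
  have M0: "0 \<le> M" using M[of 0] by auto
  have comp: "(\<lambda>p. F (g p)) \<in> borel_measurable borel" "(\<lambda>p. D (g p)) \<in> borel_measurable borel"
    "(\<lambda>p. (norm (D (g p)))\<^sup>2) \<in> borel_measurable borel"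
    if "continuous_on UNIV g" for g :: "'b::euclidean_space \<Rightarrow> 'a"
    using borel_measurable_continuous_onI[OF that] by measurable
  define Z where "Z = (\<integral>x. gauss (x::'a) \<partial>lborel)"
  define E where "E = (\<integral>x. (norm (D x))\<^sup>2 * gauss x \<partial>lborel)"
  have Z: "0 < Z" unfolding Z_def by (rule integral_gauss_pos)
  have fst_le: "norm (fst p) \<le> norm p" and snd_le: "norm (snd p) \<le> norm p" for p :: "'a \<times> 'a"
    using norm_fst_le[of "fst p" "snd p"] norm_snd_le[of "snd p" "fst p"] by auto
  define H where "H t p = F (fst p) * (D (fst (rot t p)) \<bullet> snd (rot t p)) * gauss p" for t and p :: "'a \<times> 'a"
  \<comment> \<open>\<open>K t\<close> is the integrand \<open>H t\<close> in rotated variables. Now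
    \<open>snd p\<close> occurs as a bare Gaussian factor next to \<open>D (fst p)\<close>, which is
    constant when integrating over the second variable.\<close>
  define K where "K t p = F (fst (rot (- t) p)) * (D (fst p) \<bullet> snd p)" for t and p :: "'a \<times> 'a"
  have Km: "K t \<in> borel_measurable borel" for t
    unfolding K_def
  proof (rule borel_measurable_times)
    show "(\<lambda>p::'a \<times> 'a. F (fst (rot (- t) p))) \<in> borel_measurable borel"
      by (rule comp) (intro continuous_intros)
    show "(\<lambda>p::'a \<times> 'a. D (fst p) \<bullet> snd p) \<in> borel_measurable borel"
      by (rule borel_measurable_inner, rule comp, intro continuous_intros)
        (intro borel_measurable_continuous_onI continuous_intros)
  qed
  have HK: "H t p = K t (rot t p) * gauss (rot t p)" for t p
    by (simp only: H_def K_def rot_rot gauss_rot add.left_inverse rot_0)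
  have Kb: "\<bar>K t p\<bar> \<le> (M * L) * (1 + norm p) ^ 2" for t p
  proof -
    have 1: "\<bar>F (fst (rot (- t) p))\<bar> \<le> M * (1 + norm p)"
      by (rule order_trans[OF M]) (intro mult_left_mono add_left_mono M0, use fst_le[of "rot (- t) p"] in simp)
    have 2: "\<bar>D (fst p) \<bullet> snd p\<bar> \<le> L * (1 + norm p)"
    proof -
      have "\<bar>D (fst p) \<bullet> snd p\<bar> \<le> norm (D (fst p)) * norm (snd p)" by (rule Cauchy_Schwarz_ineq2)
      also have "\<dots> \<le> L * (1 + norm p)"
        using snd_le[of p] L0 by (intro mult_mono L) auto
      finally show ?thesis .
    qed
    have "\<bar>K t p\<bar> \<le> (M * (1 + norm p)) * (L * (1 + norm p))"
      unfolding K_def abs_mult using M0 by (intro mult_mono 1 2) auto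
    then show ?thesis by (simp add: power2_eq_square ac_simps)
  qed
  have Ki: "integrable lborel (\<lambda>p. K t p * gauss p)" for t
    by (rule integrable_gauss_bound[OF Km Kb])
  have KGm: "(\<lambda>p. K t p * gauss p) \<in> borel_measurable borel" for t
    by (intro borel_measurable_times Km) simp
  have D2m: "(\<lambda>p::'a \<times> 'a. (norm (D (fst p)))\<^sup>2 * gauss p) \<in> borel_measurable borel"
    by (intro borel_measurable_times comp(3)[of fst] borel_measurable_gauss continuous_intros)
  have D2b: "\<bar>(norm (D x))\<^sup>2\<bar> \<le> L\<^sup>2 * (1 + norm y) ^ 0" for x and y :: "'b::real_normed_vector"
    using L[of x] by (auto intro!: power_mono)
  have D2pi: "integrable lborel (\<lambda>p. (norm (D (fst (rot t p))))\<^sup>2 * gauss p)" for t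
    by (rule integrable_gauss_bound[where k=0, OF _ D2b]) (intro comp(3) continuous_intros)
  have D2p: "(\<integral>p. (norm (D (fst (rot t p))))\<^sup>2 * gauss p \<partial>lborel) = Z * E" for t
  proof -
    have "(\<integral>p. (norm (D (fst (rot t p))))\<^sup>2 * gauss p \<partial>lborel) = (\<integral>p. (norm (D (fst p)))\<^sup>2 * gauss (p::'a \<times> 'a) \<partial>lborel)"
      using integral_rot(1)[OF D2m, of t] by simp
    also have "\<dots> = (\<integral>a. gauss a * (\<integral>b. (norm (D a))\<^sup>2 * gauss (b::'a) \<partial>lborel) \<partial>lborel)"
      using integral_gauss_pair[of "\<lambda>p::'a \<times> 'a. (norm (D (fst p)))\<^sup>2"] D2pi[of 0] by simp
    also have "\<dots> = Z * E"
    proof -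
      have "gauss a * (\<integral>b. (norm (D a))\<^sup>2 * gauss (b::'a) \<partial>lborel) = Z * ((norm (D a))\<^sup>2 * gauss a)" for a
        by (simp add: Z_def)
      then show ?thesis unfolding E_def by (simp only: integral_mult_right_zero)
    qed
    finally show ?thesis .
  qed
  have Hi: "integrable lborel (H t)" for t
    using integral_rot(2)[OF KGm, of t t] Ki[of t] unfolding HK[abs_def] by simp
  have Hint: "(\<integral>p. H t p \<partial>lborel) = (\<integral>p. K t p * gauss p \<partial>lborel)" for t
    using integral_rot(1)[OF KGm, of t t] by (simp add: HK)
  have parts: "(\<integral>p. K t p * gauss p \<partial>lborel) =
    - sin t * (\<integral>p. (D (fst (rot (- t) p)) \<bullet> D (fst p)) * gauss p \<partial>lborel)" for t
  proof -
    have inner: "(\<integral>b. K t (a, b) * gauss b \<partial>lborel) =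
      (\<integral>b. (- sin t * (D (fst (rot (- t) (a, b))) \<bullet> D a)) * gauss b \<partial>lborel)" for a
    proof -
      let ?z = "\<lambda>b. cos t *\<^sub>R a - sin t *\<^sub>R b"
      have z: "fst (rot (- t) (a, b)) = ?z b" for b by (simp add: rot_def)
      \<comment> \<open>If \<open>sin t = 0\<close>, then \<open>?z\<close> does not depend on
        \<open>b\<close> and its composition with \<open>F\<close> is constant, even when it sits at
        the kink. Otherwise \<open>?z\<close> vanishes at exactly one point.\<close>
      define S where "S = (if sin t = 0 then {} else {b. ?z b = 0})"
      have "(\<integral>b. F (?z b) * (b \<bullet> D a) * gauss b \<partial>lborel) = (\<integral>b. ((- sin t *\<^sub>R D (?z b)) \<bullet> D a) * gauss b \<partial>lborel)"
      proof (rule gauss_by_parts[where S=S])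
        show "continuous_on UNIV (\<lambda>b. F (?z b))"
          by (intro continuous_on_compose2[OF contF] continuous_intros) auto
        show "finite S"
        proof (cases "sin t = 0")
          case False
          have "b = (cos t / sin t) *\<^sub>R a" if "?z b = 0" for b
          proof -
            have "(1 / sin t) *\<^sub>R (sin t *\<^sub>R b) = (1 / sin t) *\<^sub>R (cos t *\<^sub>R a)" using that by simp
            then show ?thesis using False by simp
          qed
          then have "S \<subseteq> {(cos t / sin t) *\<^sub>R a}"
            using False by (auto simp: S_def)
          then show ?thesis by (rule finite_subset) simp
        qed (simp add: S_def)
        show "((\<lambda>b. F (?z b)) has_derivative (\<lambda>h. (- sin t *\<^sub>R D (?z b)) \<bullet> h)) (at b)" if "b \<notin> S" for b
        proof (cases "sin t = 0")
          case True
          then show ?thesis by simp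
        next
          case False
          have l: "(?z has_derivative (\<lambda>h. - sin t *\<^sub>R h)) (at b)"
            by (auto intro!: derivative_eq_intros)
          show ?thesis
            using diff_chain_at[OF l deriv] that False by (simp add: o_def S_def)
        qed
        show "norm (- sin t *\<^sub>R D (?z b)) \<le> L" for b
          using mult_left_le_one_le[of "norm (D (?z b))" "\<bar>sin t\<bar>"] L[of "?z b"] by simp
        show "\<bar>F (?z b)\<bar> \<le> (M * (1 + norm a)) * (1 + norm b)" for b
        proof -
          have "norm (?z b) \<le> \<bar>cos t\<bar> * norm a + \<bar>sin t\<bar> * norm b"
            using norm_triangle_ineq4[of "cos t *\<^sub>R a" "sin t *\<^sub>R b"] by simp
          also have "\<dots> \<le> norm a + norm b"
            by (intro add_mono mult_left_le_one_le) auto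
          finally have "1 + norm (?z b) \<le> (1 + norm a) * (1 + norm b)"
            by (simp add: distrib_left distrib_right)
              (meson add_increasing2 mult_nonneg_nonneg norm_ge_zero order_refl order_trans add_mono)
          then have "M * (1 + norm (?z b)) \<le> M * ((1 + norm a) * (1 + norm b))"
            by (intro mult_left_mono M0)
          then show ?thesis using M[of "?z b"] by (simp add: mult.assoc)
        qed
      qed simp
      then show ?thesis by (simp add: K_def z inner_commute)
    qed
    have bb: "\<bar>D (fst (rot (- t) p)) \<bullet> D (fst p)\<bar> \<le> L\<^sup>2 * (1 + norm p) ^ 0" for p
    proof -
      have "\<bar>D (fst (rot (- t) p)) \<bullet> D (fst p)\<bar> \<le> norm (D (fst (rot (- t) p))) * norm (D (fst p))"
        by (rule Cauchy_Schwarz_ineq2)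
      also have "\<dots> \<le> L * L" using L0 by (intro mult_mono L) auto
      finally show ?thesis by (simp add: power2_eq_square)
    qed
    have i: "integrable lborel (\<lambda>p. (D (fst (rot (- t) p)) \<bullet> D (fst p)) * gauss p)"
      by (rule integrable_gauss_bound[OF _ bb]) (intro borel_measurable_inner comp(2)[of "\<lambda>p. fst (rot (- t) p)"]
          comp(2)[of fst] continuous_intros)
    have "(\<integral>p. K t p * gauss p \<partial>lborel) = (\<integral>a. gauss a * (\<integral>b. K t (a, b) * gauss b \<partial>lborel) \<partial>lborel)"
      by (rule integral_gauss_pair[OF Ki])
    also have "\<dots> = (\<integral>p. (- sin t * (D (fst (rot (- t) p)) \<bullet> D (fst p))) * gauss p \<partial>lborel)"
      unfolding inner using integral_gauss_pair[of "\<lambda>p. - sin t * (D (fst (rot (- t) p)) \<bullet> D (fst p))"] i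
      by (simp add: mult.assoc)
    also have "\<dots> = - sin t * (\<integral>p. (D (fst (rot (- t) p)) \<bullet> D (fst p)) * gauss p \<partial>lborel)"
      by (simp only: mult.assoc integral_mult_right_zero)
    finally show ?thesis .
  qed
  \<comment> \<open>By rotation invariance both squares have the integral \<open>Z * E\<close>, so
    bounding the product pointwise by half their sum is as good as the Cauchy-Schwarz
    inequality.\<close>
  have CS: "(\<integral>p. (D (fst (rot (- t) p)) \<bullet> D (fst p)) * gauss p \<partial>lborel) \<le> Z * E" for t
  proof -
    have "(\<integral>p. (D (fst (rot (- t) p)) \<bullet> D (fst p)) * gauss p \<partial>lborel) \<le>
      (\<integral>p. (1/2) * ((norm (D (fst (rot (- t) p))))\<^sup>2 * gauss p) + (1/2) * ((norm (D (fst (rot 0 p))))\<^sup>2 * gauss p) \<partial>lborel)"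
    proof (rule integral_mono')
      show "integrable lborel (\<lambda>p. (1/2) * ((norm (D (fst (rot (- t) p))))\<^sup>2 * gauss p) + (1/2) * ((norm (D (fst (rot 0 p))))\<^sup>2 * gauss p))"
        by (intro Bochner_Integration.integrable_add integrable_mult_right D2pi)
      fix p :: "'a \<times> 'a"
      let ?x = "D (fst (rot (- t) p))" and ?y = "D (fst p)"
      have "0 \<le> (norm (?x - ?y))\<^sup>2" by simp
      then have "?x \<bullet> ?y \<le> (1/2) * (norm ?x)\<^sup>2 + (1/2) * (norm ?y)\<^sup>2"
        by (simp add: power2_norm_eq_inner inner_diff_left inner_diff_right inner_commute)
      then have "(?x \<bullet> ?y) * gauss p \<le> ((1/2) * (norm ?x)\<^sup>2 + (1/2) * (norm ?y)\<^sup>2) * gauss p"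
        by (intro mult_right_mono) auto
      then show "(?x \<bullet> ?y) * gauss p \<le> (1/2) * ((norm ?x)\<^sup>2 * gauss p) + (1/2) * ((norm (D (fst (rot 0 p))))\<^sup>2 * gauss p)"
        by (simp add: algebra_simps)
    qed (auto intro!: add_nonneg_nonneg)
    also have "\<dots> = (1/2) * (Z * E) + (1/2) * (Z * E)"
      by (subst Bochner_Integration.integral_add)
        (auto simp only: integral_mult_right_zero D2p intro!: integrable_mult_right D2pi)
    finally show ?thesis by (simp add: mult.commute)
  qed
  have ftc: "(\<integral>t. indicator {0..pi/2} t * H t p \<partial>lborel) = F (fst p) * (F (snd p) - F (fst p)) * gauss p" for p
  proof -
    obtain x y where p: "p = (x, y)" by (cases p)
    have "(\<integral>t. indicator {0..pi/2} t * (D (fst (rot t p)) \<bullet> snd (rot t p)) \<partial>lborel) =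
      F (fst (rot (pi/2) p)) - F (fst (rot 0 p))"
    \<comment> \<open>For \<open>p = 0\<close> the path stays at the kink and the function is
      constant. Otherwise it passes through 0 at most once during the open quarter turn: two such
      times \<open>t\<close>, \<open>t'\<close> force \<open>sin (t - t') = 0\<close>.\<close>
    proof (rule FTC_lborel[where f = "\<lambda>t. F (fst (rot t p))" and S = "if p = 0 then {} else {t \<in> {0<..<pi/2}. fst (rot t p) = 0}"])
      show "finite (if p = 0 then {} else {t \<in> {0<..<pi/2}. fst (rot t p) = 0})"
      proof (cases "p = 0")
        case False
        have "t = t'" if t: "t \<in> {0<..<pi/2}" "fst (rot t p) = 0" and t': "t' \<in> {0<..<pi/2}" "fst (rot t' p) = 0" for t t'
        proof -
          have 1: "cos t *\<^sub>R x = - sin t *\<^sub>R y" and 2: "cos t' *\<^sub>R x = - sin t' *\<^sub>R y"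
            using t(2) t'(2) by (simp_all add: rot_def p eq_neg_iff_add_eq_0)
          have "sin (t - t') *\<^sub>R y = cos t' *\<^sub>R (sin t *\<^sub>R y) - cos t *\<^sub>R (sin t' *\<^sub>R y)"
            by (simp add: sin_diff scaleR_left_diff_distrib mult.commute)
          also have "\<dots> = - (cos t' *\<^sub>R cos t *\<^sub>R x) + cos t *\<^sub>R cos t' *\<^sub>R x"
            unfolding 1 2 by simp
          finally have s: "sin (t - t') *\<^sub>R y = 0" by (simp add: mult.commute)
          have "cos t > 0" using t(1) by (auto intro: cos_gt_zero)
          then have "y \<noteq> 0" using False 1 by (auto simp: p zero_prod_def)
          then have "sin (t - t') = 0" using s by simp
          then show "t = t'"
            using t(1) t'(1) sin_eq_0_pi[of "t - t'"] by auto
        qed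
        then have "{t \<in> {0<..<pi/2}. fst (rot t p) = 0} \<subseteq> {SOME t. t \<in> {0<..<pi/2} \<and> fst (rot t p) = 0}"
          by (smt (verit, best) insertI1 mem_Collect_eq someI_ex subsetI)
        then show ?thesis using False by (auto intro: finite_subset)
      qed simp
      show "continuous_on {0..pi/2} (\<lambda>t. F (fst (rot t p)))"
        by (intro continuous_on_compose2[OF contF] continuous_intros) auto
      show "((\<lambda>t. F (fst (rot t p))) has_real_derivative D (fst (rot t p)) \<bullet> snd (rot t p)) (at t)"
        if t: "t \<in> {0<..<pi/2} - (if p = 0 then {} else {t \<in> {0<..<pi/2}. fst (rot t p) = 0})" for t
      proof (cases "p = 0")
        case True
        then show ?thesis by (simp add: rot_def)
      next
        case False
        have l: "((\<lambda>t. fst (rot t p)) has_derivative (\<lambda>h. h *\<^sub>R snd (rot t p))) (at t)"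
          unfolding rot_def by (auto intro!: derivative_eq_intros simp: algebra_simps)
        have nz: "fst (rot t p) \<noteq> 0" using t False by auto
        show ?thesis unfolding has_field_derivative_def
          by (rule has_derivative_eq_rhs[OF diff_chain_at[OF l deriv[OF nz], unfolded o_def]])
            (simp add: fun_eq_iff mult.commute)
      qed
      show "(\<lambda>t. D (fst (rot t p)) \<bullet> snd (rot t p)) \<in> borel_measurable borel"
        by (intro borel_measurable_inner comp(2)[of "\<lambda>t. fst (rot t p)"]
            borel_measurable_continuous_onI[of "\<lambda>t. snd (rot t p)"] continuous_intros)
      show "\<bar>D (fst (rot t p)) \<bullet> snd (rot t p)\<bar> \<le> L * norm p" for t
        using Cauchy_Schwarz_ineq2[of "D (fst (rot t p))" "snd (rot t p)"] snd_le[of "rot t p"] L0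
        by (auto intro!: order_trans[OF Cauchy_Schwarz_ineq2] mult_mono L)
    qed auto
    also have "\<dots> = F (snd p) - F (fst p)" by (simp add: rot_def)
    finally have e: "(\<integral>t. indicator {0..pi/2} t * (D (fst (rot t p)) \<bullet> snd (rot t p)) \<partial>lborel) = F (snd p) - F (fst p)" .
    have "(\<integral>t. indicator {0..pi/2} t * H t p \<partial>lborel) =
      (\<integral>t. (F (fst p) * gauss p) * (indicator {0..pi/2} t * (D (fst (rot t p)) \<bullet> snd (rot t p))) \<partial>lborel)"
      by (simp add: H_def ac_simps)
    also have "\<dots> = (F (fst p) * gauss p) * (F (snd p) - F (fst p))"
      by (simp only: integral_mult_right_zero e)
    finally show ?thesis by simp
  qed
  have comm: "(\<integral>p. F (fst p) * (F (snd p) - F (fst p)) * gauss p \<partial>lborel) =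
      (\<integral>t. indicator {0..pi/2} t * (\<integral>p. H t p \<partial>lborel) \<partial>lborel)"
    and int: "integrable lborel (\<lambda>t. indicator {0..pi/2} t * (\<integral>p. H t p \<partial>lborel))"
  proof -
    have m: "case_prod H \<in> borel_measurable borel"
      unfolding H_def case_prod_beta'
      by (intro borel_measurable_times borel_measurable_inner comp(1)[of "\<lambda>q. fst (snd q)"]
          comp(2)[of "\<lambda>q. fst (rot (fst q) (snd q))"]
          borel_measurable_continuous_onI[of "\<lambda>q. snd (rot (fst q) (snd q))"]
          borel_measurable_continuous_onI[of "\<lambda>q. gauss (snd q)"] continuous_intros)
    define B where "B = (\<integral>p. M * L * ((1 + norm (p::'a \<times> 'a)) ^ 2 * gauss p) \<partial>lborel)"
    have B: "(\<integral>p. \<bar>H t p\<bar> \<partial>lborel) \<le> B" for t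
    proof -
      have "(\<integral>p. \<bar>H t p\<bar> \<partial>lborel) = (\<integral>p. \<bar>K t p * gauss p\<bar> \<partial>lborel)"
        using integral_rot(1)[OF borel_measurable_abs[OF KGm], of t t] by (simp add: HK)
      also have "\<dots> \<le> B"
        unfolding B_def
      proof (rule integral_mono')
        show "integrable lborel (\<lambda>p::'a \<times> 'a. M * L * ((1 + norm p) ^ 2 * gauss p))"
          by (intro integrable_mult_right integrable_gauss_moment)
        show "\<bar>K t p * gauss p\<bar> \<le> M * L * ((1 + norm p) ^ 2 * gauss p)" for p
          using mult_right_mono[OF Kb[of t p], of "gauss p"] by (simp add: abs_mult mult.assoc)
      qed (use M0 L0 in auto)
      finally show ?thesis .
    qed
    from integral_interval_commute[OF m Hi B, of 0 "pi/2"]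
    show "(\<integral>p. F (fst p) * (F (snd p) - F (fst p)) * gauss p \<partial>lborel) =
        (\<integral>t. indicator {0..pi/2} t * (\<integral>p. H t p \<partial>lborel) \<partial>lborel)"
      and "integrable lborel (\<lambda>t. indicator {0..pi/2} t * (\<integral>p. H t p \<partial>lborel))"
      by (simp_all add: ftc)
  qed
  have sin_int: "(\<integral>t. indicator {0..pi/2} t * (- (sin t * (Z * E))) \<partial>lborel) = - (Z * E)"
  proof -
    have "(\<integral>t. indicator {0..pi/2} t * (- (sin t * (Z * E))) \<partial>lborel) = cos (pi/2) * (Z * E) - cos 0 * (Z * E)"
      by (rule FTC_lborel[where S="{}" and B="\<bar>Z * E\<bar>"])
        (auto intro!: continuous_intros derivative_eq_intros simp: abs_mult mult_left_le_one_le)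
    then show ?thesis by simp
  qed
  have "- (Z * E) \<le> (\<integral>t. indicator {0..pi/2} t * (\<integral>p. H t p \<partial>lborel) \<partial>lborel)"
    unfolding sin_int[symmetric]
  proof (rule integral_mono[OF _ int])
    show "integrable lborel (\<lambda>t. indicator {0..pi/2} t * (- (sin t * (Z * E))))"
      using borel_integrable_atLeastAtMost'[of 0 "pi/2" "\<lambda>t. - (sin t * (Z * E))"]
      by (simp add: set_integrable_def continuous_intros)
    show "indicator {0..pi/2} t * (- (sin t * (Z * E))) \<le> indicator {0..pi/2} t * (\<integral>p. H t p \<partial>lborel)" for t
    proof (cases "t \<in> {0..pi/2}")
      case True
      then have "0 \<le> sin t" by (auto intro: sin_ge_zero)
      then have "sin t * (\<integral>p. (D (fst (rot (- t) p)) \<bullet> D (fst p)) * gauss p \<partial>lborel) \<le> sin t * (Z * E)"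
        by (intro mult_left_mono CS)
      then show ?thesis unfolding Hint parts using True by simp
    qed simp
  qed
  also have "\<dots> = (\<integral>p. F (fst p) * (F (snd p) - F (fst p)) * gauss p \<partial>lborel)"
    by (rule comm[symmetric])
  also have "\<dots> = - (Z * (\<integral>x. (F x)\<^sup>2 * gauss x \<partial>lborel))"
  proof -
    have Fi: "integrable lborel (\<lambda>x. F x * gauss x)"
      by (rule integrable_gauss_bound[where k=1 and C=M]) (use M in auto)
    have b: "\<bar>F (fst p) * (F (snd p) - F (fst p))\<bar> \<le> (2 * M\<^sup>2) * (1 + norm p) ^ 2" for p
    proof -
      have 1: "\<bar>F (fst p)\<bar> \<le> M * (1 + norm p)"
        by (rule order_trans[OF M]) (intro mult_left_mono, use fst_le[of p] M0 in auto)
      have 2: "\<bar>F (snd p)\<bar> \<le> M * (1 + norm p)"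
        by (rule order_trans[OF M]) (intro mult_left_mono, use snd_le[of p] M0 in auto)
      have "\<bar>F (fst p) * (F (snd p) - F (fst p))\<bar> \<le> (M * (1 + norm p)) * (2 * (M * (1 + norm p)))"
        unfolding abs_mult by (intro mult_mono 1) (use 1 2 M0 in auto)
      then show ?thesis by (simp add: power2_eq_square ac_simps)
    qed
    have pi: "integrable lborel (\<lambda>p. F (fst p) * (F (snd p) - F (fst p)) * gauss p)"
      by (rule integrable_gauss_bound[OF _ b]) (intro borel_measurable_times borel_measurable_diff
          comp(1)[of fst] comp(1)[of snd] continuous_intros)
    have "(\<integral>p. F (fst p) * (F (snd p) - F (fst p)) * gauss p \<partial>lborel) =
      (\<integral>a. gauss a * (\<integral>b. F a * (F b - F a) * gauss b \<partial>lborel) \<partial>lborel)"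
      using integral_gauss_pair[OF pi] by simp
    also have "(\<lambda>a. \<integral>b. F a * (F b - F a) * gauss b \<partial>lborel) = (\<lambda>a. - (F a)\<^sup>2 * Z)"
    proof
      fix a
      have "(\<integral>b. F a * (F b - F a) * gauss b \<partial>lborel) = (\<integral>b. F a * (F b * gauss b) - (F a)\<^sup>2 * gauss b \<partial>lborel)"
        by (simp add: algebra_simps power2_eq_square)
      also have "\<dots> = F a * (\<integral>b. F b * gauss b \<partial>lborel) - (F a)\<^sup>2 * Z"
        unfolding Z_def using Fi integrable_gauss
        by (subst Bochner_Integration.integral_diff) (auto simp: integrable_mult_right)
      finally show "(\<integral>b. F a * (F b - F a) * gauss b \<partial>lborel) = - (F a)\<^sup>2 * Z"
        by (simp add: mean0)
    qed
    also have "(\<integral>a. gauss a * (- (F a)\<^sup>2 * Z) \<partial>lborel) = (\<integral>a. (- Z) * ((F a)\<^sup>2 * gauss a) \<partial>lborel)"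
      by (simp add: ac_simps)
    also have "\<dots> = - (Z * (\<integral>x. (F x)\<^sup>2 * gauss x \<partial>lborel))"
      by (simp only: integral_mult_right_zero)
    finally show ?thesis .
  qed
  finally have "Z * (\<integral>x. (F x)\<^sup>2 * gauss x \<partial>lborel) \<le> Z * E" by simp
  then show ?thesis using Z by (simp add: E_def)
qed

section \<open>Polar coordinates by scaling\<close>

lemma nn_integral_swap:
  fixes f :: "'a::euclidean_space \<Rightarrow> 'b::euclidean_space \<Rightarrow> ennreal"
  assumes [measurable]: "(\<lambda>(x, y). f x y) \<in> borel_measurable (borel \<Otimes>\<^sub>M borel)"
  shows "(\<integral>\<^sup>+x. \<integral>\<^sup>+y. f x y \<partial>lborel \<partial>lborel) = (\<integral>\<^sup>+y. \<integral>\<^sup>+x. f x y \<partial>lborel \<partial>lborel)"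
proof -
  have "(\<lambda>(x, y). f x y) \<in> borel_measurable (lborel \<Otimes>\<^sub>M lborel)" by measurable
  from lborel_pair.Fubini'[OF this] show ?thesis ..
qed

lemma borel_measurable_sgn_vec [measurable]: "(sgn :: 'a::euclidean_space \<Rightarrow> 'a) \<in> borel_measurable borel"
  unfolding sgn_div_norm[abs_def] by measurable

text \<open>Extended by 0 so that radial integrals run over all of \<open>lborel\<close>, including
  after the inversion \<open>r = 1 / s\<close>.\<close>

definition pos_power :: "nat \<Rightarrow> real \<Rightarrow> real" where
  "pos_power n r = (if 0 < r then r ^ n else 0)"

lemma pos_power_nonneg [simp]: "0 \<le> pos_power n r"
  by (simp add: pos_power_def)

lemma borel_measurable_pos_power [measurable]: "pos_power n \<in> borel_measurable borel"
  unfolding pos_power_def[abs_def] by measurable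

text \<open>The constant is $\int_0^\infty w(t) t^{n-1} dt$ written in the variable $s = 1/t$, so that the proof of
  the polar formula needs no other substitutions than dilations.\<close>

definition polar_const :: "nat \<Rightarrow> (real \<Rightarrow> ennreal) \<Rightarrow> ennreal" where
  "polar_const n w = (\<integral>\<^sup>+s. ennreal (pos_power (n + 1) (1 / s)) * w (1 / s) \<partial>lborel)"

text \<open>Three dilations suffice: \<open>r = |x| s\<close> turns \<open>F (r sgn x)\<close> into
  \<open>F (s x)\<close>, then \<open>y = s x\<close> for fixed \<open>s\<close> frees
  \<open>F\<close> from \<open>s\<close>, and finally rescaling \<open>s\<close> by
  \<open>|y|\<close> splits off a factor independent of \<open>y\<close>. The average over
  directions weighted by \<open>w\<close> takes the place of the surface measure.\<close>

lemma nn_integral_polar: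
  fixes F :: "'a::euclidean_space \<Rightarrow> ennreal" and w :: "real \<Rightarrow> ennreal"
  assumes F[measurable]: "F \<in> borel_measurable borel" and w[measurable]: "w \<in> borel_measurable borel"
  shows "(\<integral>\<^sup>+r. ennreal (pos_power (DIM('a) - 1) r) * (\<integral>\<^sup>+x. F (r *\<^sub>R sgn x) * w (norm x) \<partial>lborel) \<partial>lborel) =
    polar_const DIM('a) w * (\<integral>\<^sup>+x. F x \<partial>lborel)"
proof -
  let ?N = "DIM('a)"
  have N: "?N > 0" by simp
  have AE0: "AE x in lborel. x \<noteq> (0::'a)" by (rule AE_lborel_singleton)
  have "(\<integral>\<^sup>+r. ennreal (pos_power (?N - 1) r) * (\<integral>\<^sup>+x. F (r *\<^sub>R sgn x) * w (norm x) \<partial>lborel) \<partial>lborel) =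
    (\<integral>\<^sup>+r. \<integral>\<^sup>+x. ennreal (pos_power (?N - 1) r) * (F (r *\<^sub>R sgn x) * w (norm x)) \<partial>lborel \<partial>lborel)"
    by (rule nn_integral_cong, rule nn_integral_cmult[symmetric]) measurable
  also have "\<dots> = (\<integral>\<^sup>+x. \<integral>\<^sup>+r. ennreal (pos_power (?N - 1) r) * (F (r *\<^sub>R sgn x) * w (norm x)) \<partial>lborel \<partial>lborel)"
    by (rule nn_integral_swap) measurable
  also have "\<dots> = (\<integral>\<^sup>+x. \<integral>\<^sup>+s. ennreal (pos_power (?N - 1) s * norm x ^ ?N) * (F (s *\<^sub>R x) * w (norm x)) \<partial>lborel \<partial>lborel)"
  proof (rule nn_integral_cong_AE, rule AE_mp[OF AE0], rule AE_I2, rule impI)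
    fix x :: 'a assume x: "x \<noteq> 0"
    have "(\<integral>\<^sup>+r. ennreal (pos_power (?N - 1) r) * (F (r *\<^sub>R sgn x) * w (norm x)) \<partial>lborel) =
      ennreal \<bar>norm x\<bar> * (\<integral>\<^sup>+s. ennreal (pos_power (?N - 1) (0 + norm x * s)) * (F ((0 + norm x * s) *\<^sub>R sgn x) * w (norm x)) \<partial>lborel)"
      by (rule nn_integral_real_affine) (measurable, use x in simp)
    also have "\<dots> = (\<integral>\<^sup>+s. ennreal \<bar>norm x\<bar> * (ennreal (pos_power (?N - 1) (0 + norm x * s)) * (F ((0 + norm x * s) *\<^sub>R sgn x) * w (norm x))) \<partial>lborel)"
      by (rule nn_integral_cmult[symmetric]) measurable
    also have "\<dots> = (\<integral>\<^sup>+s. ennreal (pos_power (?N - 1) s * norm x ^ ?N) * (F (s *\<^sub>R x) * w (norm x)) \<partial>lborel)"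
    proof (rule nn_integral_cong)
      fix s :: real
      have "norm x * pos_power (?N - 1) (norm x * s) = pos_power (?N - 1) s * norm x ^ ?N"
        using x N by (cases ?N) (auto simp: pos_power_def zero_less_mult_iff power_mult_distrib)
      moreover have "(norm x * s) *\<^sub>R sgn x = s *\<^sub>R x"
        using x by (simp add: sgn_div_norm)
      ultimately show "ennreal \<bar>norm x\<bar> * (ennreal (pos_power (?N - 1) (0 + norm x * s)) * (F ((0 + norm x * s) *\<^sub>R sgn x) * w (norm x))) =
        ennreal (pos_power (?N - 1) s * norm x ^ ?N) * (F (s *\<^sub>R x) * w (norm x))"
        by (simp add: mult.assoc[symmetric] ennreal_mult[symmetric])
    qed
    finally show "(\<integral>\<^sup>+r. ennreal (pos_power (?N - 1) r) * (F (r *\<^sub>R sgn x) * w (norm x)) \<partial>lborel) =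
      (\<integral>\<^sup>+s. ennreal (pos_power (?N - 1) s * norm x ^ ?N) * (F (s *\<^sub>R x) * w (norm x)) \<partial>lborel)" .
  qed
  also have "\<dots> = (\<integral>\<^sup>+s. \<integral>\<^sup>+x. ennreal (pos_power (?N - 1) s * norm x ^ ?N) * (F (s *\<^sub>R x) * w (norm x)) \<partial>lborel \<partial>lborel)"
    by (rule nn_integral_swap) measurable
  also have "\<dots> = (\<integral>\<^sup>+s. \<integral>\<^sup>+y. ennreal (pos_power (?N + 1) (1 / s) * norm y ^ ?N) * (F y * w (norm y / s)) \<partial>lborel \<partial>lborel)"
  proof (rule nn_integral_cong)
    fix s :: real
    show "(\<integral>\<^sup>+x. ennreal (pos_power (?N - 1) s * norm x ^ ?N) * (F (s *\<^sub>R x) * w (norm x)) \<partial>lborel) =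
      (\<integral>\<^sup>+y. ennreal (pos_power (?N + 1) (1 / s) * norm y ^ ?N) * (F y * w (norm y / s)) \<partial>lborel)"
    proof (cases "s > 0")
      case s: True
      have "(\<integral>\<^sup>+y. ennreal (pos_power (?N + 1) (1 / s) * norm y ^ ?N) * (F y * w (norm y / s)) \<partial>lborel) =
        ennreal (\<bar>s\<bar> ^ ?N) * (\<integral>\<^sup>+x. ennreal (pos_power (?N + 1) (1 / s) * norm (0 + s *\<^sub>R x) ^ ?N) * (F (0 + s *\<^sub>R x) * w (norm (0 + s *\<^sub>R x) / s)) \<partial>lborel)"
        by (rule nn_integral_lborel_affine) (measurable, use s in simp)
      also have "\<dots> = (\<integral>\<^sup>+x. ennreal (\<bar>s\<bar> ^ ?N) * (ennreal (pos_power (?N + 1) (1 / s) * norm (0 + s *\<^sub>R x) ^ ?N) * (F (0 + s *\<^sub>R x) * w (norm (0 + s *\<^sub>R x) / s))) \<partial>lborel)"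
        by (rule nn_integral_cmult[symmetric]) measurable
      also have "\<dots> = (\<integral>\<^sup>+x. ennreal (pos_power (?N - 1) s * norm x ^ ?N) * (F (s *\<^sub>R x) * w (norm x)) \<partial>lborel)"
      proof (rule nn_integral_cong)
        fix x :: 'a
        have e: "s ^ ?N * (pos_power (?N + 1) (1 / s) * (s * norm x) ^ ?N) = pos_power (?N - 1) s * norm x ^ ?N"
          using s N by (cases ?N) (auto simp: pos_power_def field_simps power_mult_distrib)
        have "ennreal (\<bar>s\<bar> ^ ?N) * (ennreal (pos_power (?N + 1) (1 / s) * (s * norm x) ^ ?N) * z) =
          ennreal (s ^ ?N * (pos_power (?N + 1) (1 / s) * (s * norm x) ^ ?N)) * z" for z
          using s by (simp add: mult.assoc[symmetric] ennreal_mult[symmetric])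
        then show "ennreal (\<bar>s\<bar> ^ ?N) * (ennreal (pos_power (?N + 1) (1 / s) * norm (0 + s *\<^sub>R x) ^ ?N) * (F (0 + s *\<^sub>R x) * w (norm (0 + s *\<^sub>R x) / s))) =
          ennreal (pos_power (?N - 1) s * norm x ^ ?N) * (F (s *\<^sub>R x) * w (norm x))"
          unfolding e using s by simp
      qed
      finally show ?thesis ..
    qed (auto simp: pos_power_def)
  qed
  also have "\<dots> = (\<integral>\<^sup>+y. \<integral>\<^sup>+s. ennreal (pos_power (?N + 1) (1 / s) * norm y ^ ?N) * (F y * w (norm y / s)) \<partial>lborel \<partial>lborel)"
    by (rule nn_integral_swap) measurable
  also have "\<dots> = (\<integral>\<^sup>+y. polar_const ?N w * F y \<partial>lborel)"
  proof (rule nn_integral_cong_AE, rule AE_mp[OF AE0], rule AE_I2, rule impI)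
    fix y :: 'a assume y: "y \<noteq> 0"
    have "(\<integral>\<^sup>+s. ennreal (pos_power (?N + 1) (1 / s) * norm y ^ ?N) * (F y * w (norm y / s)) \<partial>lborel) =
      ennreal \<bar>norm y\<bar> * (\<integral>\<^sup>+s. ennreal (pos_power (?N + 1) (1 / (0 + norm y * s)) * norm y ^ ?N) * (F y * w (norm y / (0 + norm y * s))) \<partial>lborel)"
      by (rule nn_integral_real_affine) (measurable, use y in simp)
    also have "\<dots> = (\<integral>\<^sup>+s. ennreal \<bar>norm y\<bar> * (ennreal (pos_power (?N + 1) (1 / (0 + norm y * s)) * norm y ^ ?N) * (F y * w (norm y / (0 + norm y * s)))) \<partial>lborel)"
      by (rule nn_integral_cmult[symmetric]) measurable
    also have "\<dots> = (\<integral>\<^sup>+s. (ennreal (pos_power (?N + 1) (1 / s)) * w (1 / s)) * F y \<partial>lborel)"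
    proof (rule nn_integral_cong)
      fix s :: real
      have e: "norm y * (pos_power (?N + 1) (1 / (norm y * s)) * norm y ^ ?N) = pos_power (?N + 1) (1 / s)"
        using y by (auto simp: pos_power_def field_simps power_mult_distrib zero_less_mult_iff)
      have e2: "norm y / (norm y * s) = 1 / s" using y by simp
      have "ennreal \<bar>norm y\<bar> * (ennreal (pos_power (?N + 1) (1 / (norm y * s)) * norm y ^ ?N) * z) =
        ennreal (norm y * (pos_power (?N + 1) (1 / (norm y * s)) * norm y ^ ?N)) * z" for z
        by (simp add: mult.assoc[symmetric] ennreal_mult[symmetric])
      then show "ennreal \<bar>norm y\<bar> * (ennreal (pos_power (?N + 1) (1 / (0 + norm y * s)) * norm y ^ ?N) * (F y * w (norm y / (0 + norm y * s)))) =
        (ennreal (pos_power (?N + 1) (1 / s)) * w (1 / s)) * F y"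
        unfolding e add_0 e2 by (simp only: mult.assoc mult.commute[of "F y"])
    qed
    also have "\<dots> = polar_const ?N w * F y"
      unfolding polar_const_def by (rule nn_integral_multc) measurable
    finally show "(\<integral>\<^sup>+s. ennreal (pos_power (?N + 1) (1 / s) * norm y ^ ?N) * (F y * w (norm y / s)) \<partial>lborel) =
      polar_const ?N w * F y" .
  qed
  also have "\<dots> = polar_const ?N w * (\<integral>\<^sup>+x. F x \<partial>lborel)"
    by (rule nn_integral_cmult) measurable
  finally show ?thesis .
qed

text \<open>Exchanges the radial weight: for functions of the direction the integrals against
  \<open>w\<close> and \<open>v\<close> are proportional, with factors that do not depend on
  \<open>H\<close>. It is the polar formula for \<open>F x = H (sgn x) * v (norm x)\<close>, where
  the inner integral factors.\<close>

lemma nn_integral_polar_prod: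
  fixes H :: "'a::euclidean_space \<Rightarrow> ennreal" and w v :: "real \<Rightarrow> ennreal"
  assumes H[measurable]: "H \<in> borel_measurable borel" and w[measurable]: "w \<in> borel_measurable borel"
    and v[measurable]: "v \<in> borel_measurable borel"
  shows "(\<integral>\<^sup>+r. ennreal (pos_power (DIM('a) - 1) r) * v r \<partial>lborel) * (\<integral>\<^sup>+x. H (sgn x) * w (norm x) \<partial>lborel) =
    polar_const DIM('a) w * (\<integral>\<^sup>+x. H (sgn x) * v (norm x) \<partial>lborel)"
proof -
  have "polar_const DIM('a) w * (\<integral>\<^sup>+x. H (sgn x) * v (norm x) \<partial>lborel) =
    (\<integral>\<^sup>+r. ennreal (pos_power (DIM('a) - 1) r) * (\<integral>\<^sup>+x. (H (sgn (r *\<^sub>R sgn x)) * v (norm (r *\<^sub>R sgn x))) * w (norm x) \<partial>lborel) \<partial>lborel)"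
    by (rule nn_integral_polar[symmetric]) measurable
  also have "\<dots> = (\<integral>\<^sup>+r. (ennreal (pos_power (DIM('a) - 1) r) * v r) * (\<integral>\<^sup>+x. H (sgn x) * w (norm x) \<partial>lborel) \<partial>lborel)"
  proof (rule nn_integral_cong)
    fix r :: real
    show "ennreal (pos_power (DIM('a) - 1) r) * (\<integral>\<^sup>+x. (H (sgn (r *\<^sub>R sgn x)) * v (norm (r *\<^sub>R sgn x))) * w (norm x) \<partial>lborel) =
      (ennreal (pos_power (DIM('a) - 1) r) * v r) * (\<integral>\<^sup>+x. H (sgn x) * w (norm x) \<partial>lborel)"
    proof (cases "r > 0")
      case r: True
      have "(\<integral>\<^sup>+x. (H (sgn (r *\<^sub>R sgn x)) * v (norm (r *\<^sub>R sgn x))) * w (norm x) \<partial>lborel) =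
        (\<integral>\<^sup>+x. v r * (H (sgn (x::'a)) * w (norm x)) \<partial>lborel)"
      proof (rule nn_integral_cong_AE, rule AE_mp[OF AE_lborel_singleton[of 0]], rule AE_I2, rule impI)
        fix x :: 'a assume "x \<noteq> 0"
        moreover from this have "sgn (sgn x) = sgn x" by (simp add: sgn_div_norm)
        ultimately show "(H (sgn (r *\<^sub>R sgn x)) * v (norm (r *\<^sub>R sgn x))) * w (norm x) = v r * (H (sgn x) * w (norm x))"
          using r by (simp add: sgn_scaleR norm_sgn ac_simps)
      qed
      also have "\<dots> = v r * (\<integral>\<^sup>+x. H (sgn x) * w (norm x) \<partial>lborel)"
        by (rule nn_integral_cmult) measurable
      finally show ?thesis by (simp add: mult.assoc)
    qed (simp add: pos_power_def)
  qed
  also have "\<dots> = (\<integral>\<^sup>+r. ennreal (pos_power (DIM('a) - 1) r) * v r \<partial>lborel) * (\<integral>\<^sup>+x. H (sgn x) * w (norm x) \<partial>lborel)"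
    by (rule nn_integral_multc) measurable
  finally show ?thesis ..
qed

lemma integrable_bounded_support:
  fixes h :: "'a::euclidean_space \<Rightarrow> real"
  assumes [measurable]: "h \<in> borel_measurable borel"
    and B: "\<And>x. \<bar>h x\<bar> \<le> B" and R: "\<And>x. R < norm x \<Longrightarrow> h x = 0"
  shows "integrable lborel h"
proof (rule Bochner_Integration.integrable_bound)
  show "integrable lborel (\<lambda>x::'a. B * indicator (cball 0 R) x :: real)"
    by (intro integrable_mult_right) (simp add: integrable_indicator_iff emeasure_lborel_cball_finite[unfolded infinity_ennreal_def])
  show "AE x in lborel. norm (h x) \<le> norm (B * indicator (cball 0 R) x :: real)"
    using B R by (auto split: split_indicator intro!: AE_I2 order_trans[OF B] simp: not_le)
qed simp

section \<open>Polar constants of the Gaussian weights\<close>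

lemma nn_integral_unit_interval_pos_power:
  "(\<integral>\<^sup>+r. ennreal (pos_power n r) * indicator {0<..1} r \<partial>lborel) \<noteq> 0"
  "(\<integral>\<^sup>+r. ennreal (pos_power n r) * indicator {0<..1} r \<partial>lborel) < \<infinity>"
proof -
  have "(\<integral>\<^sup>+r. ennreal (pos_power n r) * indicator {0<..1} r \<partial>lborel) \<ge> (\<integral>\<^sup>+r. ennreal ((1/2) ^ n) * indicator {1/2..1::real} r \<partial>lborel)"
    by (intro nn_integral_mono)
      (auto simp: pos_power_def split: split_indicator intro!: ennreal_leI power_mono simp del: power_divide)
  also have "(\<integral>\<^sup>+r. ennreal ((1/2) ^ n) * indicator {1/2..1::real} r \<partial>lborel) = ennreal ((1/2) ^ n) * emeasure lborel {1/2..1::real}"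
    by (rule nn_integral_cmult_indicator) simp
  finally have "ennreal ((1/2) ^ n) * emeasure lborel {1/2..1::real} \<le> (\<integral>\<^sup>+r. ennreal (pos_power n r) * indicator {0<..1} r \<partial>lborel)" .
  moreover have "ennreal ((1/2) ^ n) * emeasure lborel {1/2..1::real} \<noteq> 0"
    by (simp add: ennreal_eq_0_iff not_le del: power_divide)
  ultimately show "(\<integral>\<^sup>+r. ennreal (pos_power n r) * indicator {0<..1} r \<partial>lborel) \<noteq> 0"
    by auto
  have "(\<integral>\<^sup>+r. ennreal (pos_power n r) * indicator {0<..1} r \<partial>lborel) \<le> (\<integral>\<^sup>+r. indicator {0..1::real} r \<partial>lborel)"
    by (intro nn_integral_mono)
      (auto simp: pos_power_def power_le_one split: split_indicator)
  then show "(\<integral>\<^sup>+r. ennreal (pos_power n r) * indicator {0<..1} r \<partial>lborel) < \<infinity>"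
    by (auto intro: le_less_trans)
qed

text \<open>Integration by parts, applied to each coordinate function in its own direction, turns
  every second moment into the total mass.\<close>

lemma gauss_second_moment:
  "(\<integral>x. (norm x)\<^sup>2 * gauss (x::'a::euclidean_space) \<partial>lborel) = DIM('a) * (\<integral>x. gauss (x::'a) \<partial>lborel)"
proof -
  have 1: "(\<integral>x. (x \<bullet> i) * (x \<bullet> i) * gauss x \<partial>lborel) = (\<integral>x. gauss (x::'a) \<partial>lborel)" if i: "i \<in> Basis" for i :: 'a
  proof -
    have "(\<integral>x. (x \<bullet> i) * (x \<bullet> i) * gauss x \<partial>lborel) = (\<integral>x. (i \<bullet> i) * gauss (x::'a) \<partial>lborel)"
    proof (rule gauss_by_parts[where S="{}"])
      show "((\<lambda>x. x \<bullet> i) has_derivative (\<lambda>h. i \<bullet> h)) (at b)" for b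
        by (auto intro!: derivative_eq_intros simp: inner_commute)
      show "norm i \<le> 1" using i by simp
      show "\<bar>b \<bullet> i\<bar> \<le> 1 * (1 + norm b)" for b
        using Basis_le_norm[OF i, of b] by simp
    qed (auto intro!: continuous_intros)
    then show ?thesis using i by simp
  qed
  have int: "integrable lborel (\<lambda>x. (x \<bullet> i) * (x \<bullet> i) * gauss (x::'a))" if i: "i \<in> Basis" for i :: 'a
  proof (rule integrable_gauss_bound[where C=1 and k=2])
    fix x :: 'a
    have "\<bar>x \<bullet> i\<bar> \<le> 1 + norm x" using Basis_le_norm[OF i, of x] by simp
    from mult_mono[OF this this] show "\<bar>(x \<bullet> i) * (x \<bullet> i)\<bar> \<le> 1 * (1 + norm x) ^ 2"
      by (simp add: abs_mult power2_eq_square)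
  qed simp
  have "(\<integral>x. (norm x)\<^sup>2 * gauss (x::'a) \<partial>lborel) = (\<integral>x. (\<Sum>i\<in>Basis. (x \<bullet> i) * (x \<bullet> i) * gauss (x::'a)) \<partial>lborel)"
    unfolding power2_norm_eq_inner by (subst euclidean_inner) (simp add: sum_distrib_right)
  also have "\<dots> = (\<Sum>i\<in>(Basis::'a set). (\<integral>x. (x \<bullet> i) * (x \<bullet> i) * gauss x \<partial>lborel))"
    by (rule Bochner_Integration.integral_sum) (rule int)
  also have "\<dots> = DIM('a) * (\<integral>x. gauss (x::'a) \<partial>lborel)"
    using 1 by simp
  finally show ?thesis .
qed

text \<open>For the 1-homogeneous function of the sphere argument, \<open>k = 2\<close> is the
  weight of its square, \<open>k = 1\<close> that of its mean, and \<open>k = 0\<close> that of its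
  gradient, which is 0-homogeneous.\<close>

abbreviation gauss_weight :: "nat \<Rightarrow> real \<Rightarrow> ennreal" where
  "gauss_weight k t \<equiv> ennreal (t ^ k * exp (- t\<^sup>2 / 2))"

lemma gauss_weight_norm: "gauss_weight k (norm x) = ennreal ((norm x) ^ k * gauss x)"
  by (simp add: gauss_def)

text \<open>The constants are found by comparison with the unit ball: each of them times the volume
  \<open>V\<close> equals the radial mass \<open>J\<close> times a Gaussian moment. Between the
  weights 2 and 0 both \<open>J\<close> and \<open>V\<close> drop out, and the second moment
  contributes the factor N on which the sharp constant rests.\<close>

lemma polar_const_gauss:
  shows "polar_const DIM('a::euclidean_space) (gauss_weight 2) = of_nat DIM('a) * polar_const DIM('a) (gauss_weight 0)"
    and "polar_const DIM('a) (gauss_weight 0) \<noteq> 0"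
    and "polar_const DIM('a) (gauss_weight 0) < \<infinity>"
proof -
  define J where "J = (\<integral>\<^sup>+r. ennreal (pos_power (DIM('a) - 1) r) * indicator {0<..1} r \<partial>lborel)"
  define V where "V = (\<integral>\<^sup>+x. 1 * indicator {0<..1} (norm (x::'a)) \<partial>lborel)"
  have J: "J \<noteq> 0" "J < \<infinity>" unfolding J_def by (rule nn_integral_unit_interval_pos_power)+
  have G: "(\<integral>\<^sup>+x. 1 * gauss_weight k (norm (x::'a)) \<partial>lborel) = ennreal (\<integral>x. (norm x) ^ k * gauss (x::'a) \<partial>lborel)" for k
    unfolding gauss_weight_norm mult_1_left
  proof (rule nn_integral_eq_integral)
    show "integrable lborel (\<lambda>x. (norm x) ^ k * gauss (x::'a))"
      by (rule integrable_gauss_bound[where C=1 and k=k]) (auto intro!: power_mono)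
  qed auto
  have P: "J * ennreal (\<integral>x. (norm x) ^ k * gauss (x::'a) \<partial>lborel) = polar_const DIM('a) (gauss_weight k) * V" for k
    using nn_integral_polar_prod[of "\<lambda>_::'a. 1" "gauss_weight k" "indicator {0<..1}"]
    unfolding J_def V_def G[symmetric] by simp
  have V: "V \<noteq> 0" "V < \<infinity>"
  proof -
    have "V = (\<integral>\<^sup>+x. indicator (cball 0 1 - {0::'a}) x \<partial>lborel)"
      unfolding V_def by (intro nn_integral_cong) (auto split: split_indicator)
    also have "\<dots> = emeasure lborel (cball 0 1 - {0::'a})" by simp
    also have "\<dots> = emeasure lborel (cball 0 1 :: 'a set)"
      by (rule emeasure_Diff_null_set) auto
    finally have V: "V = emeasure lborel (cball 0 1 :: 'a set)" .
    show "V < \<infinity>" unfolding V using emeasure_lborel_cball_finite[of "0::'a" 1] by (simp add: top.not_eq_extremum)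
    have "0 < measure lborel (cball 0 1 :: 'a set)" by (rule content_cball_pos) simp
    then show "V \<noteq> 0" unfolding V by (auto simp: measure_def)
  qed
  have g: "0 < (\<integral>x. gauss (x::'a) \<partial>lborel)" by (rule integral_gauss_pos)
  have P0: "J * ennreal (\<integral>x. gauss (x::'a) \<partial>lborel) = polar_const DIM('a) (gauss_weight 0) * V"
    using P[of 0] by simp
  have "polar_const DIM('a) (gauss_weight 2) * V = J * ennreal (DIM('a) * (\<integral>x. gauss (x::'a) \<partial>lborel))"
    using P[of 2] by (simp add: gauss_second_moment)
  also have "\<dots> = of_nat DIM('a) * (J * ennreal (\<integral>x. gauss (x::'a) \<partial>lborel))"
    using g by (simp add: ennreal_mult ennreal_of_nat_eq_real_of_nat ac_simps)
  also have "\<dots> = (of_nat DIM('a) * polar_const DIM('a) (gauss_weight 0)) * V"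
    unfolding P0 by (simp add: mult.assoc)
  finally show "polar_const DIM('a) (gauss_weight 2) = of_nat DIM('a) * polar_const DIM('a) (gauss_weight 0)"
    using V by (auto simp: mult.commute[of _ V] ennreal_mult_cancel_left)
  show "polar_const DIM('a) (gauss_weight 0) \<noteq> 0"
    using P0 J g by auto
  show "polar_const DIM('a) (gauss_weight 0) < \<infinity>"
  proof (rule ccontr)
    assume "\<not> polar_const DIM('a) (gauss_weight 0) < \<infinity>"
    then have "polar_const DIM('a) (gauss_weight 0) = top"
      by (simp only: infinity_ennreal_def not_less top_unique)
    then have "J * ennreal (\<integral>x. gauss (x::'a) \<partial>lborel) = top"
      unfolding P0 using V by (simp only: ennreal_top_mult if_False)
    then show False
      using J(2) by (simp add: ennreal_mult_eq_top_iff)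
  qed
qed

section \<open>The inequality with remainder\<close>

text \<open>A common setting for admissible functions and for the test functions of the optimality
  proof. The condition \<open>u 0 = 0\<close> with a bounded gradient makes
  \<open>u x / norm x\<close> bounded, hence the Hardy integral finite in every dimension.\<close>

locale compact_C1 =
  fixes u :: "'a::euclidean_space \<Rightarrow> real" and g :: "'a \<Rightarrow> 'a" and R :: real
  assumes deriv: "(u has_derivative (\<lambda>h. g x \<bullet> h)) (at x)"
    and cont_g: "continuous_on UNIV g"
    and supp: "R < norm x \<Longrightarrow> u x = 0 \<and> g x = 0"
    and u0: "u 0 = 0"
begin

lemma cont_u: "continuous_on UNIV u"
  using deriv has_derivative_continuous continuous_at_imp_continuous_on by blast

lemma u_measurable [measurable]: "u \<in> borel_measurable borel"
  and g_measurable [measurable]: "g \<in> borel_measurable borel"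
  by (intro borel_measurable_continuous_onI cont_u cont_g)+

definition L :: real where "L = (SOME L. \<forall>x. norm (g x) \<le> L)"

lemma g_le: "norm (g x) \<le> L"
proof -
  have "compact (g ` cball 0 R)"
    by (intro compact_continuous_image continuous_on_subset[OF cont_g]) auto
  then obtain B where B: "\<And>x. norm x \<le> R \<Longrightarrow> norm (g x) \<le> B"
    by (fastforce dest!: compact_imp_bounded simp: bounded_iff)
  have "norm (g x) \<le> \<bar>B\<bar>" for x
  proof (cases "norm x \<le> R")
    case True then show ?thesis using B[of x] by auto
  qed (use supp in auto)
  then have "\<forall>x. norm (g x) \<le> L" unfolding L_def by (rule_tac someI) blast
  then show ?thesis by blast
qed

lemma L_nonneg: "0 \<le> L"
  using g_le[of 0] norm_ge_zero order_trans by blast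

lemma u_le: "\<bar>u x\<bar> \<le> L * norm x"
proof -
  have "norm (u x - u 0) \<le> L * norm (x - 0)"
  proof (rule differentiable_bound[where S=UNIV and f'="\<lambda>x h. g x \<bullet> h"])
    fix y :: 'a
    show "(u has_derivative (\<lambda>h. g y \<bullet> h)) (at y within UNIV)" using deriv by simp
    show "onorm (\<lambda>h. g y \<bullet> h) \<le> L"
    proof (rule onorm_le)
      fix h show "norm (g y \<bullet> h) \<le> L * norm h"
        using Cauchy_Schwarz_ineq2[of "g y" h] mult_right_mono[OF g_le[of y], of "norm h"] by auto
    qed
  qed auto
  then show ?thesis using u0 by simp
qed

definition quot :: "'a \<Rightarrow> real" where "quot x = (u x)\<^sup>2 / (norm x)\<^sup>2"
definition rad :: "'a \<Rightarrow> real" where "rad x = g x \<bullet> sgn x"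
text \<open>By Pythagoras this is, away from 0, the squared length of the component of the gradient
  orthogonal to \<open>x\<close>.\<close>

definition tang :: "'a \<Rightarrow> real" where "tang x = (norm (g x))\<^sup>2 - (rad x)\<^sup>2"

definition cross :: "'a \<Rightarrow> real" where "cross x = u x / norm x * rad x"

lemma u_div_le: "\<bar>u x / norm x\<bar> \<le> L"
  using u_le[of x] L_nonneg by (cases "x = 0") (auto simp: divide_le_eq)

lemma rad_le: "\<bar>rad x\<bar> \<le> norm (g x)"
  using Cauchy_Schwarz_ineq2[of "g x" "sgn x"] mult_left_le[of "norm (sgn x)" "norm (g x)"]
  unfolding rad_def by (auto simp: norm_sgn split: if_splits)

lemma rad_le_L: "\<bar>rad x\<bar> \<le> L"
  using rad_le g_le order_trans by blast

lemma tang_nonneg: "0 \<le> tang x"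
  using power_mono[OF rad_le[of x], of 2] by (simp add: tang_def)

lemma quot_nonneg: "0 \<le> quot x"
  by (simp add: quot_def)

lemma quot_measurable [measurable]: "quot \<in> borel_measurable borel"
  unfolding quot_def by measurable
lemma rad_measurable [measurable]: "rad \<in> borel_measurable borel"
  unfolding rad_def by measurable
lemma cross_measurable [measurable]: "cross \<in> borel_measurable borel"
  unfolding cross_def by measurable
lemma tang_measurable [measurable]: "tang \<in> borel_measurable borel"
  unfolding tang_def by measurable

lemma integrable_grad: "integrable lborel (\<lambda>x. (norm (g x))\<^sup>2)"
proof (rule integrable_bounded_support[where R=R])
  show "\<bar>(norm (g x))\<^sup>2\<bar> \<le> L\<^sup>2" for x
    using power_mono[OF g_le[of x], of 2] by simp
qed (use supp in auto)

lemma integrable_rad: "integrable lborel (\<lambda>x. (rad x)\<^sup>2)"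
proof (rule integrable_bounded_support[where R=R])
  show "\<bar>(rad x)\<^sup>2\<bar> \<le> L\<^sup>2" for x
    using power_mono[OF rad_le_L[of x], of 2] by simp
qed (use supp in \<open>auto simp: rad_def\<close>)

lemma cross_le: "\<bar>cross x\<bar> \<le> L\<^sup>2"
  unfolding cross_def power2_eq_square abs_mult by (intro mult_mono u_div_le rad_le_L L_nonneg) auto

lemma quot_le: "\<bar>quot x\<bar> \<le> L\<^sup>2"
  using power_mono[OF u_div_le[of x], of 2] by (simp add: quot_def power_divide)

lemma integrable_quot: "integrable lborel quot"
  by (rule integrable_bounded_support[where R=R, OF _ quot_le]) (use supp in \<open>auto simp: quot_def\<close>)

lemma integrable_cross: "integrable lborel cross"
  by (rule integrable_bounded_support[where R=R, OF _ cross_le]) (use supp in \<open>auto simp: cross_def\<close>)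

lemma integrable_tang: "integrable lborel tang"
  unfolding tang_def by (intro Bochner_Integration.integrable_diff integrable_grad integrable_rad)

text \<open>This is the divergence theorem for $u^2 x / |x|^2$; it is obtained by averaging the
  derivative of the dilates of $u^2 / |x|^2$, whose integrals are known by scaling.\<close>

lemma integral_cross:
  "2 * (\<integral>x. cross x \<partial>lborel) = (2 - real DIM('a)) * (\<integral>x. quot x \<partial>lborel)"
proof -
  let ?N = "DIM('a)"
  \<comment> \<open>\<open>G\<close> is chosen so that \<open>t ^ (N - 1) * G (t x)\<close> is the
    derivative in \<open>t\<close> of \<open>t ^ N * quot (t x)\<close>. The integral of the latter
    over \<open>x\<close> does not depend on \<open>t\<close>, which forces the integral of
    \<open>G\<close> to vanish.\<close>
  define G where "G x = (real ?N - 2) * quot x + 2 * (cross x)" for x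
  have Gm[measurable]: "G \<in> borel_measurable borel" unfolding G_def by measurable
  have Gi: "integrable lborel G"
    unfolding G_def by (intro Bochner_Integration.integrable_add integrable_mult_right integrable_quot integrable_cross)
  have G_le: "\<bar>G x\<bar> \<le> (\<bar>real ?N - 2\<bar> + 2) * L\<^sup>2" for x
  proof -
    have "\<bar>G x\<bar> \<le> \<bar>real ?N - 2\<bar> * \<bar>quot x\<bar> + 2 * \<bar>cross x\<bar>"
      unfolding G_def using abs_triangle_ineq[of "(real ?N - 2) * quot x" "2 * cross x"] by (simp add: abs_mult)
    also have "\<dots> \<le> \<bar>real ?N - 2\<bar> * L\<^sup>2 + 2 * L\<^sup>2"
      by (intro add_mono mult_left_mono quot_le cross_le) auto
    finally show ?thesis by (simp add: algebra_simps)
  qed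
  have scale: "(\<integral>x. h (t *\<^sub>R x) \<partial>lborel) = (\<integral>x. h x \<partial>lborel) / t ^ ?N"
    and scale_int: "integrable lborel h \<Longrightarrow> integrable lborel (\<lambda>x. h (t *\<^sub>R x))"
    if t: "t > 0" and [measurable]: "h \<in> borel_measurable borel" for t and h :: "'a \<Rightarrow> real"
  proof -
    have l: "lborel = density (distr lborel borel (\<lambda>x::'a. 0 + t *\<^sub>R x)) (\<lambda>_. \<bar>t\<bar>^DIM('a))"
      by (rule lborel_affine) (use t in simp)
    have "(\<integral>x. h x \<partial>lborel) = t ^ ?N * (\<integral>x. h (t *\<^sub>R x) \<partial>lborel)"
      by (subst l, subst integral_density) (use t in \<open>simp_all add: integral_distr\<close>)
    then show "(\<integral>x. h (t *\<^sub>R x) \<partial>lborel) = (\<integral>x. h x \<partial>lborel) / t ^ ?N"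
      using t by simp
    assume "integrable lborel h"
    then show "integrable lborel (\<lambda>x. h (t *\<^sub>R x))"
      by (subst (asm) l, subst (asm) integrable_density) (use t in \<open>simp_all add: integrable_distr_eq\<close>)
  qed
  define H where "H t x = t ^ (?N - 1) * G (t *\<^sub>R x)" for t and x :: 'a
  have ftc: "(\<integral>t. indicator {1..2} t * H t x \<partial>lborel) = 2 ^ ?N * quot (2 *\<^sub>R x) - quot x" for x
  proof -
    have "(\<integral>t. indicator {1..2} t * H t x \<partial>lborel) = 2 ^ ?N * quot (2 *\<^sub>R x) - 1 ^ ?N * quot (1 *\<^sub>R x)"
    proof (rule FTC_lborel[where S="{}"])
      have "continuous_on {1..2} (\<lambda>t. t ^ ?N * ((u (t *\<^sub>R x))\<^sup>2 / (t\<^sup>2 * (norm x)\<^sup>2)))"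
      proof (cases "x = 0")
        case False
        then show ?thesis
          by (intro continuous_intros continuous_on_compose2[OF cont_u]) auto
      qed simp
      then show "continuous_on {1..2} (\<lambda>t. t ^ ?N * quot (t *\<^sub>R x))"
        by (simp add: quot_def power_mult_distrib)
      show "((\<lambda>t. t ^ ?N * quot (t *\<^sub>R x)) has_real_derivative H t x) (at t)" if t: "t \<in> {1<..<2} - {}" for t
      proof (cases "x = 0")
        case True
        then show ?thesis by (simp add: quot_def H_def G_def cross_def)
      next
        case x: False
        have l: "((\<lambda>t. t *\<^sub>R x) has_derivative (\<lambda>h. h *\<^sub>R x)) (at t)"
          by (auto intro!: derivative_eq_intros)
        have "((\<lambda>t. u (t *\<^sub>R x)) has_derivative (\<lambda>h. g (t *\<^sub>R x) \<bullet> (h *\<^sub>R x))) (at t)"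
          using diff_chain_at[OF l deriv] by (simp add: o_def)
        then have d: "((\<lambda>t. u (t *\<^sub>R x)) has_real_derivative g (t *\<^sub>R x) \<bullet> x) (at t)"
          unfolding has_field_derivative_def by (rule has_derivative_eq_rhs) (simp add: fun_eq_iff mult.commute)
        have r: "rad (t *\<^sub>R x) = (g (t *\<^sub>R x) \<bullet> x) / norm x"
          using t x by (simp add: rad_def sgn_div_norm sgn_scaleR field_simps)
        obtain m where m: "?N = Suc m" using DIM_positive[where 'a='a] by (cases ?N) auto
        have "((\<lambda>t. t ^ ?N * ((u (t *\<^sub>R x))\<^sup>2 / (t\<^sup>2 * (norm x)\<^sup>2))) has_real_derivative H t x) (at t)"
        proof (rule DERIV_cong[OF DERIV_mult[OF DERIV_pow DERIV_divide[OF DERIV_power[OF d] DERIV_cmult_right[OF DERIV_pow]]]])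
          show "t\<^sup>2 * (norm x)\<^sup>2 \<noteq> 0" using t x by simp
          define U U' c where "U = u (t *\<^sub>R x)" and "U' = g (t *\<^sub>R x) \<bullet> x" and "c = norm x"
          have "t \<noteq> 0" "c \<noteq> 0" using t x by (auto simp: c_def)
          then show "real ?N * t ^ (?N - Suc 0) * ((u (t *\<^sub>R x))\<^sup>2 / (t\<^sup>2 * (norm x)\<^sup>2)) +
            (real 2 * ((g (t *\<^sub>R x) \<bullet> x) * u (t *\<^sub>R x) ^ (2 - Suc 0)) * (t\<^sup>2 * (norm x)\<^sup>2) -
              (u (t *\<^sub>R x))\<^sup>2 * (real 2 * t ^ (2 - Suc 0) * (norm x)\<^sup>2)) /
            (t\<^sup>2 * (norm x)\<^sup>2 * (t\<^sup>2 * (norm x)\<^sup>2)) * t ^ ?N = H t x"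
            using t unfolding H_def G_def quot_def cross_def r m norm_scaleR
              U_def[symmetric] U'_def[symmetric] c_def[symmetric]
            by (simp add: field_simps power2_eq_square)
        qed
        then show ?thesis by (simp add: quot_def power_mult_distrib)
      qed
      show "(\<lambda>t. H t x) \<in> borel_measurable borel" unfolding H_def by measurable
      show "\<bar>H t x\<bar> \<le> 2 ^ (?N - 1) * ((\<bar>real ?N - 2\<bar> + 2) * L\<^sup>2)" if "t \<in> {1..2}" for t
        unfolding H_def abs_mult using that by (intro mult_mono G_le) (auto simp: power_abs[symmetric] intro!: power_mono)
    qed auto
    then show ?thesis by simp
  qed
  \<comment> \<open>Scaling leaves exactly \<open>1 / t\<close>, so integrating over
    \<open>{1..2}\<close> multiplies the integral of \<open>G\<close> by \<open>ln 2\<close>, which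
    can be cancelled.\<close>
  have Hint: "(\<integral>x. H t x \<partial>lborel) = (1 / t) * (\<integral>x. G x \<partial>lborel)" if t: "t \<in> {1..2}" for t
  proof -
    have "(\<integral>x. H t x \<partial>lborel) = t ^ (?N - 1) * ((\<integral>x. G x \<partial>lborel) / t ^ ?N)"
      unfolding H_def using t by (simp add: scale)
    also have "t ^ ?N = t * t ^ (?N - 1)"
      using power_Suc[of t "?N - 1"] by simp
    finally show ?thesis using t by simp
  qed
  have "(\<integral>x. (\<integral>t. indicator {1..2} t * H t x \<partial>lborel) \<partial>lborel) = (\<integral>t. indicator {1..2} t * (\<integral>x. H t x \<partial>lborel) \<partial>lborel)"
  proof (rule integral_interval_commute(1))
    have "(\<lambda>p::real \<times> 'a. fst p *\<^sub>R snd p) \<in> borel_measurable borel"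
      by (intro borel_measurable_continuous_onI continuous_intros)
    from measurable_compose[OF this Gm]
    have "(\<lambda>p::real \<times> 'a. fst p ^ (?N - 1) * G (fst p *\<^sub>R snd p)) \<in> borel_measurable borel"
      by (rule borel_measurable_times[rotated]) (intro borel_measurable_continuous_onI continuous_intros)
    then show "case_prod H \<in> borel_measurable borel"
      unfolding H_def by (simp add: case_prod_beta')
    show "integrable lborel (H t)" if "t \<in> {1..2}" for t
      unfolding H_def using that by (intro integrable_mult_right scale_int Gi) auto
    show "(\<integral>x. \<bar>H t x\<bar> \<partial>lborel) \<le> 2 ^ (?N - 1) * (\<integral>x. \<bar>G x\<bar> \<partial>lborel)" if t: "t \<in> {1..2}" for t
    proof -
      have "(\<integral>x. \<bar>H t x\<bar> \<partial>lborel) = t ^ (?N - 1) * ((\<integral>x. \<bar>G x\<bar> \<partial>lborel) / t ^ ?N)"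
        unfolding H_def abs_mult using t scale[of t "\<lambda>x. \<bar>G x\<bar>"] by simp
      also have "\<dots> \<le> 2 ^ (?N - 1) * ((\<integral>x. \<bar>G x\<bar> \<partial>lborel) / 1)"
        using t by (intro mult_mono power_mono divide_left_mono one_le_power) (auto intro!: divide_nonneg_nonneg)
      finally show ?thesis by simp
    qed
  qed
  also have "(\<integral>t. indicator {1..2} t * (\<integral>x. H t x \<partial>lborel) \<partial>lborel) =
    (\<integral>t. (indicator {1..2} t * (1 / t)) * (\<integral>x. G x \<partial>lborel) \<partial>lborel)"
    by (intro Bochner_Integration.integral_cong) (auto simp: Hint split: split_indicator)
  also have "\<dots> = (\<integral>t. indicator {1..2} t * (1 / t) \<partial>lborel) * (\<integral>x. G x \<partial>lborel)"
    by (rule integral_mult_left_zero)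
  also have "(\<integral>t. indicator {1..2} t * (1 / t) \<partial>lborel) = ln 2 - ln (1::real)"
    by (rule FTC_lborel[where S="{}" and B=1]) (auto intro!: continuous_intros derivative_eq_intros)
  finally have "ln 2 * (\<integral>x. G x \<partial>lborel) = (\<integral>x. 2 ^ ?N * quot (2 *\<^sub>R x) - quot x \<partial>lborel)"
    by (simp add: ftc)
  also have "\<dots> = 2 ^ ?N * ((\<integral>x. quot x \<partial>lborel) / 2 ^ ?N) - (\<integral>x. quot x \<partial>lborel)"
    by (subst Bochner_Integration.integral_diff)
      (auto intro!: integrable_mult_right scale_int integrable_quot simp: scale)
  finally have "(\<integral>x. G x \<partial>lborel) = 0" by simp
  also have "(\<integral>x. G x \<partial>lborel) = (real ?N - 2) * (\<integral>x. quot x \<partial>lborel) + 2 * (\<integral>x. cross x \<partial>lborel)"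
    unfolding G_def by (subst Bochner_Integration.integral_add)
      (auto intro!: integrable_mult_right integrable_quot integrable_cross)
  finally show ?thesis by (simp add: algebra_simps)
qed

text \<open>With \<open>b = (N - 2) / 2\<close> this is \<open>|x|^(-b)\<close> times the radial
  derivative of \<open>|x|^b * u\<close>; \<open>b\<close> is the coefficient that completes the
  square in the radial Hardy inequality.\<close>

definition remainder :: "'a \<Rightarrow> real" where
  "remainder x = rad x + (real DIM('a) - 2) / 2 * (u x / norm x)"

lemma remainder_sq: "(remainder x)\<^sup>2 = (rad x)\<^sup>2 + (real DIM('a) - 2) * (cross x) + ((real DIM('a) - 2) / 2)\<^sup>2 * quot x"
  by (simp add: remainder_def quot_def cross_def power2_sum power_mult_distrib power_divide)

lemma integrable_remainder: "integrable lborel (\<lambda>x. (remainder x)\<^sup>2)"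
  unfolding remainder_sq
  by (intro Bochner_Integration.integrable_add integrable_mult_right integrable_rad integrable_cross integrable_quot)

text \<open>Expanding the square of \<open>remainder\<close>, the mixed term becomes
  \<open>- (N - 2)^2 / 2\<close> times the Hardy integral by \<open>integral_cross\<close>, which
  flips the sign of the \<open>(N - 2)^2 / 4\<close> already there. Being an identity, it also
  evaluates the Dirichlet integral of the test functions.\<close>

lemma dirichlet_split:
  "(\<integral>x. (norm (g x))\<^sup>2 \<partial>lborel) =
    (\<integral>x. tang x \<partial>lborel) + ((real DIM('a) - 2) / 2)\<^sup>2 * (\<integral>x. quot x \<partial>lborel) + (\<integral>x. (remainder x)\<^sup>2 \<partial>lborel)"
proof -
  let ?N = "real DIM('a)"
  have "(\<integral>x. (remainder x)\<^sup>2 \<partial>lborel) = (\<integral>x. (rad x)\<^sup>2 \<partial>lborel) +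
    (?N - 2) * (\<integral>x. cross x \<partial>lborel) + ((?N - 2) / 2)\<^sup>2 * (\<integral>x. quot x \<partial>lborel)"
    unfolding remainder_sq
    by (simp add: integrable_rad integrable_cross integrable_quot)
  also have "(?N - 2) * (\<integral>x. cross x \<partial>lborel) = (?N - 2) / 2 * ((2 - ?N) * (\<integral>x. quot x \<partial>lborel))"
    using integral_cross by simp
  finally have 1: "(\<integral>x. (remainder x)\<^sup>2 \<partial>lborel) = (\<integral>x. (rad x)\<^sup>2 \<partial>lborel) - ((?N - 2) / 2)\<^sup>2 * (\<integral>x. quot x \<partial>lborel)"
    by (simp add: power2_eq_square field_simps)
  have 2: "(\<integral>x. tang x \<partial>lborel) = (\<integral>x. (norm (g x))\<^sup>2 \<partial>lborel) - (\<integral>x. (rad x)\<^sup>2 \<partial>lborel)"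
    unfolding tang_def by (rule Bochner_Integration.integral_diff[OF integrable_grad integrable_rad])
  show ?thesis unfolding 1 2 by simp
qed

end

section \<open>The tangential inequality and the case of equality\<close>

context compact_C1
begin

lemma quot_scale_sgn: "x \<noteq> 0 \<Longrightarrow> r > 0 \<Longrightarrow> quot (r *\<^sub>R sgn x) = (u (r *\<^sub>R sgn x))\<^sup>2 / r\<^sup>2"
  by (simp add: quot_def norm_sgn)

lemma rad_scale_sgn: "x \<noteq> 0 \<Longrightarrow> r > 0 \<Longrightarrow> rad (r *\<^sub>R sgn x) = g (r *\<^sub>R sgn x) \<bullet> sgn x"
  by (simp add: rad_def sgn_scaleR) (simp add: sgn_div_norm)

text \<open>This is one sphere of radius \<open>r\<close> at a time. Nonnegative integrals are used
  so that the result can be integrated over \<open>r\<close> by monotonicity alone.\<close>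

lemma sphere_Poincare:
  assumes r: "r > 0" and mean0: "(\<integral>x. u (r *\<^sub>R sgn x) * norm x * gauss x \<partial>lborel) = 0"
  shows "(\<integral>\<^sup>+x. ennreal (quot (r *\<^sub>R sgn x)) * gauss_weight 2 (norm x) \<partial>lborel) \<le>
    (\<integral>\<^sup>+x. ennreal (quot (r *\<^sub>R sgn x) + tang (r *\<^sub>R sgn x)) * gauss_weight 0 (norm x) \<partial>lborel)"
proof -
  define F where "F x = u (r *\<^sub>R sgn x) * norm x" for x
  \<comment> \<open>The gradient of \<open>F\<close>: the first summand is radial. In the second,
    the factor \<open>1 / |x|\<close> from the derivative of \<open>sgn\<close> cancels against the
    factor \<open>|x|\<close> of \<open>F\<close>, leaving \<open>r\<close> times the part of
    \<open>g\<close> orthogonal to \<open>sgn x\<close>. The two are orthogonal, so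
    \<open>|D x|^2\<close> has no mixed term.\<close>
  define D where "D x = u (r *\<^sub>R sgn x) *\<^sub>R sgn x +
    r *\<^sub>R (g (r *\<^sub>R sgn x) - (g (r *\<^sub>R sgn x) \<bullet> sgn x) *\<^sub>R sgn x)" for x
  have sgn1: "norm (sgn x) \<le> 1" for x :: 'a by (simp add: norm_sgn)
  have u_r: "\<bar>u (r *\<^sub>R sgn x)\<bar> \<le> L * r" for x
  proof -
    have "\<bar>u (r *\<^sub>R sgn x)\<bar> \<le> L * (r * norm (sgn x))" using u_le[of "r *\<^sub>R sgn x"] r by simp
    also have "\<dots> \<le> L * r" using r L_nonneg sgn1[of x] by (intro mult_left_mono mult_left_le) auto
    finally show ?thesis .
  qed
  have Dm[measurable]: "D \<in> borel_measurable borel" unfolding D_def by measurable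
  have Fderiv: "(F has_derivative (\<lambda>h. D x \<bullet> h)) (at x)" if x: "x \<noteq> 0" for x
  proof -
    have n: "(norm has_derivative (\<lambda>h. sgn x \<bullet> h)) (at x)"
      using has_derivative_norm[OF x] by (simp add: inner_commute)
    have s: "(sgn has_derivative (\<lambda>h. (1 / norm x) *\<^sub>R (h - (sgn x \<bullet> h) *\<^sub>R sgn x))) (at x)"
      unfolding sgn_div_norm[abs_def]
      by (rule has_derivative_eq_rhs, rule has_derivative_scaleR[OF Deriv.has_derivative_inverse[OF _ n] has_derivative_ident])
         (use x in \<open>auto simp: fun_eq_iff sgn_div_norm algebra_simps power2_eq_square divide_inverse\<close>)
    have rs: "((\<lambda>x. r *\<^sub>R sgn x) has_derivative (\<lambda>h. r *\<^sub>R ((1 / norm x) *\<^sub>R (h - (sgn x \<bullet> h) *\<^sub>R sgn x)))) (at x)"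
      by (rule has_derivative_scaleR_right[OF s])
    have us: "((\<lambda>x. u (r *\<^sub>R sgn x)) has_derivative (\<lambda>h. g (r *\<^sub>R sgn x) \<bullet> (r *\<^sub>R ((1 / norm x) *\<^sub>R (h - (sgn x \<bullet> h) *\<^sub>R sgn x))))) (at x)"
      using diff_chain_at[OF rs deriv] by (simp add: o_def)
    show ?thesis
      unfolding F_def[abs_def]
      by (rule has_derivative_eq_rhs[OF has_derivative_mult[OF us n]])
        (use x in \<open>simp add: fun_eq_iff D_def inner_add_left inner_diff_left inner_diff_right algebra_simps\<close>)
  qed
  have F_le: "\<bar>F x\<bar> \<le> (L * r) * norm x" for x
    unfolding F_def abs_mult using u_r by (auto intro!: mult_right_mono)
  have Fcont: "continuous_on UNIV F"
  proof (rule continuous_at_imp_continuous_on, rule ballI)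
    fix x :: 'a
    show "isCont F x"
    proof (cases "x = 0")
      case True
      have "((\<lambda>x::'a. (L * r) * norm x) \<longlongrightarrow> (L * r) * norm (0::'a)) (at 0)"
        by (rule tendsto_mult[OF tendsto_const tendsto_norm[OF tendsto_ident_at]])
      then have "(F \<longlongrightarrow> 0) (at 0)"
        by (intro Lim_null_comparison[OF always_eventually, of F]) (use F_le in auto)
      then show ?thesis using True by (simp add: isCont_def F_def)
    next
      case False
      then show ?thesis using Fderiv has_derivative_continuous by blast
    qed
  qed
  have D_le: "norm (D x) \<le> 3 * (L * r)" for x
  proof -
    have "norm ((g (r *\<^sub>R sgn x) \<bullet> sgn x) *\<^sub>R sgn x) \<le> (L * 1) * 1"
    proof -
      have "\<bar>g (r *\<^sub>R sgn x) \<bullet> sgn x\<bar> \<le> norm (g (r *\<^sub>R sgn x)) * norm (sgn x)" by (rule Cauchy_Schwarz_ineq2)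
      also have "\<dots> \<le> L * 1" by (intro mult_mono g_le sgn1 L_nonneg) auto
      finally show ?thesis unfolding norm_scaleR using L_nonneg sgn1 by (intro mult_mono) auto
    qed
    then have "norm (g (r *\<^sub>R sgn x) - (g (r *\<^sub>R sgn x) \<bullet> sgn x) *\<^sub>R sgn x) \<le> L + L"
      using g_le[of "r *\<^sub>R sgn x"] by (intro order_trans[OF norm_triangle_ineq4]) auto
    then have "r * norm (g (r *\<^sub>R sgn x) - (g (r *\<^sub>R sgn x) \<bullet> sgn x) *\<^sub>R sgn x) \<le> r * (L + L)"
      using r by (intro mult_left_mono) auto
    moreover have "r * (L + L) = 2 * (L * r)" by simp
    moreover have "\<bar>u (r *\<^sub>R sgn x)\<bar> * norm (sgn x) \<le> (L * r) * 1"
      using u_r[of x] sgn1[of x] L_nonneg r by (intro mult_mono) auto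
    ultimately have "\<bar>u (r *\<^sub>R sgn x)\<bar> * norm (sgn x) +
        \<bar>r\<bar> * norm (g (r *\<^sub>R sgn x) - (g (r *\<^sub>R sgn x) \<bullet> sgn x) *\<^sub>R sgn x) \<le> 3 * (L * r)"
      unfolding abs_of_pos[OF r] by linarith
    then show ?thesis unfolding D_def
      by (intro order_trans[OF norm_triangle_ineq]) (simp only: norm_scaleR)
  qed
  have P: "(\<integral>x. (F x)\<^sup>2 * gauss x \<partial>lborel) \<le> (\<integral>x. (norm (D x))\<^sup>2 * gauss x \<partial>lborel)"
  proof (rule gauss_Poincare[OF Fcont Fderiv Dm D_le])
    show "\<bar>F b\<bar> \<le> (L * r) * (1 + norm b)" for b
      using F_le[of b] L_nonneg r by (simp add: algebra_simps add_increasing)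
    show "(\<integral>x. F x * gauss x \<partial>lborel) = 0" using mean0 by (simp add: F_def)
  qed
  have iF: "integrable lborel (\<lambda>x. (F x)\<^sup>2 * gauss x)"
  proof (rule integrable_gauss_bound[where C="(L * r)\<^sup>2" and k=2])
    show "(\<lambda>x. (F x)\<^sup>2) \<in> borel_measurable borel" using borel_measurable_continuous_onI[OF Fcont] by measurable
    fix x
    have "\<bar>F x\<bar> \<le> (L * r) * (1 + norm x)"
      using F_le[of x] L_nonneg r by (simp add: algebra_simps add_increasing)
    from power_mono[OF this, of 2] show "\<bar>(F x)\<^sup>2\<bar> \<le> (L * r)\<^sup>2 * (1 + norm x)\<^sup>2"
      by (simp add: power_mult_distrib)
  qed
  have iD: "integrable lborel (\<lambda>x. (norm (D x))\<^sup>2 * gauss x)"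
  proof (rule integrable_gauss_bound[where C="(3 * (L * r))\<^sup>2" and k=0])
    show "\<bar>(norm (D x))\<^sup>2\<bar> \<le> (3 * (L * r))\<^sup>2 * (1 + norm x) ^ 0" for x
      using power_mono[OF D_le[of x], of 2] by simp
  qed measurable
  have D2: "(norm (D x))\<^sup>2 = r\<^sup>2 * (quot (r *\<^sub>R sgn x) + tang (r *\<^sub>R sgn x))" if x: "x \<noteq> 0" for x
  proof -
    define U G S where "U = u (r *\<^sub>R sgn x)" and "G = g (r *\<^sub>R sgn x)" and "S = sgn x"
    have s: "S \<bullet> S = 1" using x by (simp add: S_def dot_square_norm norm_sgn)
    have D: "D x = U *\<^sub>R S + r *\<^sub>R (G - (G \<bullet> S) *\<^sub>R S)"
      by (simp add: D_def U_def G_def S_def)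
    have "(norm (D x))\<^sup>2 = U\<^sup>2 + r\<^sup>2 * (G \<bullet> G - (G \<bullet> S)\<^sup>2)"
      using s unfolding power2_norm_eq_inner D
      by (simp add: inner_add_left inner_add_right inner_diff_left inner_diff_right inner_commute
          algebra_simps power2_eq_square)
    then show ?thesis
      using r by (simp add: quot_scale_sgn[OF x r] tang_def rad_scale_sgn[OF x r] U_def G_def S_def
          power2_norm_eq_inner algebra_simps)
  qed
  have AE0: "AE x in lborel. x \<noteq> (0::'a)" by (rule AE_lborel_singleton)
  have "ennreal (r\<^sup>2) * (\<integral>\<^sup>+x. ennreal (quot (r *\<^sub>R sgn x)) * gauss_weight 2 (norm x) \<partial>lborel) =
    (\<integral>\<^sup>+x. ennreal (r\<^sup>2) * (ennreal (quot (r *\<^sub>R sgn x)) * gauss_weight 2 (norm x)) \<partial>lborel)"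
    by (rule nn_integral_cmult[symmetric]) measurable
  also have "\<dots> = (\<integral>\<^sup>+x. ennreal ((F x)\<^sup>2 * gauss x) \<partial>lborel)"
  proof (rule nn_integral_cong_AE, rule AE_mp[OF AE0], rule AE_I2, rule impI)
    fix x :: 'a assume x: "x \<noteq> 0"
    show "ennreal (r\<^sup>2) * (ennreal (quot (r *\<^sub>R sgn x)) * gauss_weight 2 (norm x)) = ennreal ((F x)\<^sup>2 * gauss x)"
      unfolding gauss_weight_norm using r
      by (simp add: ennreal_mult[symmetric] quot_nonneg) (simp add: quot_scale_sgn[OF x r] F_def power_mult_distrib)
  qed
  also have "\<dots> = ennreal (\<integral>x. (F x)\<^sup>2 * gauss x \<partial>lborel)"
    by (rule nn_integral_eq_integral[OF iF]) simp
  also have "\<dots> \<le> ennreal (\<integral>x. (norm (D x))\<^sup>2 * gauss x \<partial>lborel)"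
    by (rule ennreal_leI[OF P])
  also have "\<dots> = (\<integral>\<^sup>+x. ennreal ((norm (D x))\<^sup>2 * gauss x) \<partial>lborel)"
    by (rule nn_integral_eq_integral[OF iD, symmetric]) simp
  also have "\<dots> = (\<integral>\<^sup>+x. ennreal (r\<^sup>2) * (ennreal (quot (r *\<^sub>R sgn x) + tang (r *\<^sub>R sgn x)) * gauss_weight 0 (norm x)) \<partial>lborel)"
  proof (rule nn_integral_cong_AE, rule AE_mp[OF AE0], rule AE_I2, rule impI)
    fix x :: 'a assume x: "x \<noteq> 0"
    show "ennreal ((norm (D x))\<^sup>2 * gauss x) = ennreal (r\<^sup>2) * (ennreal (quot (r *\<^sub>R sgn x) + tang (r *\<^sub>R sgn x)) * gauss_weight 0 (norm x))"
      unfolding gauss_weight_norm D2[OF x]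
      by (simp add: ennreal_mult[symmetric] quot_nonneg tang_nonneg mult.assoc del: ennreal_plus)
  qed
  also have "\<dots> = ennreal (r\<^sup>2) * (\<integral>\<^sup>+x. ennreal (quot (r *\<^sub>R sgn x) + tang (r *\<^sub>R sgn x)) * gauss_weight 0 (norm x) \<partial>lborel)"
    by (rule nn_integral_cmult) measurable
  finally show ?thesis
    using r by (simp add: ennreal_mult_le_mult_iff)
qed

text \<open>Integrating the inequality on spheres with \<open>pos_power (N - 1)\<close>, both sides
  become full integrals by the polar formula, with the constants of weights 2 and 0. Their ratio N
  yields \<open>N * quot <= quot + tang\<close> in integrated form, and one copy of
  \<open>quot\<close> is subtracted.\<close>

lemma tangential_inequality:
  assumes mean0: "\<And>r. r > 0 \<Longrightarrow> (\<integral>x. u (r *\<^sub>R sgn x) * norm x * gauss x \<partial>lborel) = 0"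
  shows "(real DIM('a) - 1) * (\<integral>x. quot x \<partial>lborel) \<le> (\<integral>x. tang x \<partial>lborel)"
proof -
  let ?N = "DIM('a)"
  let ?k = "polar_const ?N (gauss_weight 0)"
  have "polar_const ?N (gauss_weight 2) * (\<integral>\<^sup>+x. ennreal (quot x) \<partial>lborel) =
    (\<integral>\<^sup>+r. ennreal (pos_power (?N - 1) r) * (\<integral>\<^sup>+x. ennreal (quot (r *\<^sub>R sgn x)) * gauss_weight 2 (norm x) \<partial>lborel) \<partial>lborel)"
    by (rule nn_integral_polar[symmetric]) measurable
  also have "\<dots> \<le> (\<integral>\<^sup>+r. ennreal (pos_power (?N - 1) r) *
    (\<integral>\<^sup>+x. ennreal (quot (r *\<^sub>R sgn x) + tang (r *\<^sub>R sgn x)) * gauss_weight 0 (norm x) \<partial>lborel) \<partial>lborel)"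
  proof (rule nn_integral_mono)
    fix r :: real
    show "ennreal (pos_power (?N - 1) r) * (\<integral>\<^sup>+x. ennreal (quot (r *\<^sub>R sgn x)) * gauss_weight 2 (norm x) \<partial>lborel) \<le>
      ennreal (pos_power (?N - 1) r) * (\<integral>\<^sup>+x. ennreal (quot (r *\<^sub>R sgn x) + tang (r *\<^sub>R sgn x)) * gauss_weight 0 (norm x) \<partial>lborel)"
    proof (cases "r > 0")
      case True
      then show ?thesis by (intro mult_left_mono sphere_Poincare mean0) auto
    qed (simp add: pos_power_def)
  qed
  also have "\<dots> = ?k * (\<integral>\<^sup>+x. ennreal (quot x + tang x) \<partial>lborel)"
    by (rule nn_integral_polar) measurable
  finally have 1: "?k * (of_nat ?N * (\<integral>\<^sup>+x. ennreal (quot x) \<partial>lborel)) \<le> ?k * (\<integral>\<^sup>+x. ennreal (quot x + tang x) \<partial>lborel)"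
    unfolding polar_const_gauss(1) by (simp add: ac_simps)
  have i: "integrable lborel (\<lambda>x. quot x + tang x)"
    by (intro Bochner_Integration.integrable_add integrable_quot integrable_tang)
  have "of_nat ?N * (\<integral>\<^sup>+x. ennreal (quot x) \<partial>lborel) \<le> (\<integral>\<^sup>+x. ennreal (quot x + tang x) \<partial>lborel)"
    using 1 polar_const_gauss(2,3)[where 'a='a] by (simp add: ennreal_mult_le_mult_iff)
  also have "\<dots> = ennreal (\<integral>x. quot x + tang x \<partial>lborel)"
    by (rule nn_integral_eq_integral[OF i]) (simp add: quot_nonneg tang_nonneg)
  also have "(\<integral>\<^sup>+x. ennreal (quot x) \<partial>lborel) = ennreal (\<integral>x. quot x \<partial>lborel)"
    by (rule nn_integral_eq_integral[OF integrable_quot]) (simp add: quot_nonneg)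
  finally have "ennreal (real ?N * (\<integral>x. quot x \<partial>lborel)) \<le> ennreal (\<integral>x. quot x + tang x \<partial>lborel)"
    by (simp add: ennreal_mult ennreal_of_nat_eq_real_of_nat quot_nonneg integral_nonneg_AE)
  then have "real ?N * (\<integral>x. quot x \<partial>lborel) \<le> (\<integral>x. quot x + tang x \<partial>lborel)"
    by (rule ennreal_le_iff[THEN iffD1, rotated]) (simp add: quot_nonneg tang_nonneg integral_nonneg_AE)
  also have "\<dots> = (\<integral>x. quot x \<partial>lborel) + (\<integral>x. tang x \<partial>lborel)"
    by (rule Bochner_Integration.integral_add[OF integrable_quot integrable_tang])
  finally show ?thesis by (simp add: algebra_simps)
qed

theorem Hardy_with_remainder:
  assumes mean0: "\<And>r. r > 0 \<Longrightarrow> (\<integral>x. u (r *\<^sub>R sgn x) * norm x * gauss x \<partial>lborel) = 0"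
  shows "(real DIM('a))\<^sup>2 / 4 * (\<integral>x. quot x \<partial>lborel) + (\<integral>x. (remainder x)\<^sup>2 \<partial>lborel) \<le>
    (\<integral>x. (norm (g x))\<^sup>2 \<partial>lborel)"
proof -
  have "(real DIM('a))\<^sup>2 / 4 = (real DIM('a) - 1) + ((real DIM('a) - 2) / 2)\<^sup>2"
    by (simp add: power2_eq_square field_simps)
  moreover have "(real DIM('a) - 1) * (\<integral>x. quot x \<partial>lborel) \<le> (\<integral>x. tang x \<partial>lborel)"
    by (rule tangential_inequality) (rule mean0)
  ultimately show ?thesis unfolding dirichlet_split by (simp only: distrib_right)
qed

text \<open>A vanishing remainder means that $r^{(N-2)/2} u$ is constant along rays.\<close>

lemma remainder_zero_imp_zero:
  assumes "(\<integral>x. (remainder x)\<^sup>2 \<partial>lborel) = 0"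
  shows "u = (\<lambda>x. 0)"
proof
  fix x
  define b where "b = (real DIM('a) - 2) / 2"
  have cont: "continuous_on (- {0}) remainder"
    unfolding remainder_def rad_def sgn_div_norm
    by (intro continuous_intros continuous_on_subset[OF cont_g] continuous_on_subset[OF cont_u]) auto
  have "AE x in lborel. (remainder x)\<^sup>2 = 0"
    using assms integrable_remainder by (subst (asm) integral_nonneg_eq_0_iff_AE) auto
  then have ae: "AE x in lebesgue. remainder x = 0"
    by (intro AE_completion) auto
  \<comment> \<open>The set where \<open>remainder\<close> is nonzero is open, by continuity away
    from 0, and negligible, hence empty off the origin.\<close>
  have zero: "remainder x = 0" if "x \<noteq> 0" for x
  proof (rule ccontr)
    assume "remainder x \<noteq> 0"
    define T where "T = {y \<in> - {0}. remainder y \<noteq> 0}"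
    have "open T"
    proof -
      have "T = - {0} \<inter> remainder -` (- {0})" by (auto simp: T_def)
      then show ?thesis using continuous_open_preimage[OF cont, of "- {0}"] by auto
    qed
    moreover have "T \<noteq> {}" using \<open>remainder x \<noteq> 0\<close> that by (auto simp: T_def)
    ultimately have "\<not> negligible T" by (rule open_not_negligible)
    moreover have "negligible T"
    proof -
      obtain Z where "{x. remainder x \<noteq> 0} \<subseteq> Z" "Z \<in> null_sets lebesgue"
        using ae by (auto simp: eventually_ae_filter)
      then show ?thesis
        by (metis (no_types, lifting) T_def mem_Collect_eq negligible_iff_null_sets negligible_subset subset_eq)
    qed
    ultimately show False by blast
  qed
  show "u x = 0"
  proof (cases "x = 0")
    case False
    define f where "f t = t powr b * u (t *\<^sub>R x)" for t
    have d: "(f has_real_derivative 0) (at t)" if t: "t > 0" for t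
    proof -
      have l: "((\<lambda>t. t *\<^sub>R x) has_derivative (\<lambda>h. h *\<^sub>R x)) (at t)"
        by (auto intro!: derivative_eq_intros)
      have "((\<lambda>t. u (t *\<^sub>R x)) has_derivative (\<lambda>h. g (t *\<^sub>R x) \<bullet> (h *\<^sub>R x))) (at t)"
        using diff_chain_at[OF l deriv] by (simp add: o_def)
      then have du: "((\<lambda>t. u (t *\<^sub>R x)) has_real_derivative g (t *\<^sub>R x) \<bullet> x) (at t)"
        unfolding has_field_derivative_def by (rule has_derivative_eq_rhs) (simp add: fun_eq_iff mult.commute)
      have "(f has_real_derivative (b * t powr (b - 1)) * u (t *\<^sub>R x) + (g (t *\<^sub>R x) \<bullet> x) * t powr b) (at t)"
        unfolding f_def[abs_def] by (rule DERIV_mult[OF has_real_derivative_powr[OF t] du])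
      moreover have "(b * t powr (b - 1)) * u (t *\<^sub>R x) + (g (t *\<^sub>R x) \<bullet> x) * t powr b = 0"
      proof -
        have r: "rad (t *\<^sub>R x) = (g (t *\<^sub>R x) \<bullet> x) / norm x"
          using t False by (simp add: rad_def sgn_div_norm sgn_scaleR field_simps)
        have "remainder (t *\<^sub>R x) = 0" using zero t False by simp
        then have "(g (t *\<^sub>R x) \<bullet> x) + b * (u (t *\<^sub>R x) / t) = 0"
          using t False by (simp add: remainder_def r b_def[symmetric] field_simps)
        then have "t powr b * ((g (t *\<^sub>R x) \<bullet> x) + b * (u (t *\<^sub>R x) / t)) = 0" by simp
        then show ?thesis using t by (simp add: powr_diff algebra_simps)
      qed
      ultimately show ?thesis by simp
    qed
    \<comment> \<open>Far enough out for \<open>M x\<close> to lie beyond the support; the 2 ensures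
      \<open>M > 1\<close>. Then \<open>f\<close> is constant from \<open>t = 1\<close>, where it is
      \<open>u x\<close>, to \<open>t = M\<close>, where it is 0.\<close>
    define M where "M = max 2 ((\<bar>R\<bar> + 1) / norm x)"
    have "R < norm (M *\<^sub>R x)"
    proof -
      have "\<bar>R\<bar> + 1 \<le> M * norm x" using False by (simp add: M_def pos_divide_le_eq[symmetric])
      moreover have "M \<ge> 2" by (simp add: M_def)
      ultimately show ?thesis by simp
    qed
    then have "u (M *\<^sub>R x) = 0" using supp by blast
    then have fM: "f M = 0" by (simp add: f_def)
    have "f M = f 1"
    proof (rule DERIV_isconst2[of 1 M f M, symmetric, THEN sym])
      show "1 < M" by (simp add: M_def)
      show "continuous_on {1..M} f"
        by (rule continuous_at_imp_continuous_on) (auto intro: DERIV_isCont[OF d])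
      show "1 < y \<Longrightarrow> y < M \<Longrightarrow> DERIV f y :> 0" for y using d[of y] by simp
    qed (auto simp: M_def)
    then show ?thesis using fM by (simp add: f_def[of 1])
  qed (simp add: u0)
qed

end

section \<open>The surface measure and admissible functions\<close>

lemma C_k_differentiable: "C_k (Suc 0) f \<Longrightarrow> (f has_derivative frechet_derivative f (at x)) (at x)"
  by (simp add: frechet_derivative_works[symmetric])

lemma inner_gradient:
  fixes u :: "real ^ 'n \<Rightarrow> real"
  assumes "(u has_derivative D) (at x)"
  shows "gradient u x \<bullet> h = D h"
proof -
  interpret D: bounded_linear D by (rule has_derivative_bounded_linear[OF assms])
  have "D h = D (\<Sum>i\<in>UNIV. h $ i *\<^sub>R axis i 1)"
    by (simp add: basis_expansion[of h, unfolded scalar_mult_eq_scaleR])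
  also have "\<dots> = (\<Sum>i\<in>UNIV. h $ i * D (axis i 1))"
    by (simp add: D.sum D.scaleR)
  finally show ?thesis
    unfolding gradient_def frechet_derivative_at[OF assms, symmetric]
    by (simp add: inner_vec_def mult.commute)
qed

lemma integral_sphere_measure:
  fixes h :: "real ^ 'n \<Rightarrow> real"
  assumes [measurable]: "h \<in> borel_measurable borel"
  shows "(\<integral>w. h w \<partial>sphere_measure) = real CARD('n) * (\<integral>x. indicator (cball 0 1 - {0}) x * h (sgn x) \<partial>lborel)"
proof -
  let ?B = "cball 0 1 - {0} :: (real ^ 'n) set"
  let ?M = "distr (restrict_space lborel ?B) (restrict_space borel (sphere 0 1)) (\<lambda>x. x /\<^sub>R norm x)"
  have meas: "(\<lambda>x. x /\<^sub>R norm x) \<in> restrict_space lborel ?B \<rightarrow>\<^sub>M restrict_space borel (sphere 0 1)"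
    by (intro measurable_restrict_space2 measurable_restrict_space1) (auto simp: space_restrict_space)
  have hm: "h \<in> borel_measurable (restrict_space borel (sphere 0 1))"
    by (rule measurable_restrict_space1) measurable
  \<comment> \<open>Scaling is rewritten as a constant density so that
    \<open>integral_density\<close> applies.\<close>
  have D: "sphere_measure = density ?M (\<lambda>_. ennreal (real CARD('n)))"
    unfolding sphere_measure_def
    by (rule measure_eqI) (auto simp: emeasure_density_const ennreal_of_nat_eq_real_of_nat)
  have "(\<integral>w. h w \<partial>sphere_measure) = (\<integral>w. real CARD('n) *\<^sub>R h w \<partial>?M)"
    unfolding D by (rule integral_density) (use hm in auto)
  also have "\<dots> = real CARD('n) * (\<integral>x. h (x /\<^sub>R norm x) \<partial>restrict_space lborel ?B)"
    using hm by (simp add: integral_distr[OF meas])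
  also have "(\<integral>x. h (x /\<^sub>R norm x) \<partial>restrict_space lborel ?B) = (\<integral>x. indicator ?B x * h (sgn x) \<partial>lborel)"
    by (subst integral_restrict_space) (auto simp: sgn_div_norm)
  finally show ?thesis .
qed

text \<open>The indicator of the unit interval and \<open>gauss_weight 1\<close> are two radial
  weights for the same function of the direction. The exchange of weights concerns nonnegative
  functions, so it is applied to the positive and the negative part: mean zero says that their
  integrals agree, and this survives a common factor.\<close>

lemma sphere_mean_zero_gauss:
  fixes h :: "real ^ 'n \<Rightarrow> real"
  assumes h: "continuous_on UNIV h" and zero: "(\<integral>w. h w \<partial>sphere_measure) = 0"
  shows "(\<integral>x. h (sgn x) * norm x * gauss x \<partial>lborel) = 0"
proof -
  have hm[measurable]: "h \<in> borel_measurable borel" by (rule borel_measurable_continuous_onI[OF h])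
  have "compact (h ` cball 0 1)"
    by (intro compact_continuous_image continuous_on_subset[OF h]) auto
  then obtain B where B: "\<And>s. norm s \<le> 1 \<Longrightarrow> \<bar>h s\<bar> \<le> B"
    by (fastforce dest!: compact_imp_bounded simp: bounded_iff)
  have Bs: "\<bar>h (sgn x)\<bar> \<le> B" for x by (rule B) (simp add: norm_sgn)
  have B0: "0 \<le> B" using Bs[of 0] by linarith
  let ?f = "\<lambda>x. indicator (cball 0 1 - {0}) x * h (sgn x)"
  let ?g = "\<lambda>x. h (sgn x) * norm x * gauss x"
  have f: "integrable lborel ?f"
  proof (rule integrable_bounded_support[where B=B and R=1])
    show "?f \<in> borel_measurable borel"
      by (intro borel_measurable_times borel_measurable_indicator measurable_compose[OF borel_measurable_sgn_vec hm]) auto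
  qed (use Bs B0 in \<open>auto split: split_indicator\<close>)
  have g: "integrable lborel ?g"
  proof (rule integrable_gauss_bound[where C=B and k=1])
    show "\<bar>h (sgn x) * norm x\<bar> \<le> B * (1 + norm x) ^ 1" for x
      unfolding abs_mult using Bs[of x] B0 by (intro mult_mono) auto
  qed measurable
  define J where "J = (\<integral>\<^sup>+r. ennreal (pos_power (DIM(real ^ 'n) - 1) r) * indicator {0<..1} r \<partial>lborel)"
  have J: "J \<noteq> 0" "J < \<infinity>" unfolding J_def by (rule nn_integral_unit_interval_pos_power)+
  \<comment> \<open>Taking \<open>c = 1\<close> and \<open>c = -1\<close> selects the positive and
    the negative part, since \<open>ennreal\<close> sends negative numbers to 0.\<close>
  have fe: "ennreal (c * ?f x) = ennreal (c * h (sgn x)) * indicator {0<..1} (norm x)" for c and x :: "real ^ 'n"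
    by (auto split: split_indicator)
  have ge: "ennreal (c * ?g x) = ennreal (c * h (sgn x)) * gauss_weight 1 (norm x)" for c and x :: "real ^ 'n"
    unfolding gauss_weight_norm by (simp add: ennreal_mult''[symmetric] mult.assoc)
  have P: "J * (\<integral>\<^sup>+x. ennreal (c * ?g x) \<partial>lborel) =
    polar_const DIM(real ^ 'n) (gauss_weight 1) * (\<integral>\<^sup>+x. ennreal (c * ?f x) \<partial>lborel)" for c
    unfolding fe ge J_def by (rule nn_integral_polar_prod) measurable
  have "(\<integral>x. ?f x \<partial>lborel) = 0"
    using zero integral_sphere_measure[OF hm] by simp
  moreover have "(\<integral>\<^sup>+x. ennreal (?f x) \<partial>lborel) \<noteq> \<infinity>" "(\<integral>\<^sup>+x. ennreal (- ?f x) \<partial>lborel) \<noteq> \<infinity>"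
    using f by (auto simp: real_integrable_def)
  moreover have "A = B" if "enn2real A - enn2real B = 0" "A \<noteq> \<infinity>" "B \<noteq> \<infinity>" for A B
    using that by (cases A; cases B) auto
  ultimately have "(\<integral>\<^sup>+x. ennreal (?f x) \<partial>lborel) = (\<integral>\<^sup>+x. ennreal (- ?f x) \<partial>lborel)"
    unfolding real_lebesgue_integral_def[OF f] by blast
  then have "J * (\<integral>\<^sup>+x. ennreal (?g x) \<partial>lborel) = J * (\<integral>\<^sup>+x. ennreal (- ?g x) \<partial>lborel)"
    using P[of 1] P[of "-1"] by simp
  then have "(\<integral>\<^sup>+x. ennreal (?g x) \<partial>lborel) = (\<integral>\<^sup>+x. ennreal (- ?g x) \<partial>lborel)"
    using J by (auto simp: ennreal_mult_cancel_left)
  then show ?thesis unfolding real_lebesgue_integral_def[OF g] by simp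
qed

text \<open>The mass of the sphere is N times the volume of the unit ball, hence positive. At
  \<open>r = 0\<close> the mean value condition integrates the constant \<open>u 0\<close>, which
  therefore vanishes.\<close>

lemma integral_const_sphere_measure_eq_0:
  "(\<integral>w. c \<partial>(sphere_measure :: (real ^ 'n) measure)) = 0 \<Longrightarrow> c = (0::real)"
proof -
  assume a: "(\<integral>w. c \<partial>(sphere_measure :: (real ^ 'n) measure)) = 0"
  have "(\<integral>x. indicator (cball 0 1 - {0::real ^ 'n}) x * c \<partial>lborel) = measure lborel (cball 0 1 - {0::real ^ 'n}) * c"
    by (subst integral_mult_left_zero) simp
  then have "(\<integral>w. c \<partial>(sphere_measure :: (real ^ 'n) measure)) = real CARD('n) * (measure lborel (cball 0 1 - {0::real ^ 'n}) * c)"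
    using integral_sphere_measure[of "\<lambda>_::real ^ 'n. c"] by (simp del: Bochner_Integration.lebesgue_integral_const)
  moreover have "measure lborel (cball 0 1 - {0::real ^ 'n}) = measure lborel (cball 0 1 :: (real ^ 'n) set)"
    by (rule measure_Diff_null_set) auto
  moreover have "0 < measure lborel (cball 0 1 :: (real ^ 'n) set)" by (rule content_cball_pos) simp
  ultimately show "c = 0" using a by (simp del: Bochner_Integration.lebesgue_integral_const)
qed

lemma C0_infinity_compact_C1:
  fixes u :: "real ^ 'n \<Rightarrow> real"
  assumes u: "u \<in> C0_infinity" and u0: "u 0 = 0"
  shows "\<exists>R. compact_C1 u (gradient u) R"
proof -
  have C1: "C_k (Suc 0) u" and K: "compact (closure {x. u x \<noteq> 0})"
    using u by (auto simp: C0_infinity_def)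
  obtain R where R: "\<And>x. x \<in> closure {x. u x \<noteq> 0} \<Longrightarrow> norm x \<le> R"
    using compact_imp_bounded[OF K] by (auto simp: bounded_iff)
  have der: "(u has_derivative frechet_derivative u (at x)) (at x)" for x
    by (rule C_k_differentiable[OF C1])
  have gr: "gradient u x \<bullet> h = frechet_derivative u (at x) h" for x h
    by (rule inner_gradient[OF der])
  have "compact_C1 u (gradient u) R"
  proof
    show "(u has_derivative (\<lambda>h. gradient u x \<bullet> h)) (at x)" for x
      unfolding gr using der by simp
    show "continuous_on UNIV (gradient u)"
      unfolding gradient_def using C1 by (auto intro!: continuous_on_vec_lambda)
    show "u x = 0 \<and> gradient u x = 0" if "R < norm x" for x
    proof
      have x: "x \<in> - closure {x. u x \<noteq> 0}" using R[of x] that by auto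
      then show "u x = 0" using closure_subset[of "{x. u x \<noteq> 0}"] by auto
      have "((\<lambda>x. 0) has_derivative (\<lambda>h. 0)) (at x)" by simp
      then have "(u has_derivative (\<lambda>h. 0)) (at x)"
        by (rule has_derivative_transform_within_open[where s="- closure {x. u x \<noteq> 0}"])
          (use x closure_subset[of "{x. u x \<noteq> 0}"] in auto)
      then have "frechet_derivative u (at x) = (\<lambda>h. 0)"
        using frechet_derivative_at by metis
      then show "gradient u x = 0" by (simp add: gradient_def vec_eq_iff)
    qed
    show "u 0 = 0" by (rule u0)
  qed
  then show ?thesis ..
qed

lemma admissible_zero:
  fixes u :: "real ^ 'n \<Rightarrow> real"
  assumes "u \<in> admissible"
  shows "u 0 = 0"
proof -
  have "(\<integral>w. u (0 *\<^sub>R w) \<partial>sphere_measure) = 0"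
    using assms unfolding admissible_def by blast
  then show ?thesis using integral_const_sphere_measure_eq_0[of "u 0"] by simp
qed

section \<open>Smooth test functions\<close>

text \<open>Coinduction replaces induction on the order of differentiation: any class of functions
  that contains a derivative of each of its members consists of smooth functions.\<close>

coinductive smooth_real :: "(real \<Rightarrow> real) \<Rightarrow> bool" where
  smooth_realI: "(\<And>x. (f has_real_derivative f' x) (at x)) \<Longrightarrow> smooth_real f' \<Longrightarrow> smooth_real f"

lemma smooth_real_deriv:
  assumes "smooth_real f"
  shows "\<exists>f'. (\<forall>x. (f has_real_derivative f' x) (at x)) \<and> smooth_real f'"
  using assms by cases blast

lemma smooth_real_class:
  assumes "P f" and step: "\<And>f. P f \<Longrightarrow> \<exists>f'. P f' \<and> (\<forall>x. (f has_real_derivative f' x) (at x))"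
  shows "smooth_real f"
  using \<open>P f\<close>
proof (coinduction arbitrary: f)
  case (smooth_real f)
  from step[OF this] show ?case by blast
qed

lemma smooth_real_lincomb:
  assumes "smooth_real f" "smooth_real g"
  shows "smooth_real (\<lambda>x. a * f x + b * g x)"
proof (rule smooth_real_class[where P="\<lambda>h. \<exists>f g. smooth_real f \<and> smooth_real g \<and> h = (\<lambda>x. a * f x + b * g x)"])
  show "\<exists>f' g'. smooth_real f' \<and> smooth_real g' \<and> (\<lambda>x. a * f x + b * g x) = (\<lambda>x. a * f' x + b * g' x)"
    by (rule exI[of _ f], rule exI[of _ g]) (intro conjI assms refl)
next
  fix h assume "\<exists>f g. smooth_real f \<and> smooth_real g \<and> h = (\<lambda>x. a * f x + b * g x)"
  then obtain f g where h: "h = (\<lambda>x. a * f x + b * g x)" and f: "smooth_real f" and g: "smooth_real g" by blast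
  obtain f' where f': "\<And>x. (f has_real_derivative f' x) (at x)" "smooth_real f'"
    using smooth_real_deriv[OF f] by (elim exE conjE) (rule that, auto)
  obtain g' where g': "\<And>x. (g has_real_derivative g' x) (at x)" "smooth_real g'"
    using smooth_real_deriv[OF g] by (elim exE conjE) (rule that, auto)
  have "(h has_real_derivative a * f' x + b * g' x) (at x)" for x
    unfolding h by (intro DERIV_add DERIV_cmult f' g')
  then show "\<exists>h'. (\<exists>f g. smooth_real f \<and> smooth_real g \<and> h' = (\<lambda>x. a * f x + b * g x)) \<and>
      (\<forall>x. (h has_real_derivative h' x) (at x))"
    using f'(2) g'(2) by (intro exI[of _ "\<lambda>x. a * f' x + b * g' x"] conjI exI[of _ f'] exI[of _ g'] refl allI)
qed

text \<open>The free factor \<open>a\<close> in the class absorbs the \<open>c\<close> that each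
  differentiation produces.\<close>

lemma smooth_real_scale:
  assumes "smooth_real f"
  shows "smooth_real (\<lambda>x. f (c * x))"
proof (rule smooth_real_class[where P="\<lambda>h. \<exists>a f. smooth_real f \<and> h = (\<lambda>x. a * f (c * x))"])
  show "\<exists>a f'. smooth_real f' \<and> (\<lambda>x. f (c * x)) = (\<lambda>x. a * f' (c * x))"
    using assms by (intro exI[of _ 1] exI[of _ f]) auto
next
  fix h assume "\<exists>a f. smooth_real f \<and> h = (\<lambda>x. a * f (c * x))"
  then obtain a f where h: "h = (\<lambda>x. a * f (c * x))" and f: "smooth_real f" by blast
  obtain f' where f': "\<And>x. (f has_real_derivative f' x) (at x)" "smooth_real f'"
    using smooth_real_deriv[OF f] by (elim exE conjE) (rule that, auto)
  have "((\<lambda>x. f (c * x)) has_real_derivative f' (c * x) * c) (at x)" for x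
    by (rule DERIV_chain2[OF f'(1)]) (auto intro!: derivative_eq_intros)
  then have D: "(h has_real_derivative a * (f' (c * x) * c)) (at x)" for x
    unfolding h by (intro DERIV_cmult)
  have "(h has_real_derivative (a * c) * f' (c * x)) (at x)" for x
    using D[of x] by (simp add: ac_simps)
  then show "\<exists>h'. (\<exists>a f. smooth_real f \<and> h' = (\<lambda>x. a * f (c * x))) \<and>
      (\<forall>x. (h has_real_derivative h' x) (at x))"
    using f'(2) by (intro exI[of _ "\<lambda>x. (a * c) * f' (c * x)"] conjI exI[of _ "a * c"] exI[of _ f'] refl allI)
qed

section \<open>Bump functions supported in the unit interval\<close>

lemma power_le_fact_exp:
  fixes y :: real
  assumes "0 \<le> y"
  shows "y ^ n \<le> fact n * exp y"
proof -
  have "(\<Sum>i\<in>{n}. y ^ i /\<^sub>R fact i) \<le> (\<Sum>i. y ^ i /\<^sub>R fact i)"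
    by (rule sum_le_suminf[OF summable_exp_generic]) (use assms in auto)
  then have "y ^ n / fact n \<le> exp y"
    unfolding exp_def by (simp add: field_simps)
  then show ?thesis by (simp add: pos_divide_le_eq mult.commute)
qed

text \<open>A single term of the exponential series at \<open>1 / s\<close>, taken of order
  \<open>k + 2\<close> rather than \<open>k\<close>: the two spare powers of \<open>s\<close> give
  the quadratic decay at the edge of the support.\<close>

lemma exp_inverse_le:
  fixes s :: real
  assumes "s > 0"
  shows "exp (- (1 / s)) / s ^ k \<le> fact (k + 2) * s\<^sup>2"
proof -
  have "(1 / s) ^ (k + 2) \<le> fact (k + 2) * exp (1 / s)"
    by (rule power_le_fact_exp) (use assms in simp)
  then have "(1 / s) ^ (k + 2) * exp (- (1 / s)) \<le> fact (k + 2) * exp (1 / s) * exp (- (1 / s))"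
    by (intro mult_right_mono) auto
  also have "fact (k + 2) * exp (1 / s) * exp (- (1 / s)) = fact (k + 2)"
    by (simp only: mult.assoc exp_add[symmetric]) simp
  finally have "exp (- (1 / s)) / s ^ (k + 2) \<le> fact (k + 2)"
    by (simp only: power_one_over) (simp add: divide_inverse mult.commute power_inverse)
  then have "exp (- (1 / s)) / s ^ (k + 2) * s\<^sup>2 \<le> fact (k + 2) * s\<^sup>2"
    by (intro mult_right_mono) auto
  then show ?thesis using assms by (simp only: power_add) (simp add: field_simps)
qed

text \<open>Unlike the single bump function $\exp(-1/(1-t^2))$, this family is closed under differentiation.\<close>

definition bump_poly :: "real poly \<Rightarrow> nat \<Rightarrow> real \<Rightarrow> real" where
  "bump_poly p k t = (if \<bar>t\<bar> < 1 then poly p t / (1 - t\<^sup>2) ^ k * exp (- (1 / (1 - t\<^sup>2))) else 0)"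

text \<open>Quadratic smallness at every point outside the open interval yields both the value 0 and
  the derivative 0 there. It follows from the decay in \<open>s = 1 - t^2\<close>, since
  \<open>s = (1 - |t|) * (1 + |t|)\<close> is at most \<open>2 * |t - t0|\<close>.\<close>

lemma bump_poly_le:
  obtains C where "\<And>t t0. \<bar>t0\<bar> \<ge> 1 \<Longrightarrow> \<bar>bump_poly p k t\<bar> \<le> C * \<bar>t - t0\<bar>\<^sup>2"
proof -
  have "compact (poly p ` {-1..1})"
    by (intro compact_continuous_image) (auto intro!: continuous_intros)
  then obtain B where B: "\<And>t. t \<in> {-1..1} \<Longrightarrow> \<bar>poly p t\<bar> \<le> B"
    by (fastforce dest!: compact_imp_bounded simp: bounded_iff)
  have B0: "0 \<le> B" using B[of 0] by auto
  show ?thesis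
  proof (rule that[of "B * (fact (k + 2) * 4)"])
    fix t t0 :: real assume t0: "\<bar>t0\<bar> \<ge> 1"
    show "\<bar>bump_poly p k t\<bar> \<le> B * (fact (k + 2) * 4) * \<bar>t - t0\<bar>\<^sup>2"
    proof (cases "\<bar>t\<bar> < 1")
      case True
      define s where "s = 1 - t\<^sup>2"
      have s0: "s > 0" using True by (simp add: s_def abs_square_less_1)
      have "s = (1 - \<bar>t\<bar>) * (1 + \<bar>t\<bar>)"
        by (simp add: s_def algebra_simps power2_eq_square)
      also have "\<dots> \<le> \<bar>t - t0\<bar> * 2"
        using True t0 by (intro mult_mono) auto
      finally have "s\<^sup>2 \<le> (\<bar>t - t0\<bar> * 2)\<^sup>2" using s0 by (intro power_mono) auto
      then have s2: "s\<^sup>2 \<le> 4 * \<bar>t - t0\<bar>\<^sup>2" by (simp add: power_mult_distrib)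
      have "\<bar>bump_poly p k t\<bar> = \<bar>poly p t\<bar> * (exp (- (1 / s)) / s ^ k)"
        using True s0 by (simp add: bump_poly_def s_def[symmetric] abs_mult)
      also have "\<dots> \<le> B * (fact (k + 2) * s\<^sup>2)"
        using True s0 B0 by (intro mult_mono B exp_inverse_le) auto
      also have "\<dots> \<le> B * (fact (k + 2) * (4 * \<bar>t - t0\<bar>\<^sup>2))"
        using B0 s2 by (intro mult_left_mono) auto
      finally show ?thesis by (simp add: mult.assoc)
    qed (use B0 in \<open>auto simp: bump_poly_def\<close>)
  qed
qed

text \<open>With \<open>s = 1 - t^2\<close>, the polynomial \<open>[:1, 0, -1:]\<close>, the
  derivative of \<open>p / s^k * exp (- 1 / s)\<close> over the common denominator
  \<open>s^(k + 2)\<close> has the numerator \<open>p' s^2 + 2 k t p s - 2 t p\<close>. At points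
  with \<open>|t| >= 1\<close> the difference quotient is at most
  \<open>C * |y - t|\<close>.\<close>

lemma has_real_derivative_bump_poly:
  "(bump_poly p k has_real_derivative
    bump_poly (pderiv p * [:1, 0, -1:] ^ 2 + [:0, 2 * real k:] * p * [:1, 0, -1:] + [:0, -2:] * p) (k + 2) t) (at t)"
proof (cases "\<bar>t\<bar> < 1")
  case True
  define s where "s = 1 - t\<^sup>2"
  have s0: "s > 0" using True by (simp add: s_def abs_square_less_1)
  have "((\<lambda>t. poly p t / (1 - t\<^sup>2) ^ k * exp (- (1 / (1 - t\<^sup>2)))) has_real_derivative
    ((poly (pderiv p) t * s ^ k - poly p t * (real k * ((- 2 * t) * s ^ (k - 1)))) / (s ^ k * s ^ k)) * exp (- (1 / s))
      + (exp (- (1 / s)) * (- 2 * t / (s * s))) * (poly p t / s ^ k)) (at t)"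
  proof -
    have q: "((\<lambda>t. 1 - t\<^sup>2) has_real_derivative - 2 * t) (at t)"
      by (auto intro!: derivative_eq_intros)
    have d1: "((\<lambda>t. poly p t / (1 - t\<^sup>2) ^ k) has_real_derivative
        (poly (pderiv p) t * (1 - t\<^sup>2) ^ k - poly p t * (real k * ((- 2 * t) * (1 - t\<^sup>2) ^ (k - 1)))) /
        ((1 - t\<^sup>2) ^ k * (1 - t\<^sup>2) ^ k)) (at t)"
      using DERIV_divide[OF poly_DERIV DERIV_power[OF q]] s0 unfolding s_def by simp
    have d2: "((\<lambda>t. exp (- (1 / (1 - t\<^sup>2)))) has_real_derivative
        exp (- (1 / (1 - t\<^sup>2))) * (- 2 * t / ((1 - t\<^sup>2) * (1 - t\<^sup>2)))) (at t)"
      using s0 unfolding s_def by (auto intro!: derivative_eq_intros q)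
    show ?thesis unfolding s_def by (rule DERIV_mult[OF d1 d2])
  qed
  also have "((poly (pderiv p) t * s ^ k - poly p t * (real k * ((- 2 * t) * s ^ (k - 1)))) / (s ^ k * s ^ k)) * exp (- (1 / s))
      + (exp (- (1 / s)) * (- 2 * t / (s * s))) * (poly p t / s ^ k) =
    bump_poly (pderiv p * [:1, 0, -1:] ^ 2 + [:0, 2 * real k:] * p * [:1, 0, -1:] + [:0, -2:] * p) (k + 2) t"
  proof -
    have P: "poly [:1, 0, -1:] t = s" by (simp add: s_def power2_eq_square)
    \<comment> \<open>The factor \<open>real k\<close> makes the truncated exponent
      \<open>k - 1\<close> harmless at \<open>k = 0\<close>.\<close>
    have e: "real k * s ^ (k - 1) * s = real k * s ^ k" by (cases k) auto
    have 1: "(poly (pderiv p) t * s ^ k - poly p t * (real k * ((- 2 * t) * s ^ (k - 1)))) / (s ^ k * s ^ k) =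
      (poly (pderiv p) t * s + 2 * t * real k * poly p t) / (s ^ k * s)"
    proof -
      have "(poly (pderiv p) t * s ^ k - poly p t * (real k * ((- 2 * t) * s ^ (k - 1)))) * s =
        (poly (pderiv p) t * s + 2 * t * real k * poly p t) * s ^ k"
        using e by (auto simp: algebra_simps)
      then show ?thesis using s0 by (simp add: frac_eq_eq algebra_simps)
    qed
    have 2: "bump_poly (pderiv p * [:1, 0, -1:] ^ 2 + [:0, 2 * real k:] * p * [:1, 0, -1:] + [:0, -2:] * p) (k + 2) t =
      (poly (pderiv p) t * s\<^sup>2 + 2 * t * real k * poly p t * s - 2 * t * poly p t) / s ^ (k + 2) * exp (- (1 / s))"
      using True unfolding bump_poly_def s_def[symmetric]
      by (simp only: poly_add poly_mult poly_power P) (simp add: algebra_simps)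
    show ?thesis unfolding 1 2 using s0 by (simp add: field_simps power2_eq_square)
  qed
  finally show ?thesis
  proof (rule has_field_derivative_transform_within_open[where S="{-1<..<1}"])
    show "poly p x / (1 - x\<^sup>2) ^ k * exp (- (1 / (1 - x\<^sup>2))) = bump_poly p k x" if "x \<in> {-1<..<1}" for x
      using that by (auto simp: bump_poly_def)
  qed (use True in auto)
next
  case False
  obtain C where C: "\<And>t t0. \<bar>t0\<bar> \<ge> 1 \<Longrightarrow> \<bar>bump_poly p k t\<bar> \<le> C * \<bar>t - t0\<bar>\<^sup>2"
    using bump_poly_le[of p k] by blast
  have "((\<lambda>y. (bump_poly p k y - bump_poly p k t) / (y - t)) \<longlongrightarrow> 0) (at t)"
  proof (rule Lim_null_comparison)
    show "\<forall>\<^sub>F y in at t. norm ((bump_poly p k y - bump_poly p k t) / (y - t)) \<le> C * \<bar>y - t\<bar>"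
    proof (rule always_eventually, rule allI)
      fix y
      have "\<bar>bump_poly p k y\<bar> \<le> C * \<bar>y - t\<bar>\<^sup>2" using C[of t y] False by simp
      then show "norm ((bump_poly p k y - bump_poly p k t) / (y - t)) \<le> C * \<bar>y - t\<bar>"
        using False by (cases "y = t") (auto simp: bump_poly_def[of _ _ t] divide_le_eq power2_eq_square mult.assoc)
    qed
    have "((\<lambda>y. C * \<bar>y - t\<bar>) \<longlongrightarrow> C * \<bar>t - t\<bar>) (at t)" by (intro tendsto_intros)
    then show "((\<lambda>y. C * \<bar>y - t\<bar>) \<longlongrightarrow> 0) (at t)" by simp
  qed
  then show ?thesis using False by (simp add: has_field_derivative_iff bump_poly_def[of _ _ t])
qed

lemma smooth_real_bump_poly: "smooth_real (bump_poly p k)"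
proof (rule smooth_real_class[where P="\<lambda>f. \<exists>p k. f = bump_poly p k"])
  show "\<exists>p' k'. bump_poly p k = bump_poly p' k'" by (intro exI) (rule refl)
next
  fix f assume "\<exists>p k. f = bump_poly p k"
  then obtain p k where f: "f = bump_poly p k" by (elim exE)
  have "\<exists>q j. \<forall>x. (f has_real_derivative bump_poly q j x) (at x)"
    unfolding f by (intro exI allI) (rule has_real_derivative_bump_poly)
  then obtain q j where "\<forall>x. (f has_real_derivative bump_poly q j x) (at x)" by (elim exE)
  moreover have "\<exists>p k. bump_poly q j = bump_poly p k" by (intro exI) (rule refl)
  ultimately show "\<exists>f'. (\<exists>p k. f' = bump_poly p k) \<and> (\<forall>x. (f has_real_derivative f' x) (at x))"
    by (intro exI[of _ "bump_poly q j"] conjI)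
qed

text \<open>Differentiation lowers \<open>b\<close> by 1 and replaces \<open>w\<close> by
  \<open>b * w + w'\<close>, which has the same support bound, so the class is closed. Since
  \<open>w\<close> has bounded support, the function vanishes for small positive \<open>s\<close>
  and the extension by 0 is smooth. It provides radial profiles as functions of
  \<open>s = |x|^2\<close>.\<close>

lemma smooth_real_powr_ln:
  assumes "smooth_real w" and "\<And>t. \<bar>t\<bar> > M \<Longrightarrow> w t = 0"
  shows "smooth_real (\<lambda>s. if s > 0 then s powr b * w (ln s) else 0)"
    and "\<And>w' s. (\<And>t. (w has_real_derivative w' t) (at t)) \<Longrightarrow>
      ((\<lambda>s. if s > 0 then s powr b * w (ln s) else 0) has_real_derivative
       (if s > 0 then s powr (b - 1) * (b * w (ln s) + w' (ln s)) else 0)) (at s)"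
proof -
  let ?h = "\<lambda>b w s. if s > 0 then s powr b * w (ln s) else 0 :: real"
  have der: "(?h b w has_real_derivative ?h (b - 1) (\<lambda>t. b * w t + w' t) s) (at s)"
    if w': "\<And>t. (w has_real_derivative w' t) (at t)" and M: "\<And>t. \<bar>t\<bar> > M \<Longrightarrow> w t = 0" for b w w' s
  proof (cases "s > 0")
    case True
    have "((\<lambda>s. s powr b * w (ln s)) has_real_derivative
      (b * s powr (b - 1)) * w (ln s) + (w' (ln s) * (1 / s)) * s powr b) (at s)"
      using True by (auto intro!: derivative_eq_intros DERIV_chain2[OF w'] has_real_derivative_powr)
    also have "(b * s powr (b - 1)) * w (ln s) + (w' (ln s) * (1 / s)) * s powr b = ?h (b - 1) (\<lambda>t. b * w t + w' t) s"
      using True by (simp add: powr_diff field_simps)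
    finally show ?thesis
      by (rule has_field_derivative_transform_within_open[where S="{0<..}"]) (use True in auto)
  next
    case False
    have "((\<lambda>s. 0) has_real_derivative 0) (at s)" by simp
    then have "(?h b w has_real_derivative 0) (at s)"
    \<comment> \<open>On this neighbourhood of the nonpositive axis every positive point has
      logarithm below \<open>- |M|\<close>, outside the support of \<open>w\<close>.\<close>
    proof (rule has_field_derivative_transform_within_open[where S="{..< exp (- \<bar>M\<bar> - 1)}"])
      show "s \<in> {..< exp (- \<bar>M\<bar> - 1)}" using False by (simp add: le_less_trans[OF _ exp_gt_zero] not_less)
      show "0 = ?h b w x" if "x \<in> {..< exp (- \<bar>M\<bar> - 1)}" for x
      proof (cases "x > 0")
        case True
        then have "ln x < - \<bar>M\<bar> - 1" using that by (metis lessThan_iff ln_exp ln_less_cancel_iff exp_gt_zero)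
        then show ?thesis using M[of "ln x"] by simp
      qed simp
    qed auto
    then show ?thesis using False by simp
  qed
  show "((\<lambda>s. if s > 0 then s powr b * w (ln s) else 0) has_real_derivative
       (if s > 0 then s powr (b - 1) * (b * w (ln s) + w' (ln s)) else 0)) (at s)"
    if "\<And>t. (w has_real_derivative w' t) (at t)" for w' s
    by (rule der[OF that assms(2)])
  show "smooth_real (?h b w)"
  proof (rule smooth_real_class[where P="\<lambda>f. \<exists>b w. smooth_real w \<and> (\<forall>t. \<bar>t\<bar> > M \<longrightarrow> w t = 0) \<and> f = ?h b w"])
    show "\<exists>b' w'. smooth_real w' \<and> (\<forall>t. \<bar>t\<bar> > M \<longrightarrow> w' t = 0) \<and> ?h b w = ?h b' w'"
      using assms by blast
  next
    fix f assume "\<exists>b w. smooth_real w \<and> (\<forall>t. \<bar>t\<bar> > M \<longrightarrow> w t = 0) \<and> f = ?h b w"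
    then obtain b w where w: "smooth_real w" "\<And>t. \<bar>t\<bar> > M \<Longrightarrow> w t = 0" and f: "f = ?h b w" by blast
    obtain w' where w': "\<And>t. (w has_real_derivative w' t) (at t)" "smooth_real w'"
      using smooth_real_deriv[OF w(1)] by blast
    have z: "w' t = 0" if "\<bar>t\<bar> > M" for t
    proof -
      have "open {t. \<bar>t\<bar> > M}" by (intro open_Collect_less continuous_intros)
      have "((\<lambda>s. 0) has_real_derivative 0) (at t)" by simp
      then have "(w has_real_derivative 0) (at t)"
        by (rule has_field_derivative_transform_within_open[OF _ \<open>open _\<close>]) (use that w(2) in auto)
      then show ?thesis using w'(1) DERIV_unique by blast
    qed
    define v where "v = (\<lambda>t. b * w t + w' t)"
    have "smooth_real v"
      using smooth_real_lincomb[OF w(1) w'(2), of b 1] by (simp add: v_def)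
    moreover have "\<forall>t. \<bar>t\<bar> > M \<longrightarrow> v t = 0"
      using w(2) z by (simp add: v_def)
    moreover have "\<forall>x. (f has_real_derivative ?h (b - 1) v x) (at x)"
      unfolding f v_def using der[OF w'(1) w(2)] by (intro allI)
    ultimately show "\<exists>f'. (\<exists>b w. smooth_real w \<and> (\<forall>t. \<bar>t\<bar> > M \<longrightarrow> w t = 0) \<and> f' = ?h b w) \<and>
        (\<forall>x. (f has_real_derivative f' x) (at x))"
      apply (rule_tac x="?h (b - 1) v" in exI)
      apply (rule conjI)
       apply (rule_tac x="b - 1" in exI)
       apply (rule_tac x=v in exI)
       apply (intro conjI refl)
        apply assumption+
      done
  qed
qed

text \<open>A class closed under directional derivatives that contains the test functions. Radial
  functions are taken in the variable \<open>x \<bullet> x\<close>, which is smooth at the origin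
  and whose derivative \<open>2 * (x \<bullet> v)\<close> stays in the class.\<close>

inductive smooth_fun :: "('a::euclidean_space \<Rightarrow> real) \<Rightarrow> bool" where
  radial: "smooth_real h \<Longrightarrow> smooth_fun (\<lambda>x. h (x \<bullet> x))"
| inner: "smooth_fun (\<lambda>x. x \<bullet> v)"
| const: "smooth_fun (\<lambda>x. c)"
| add: "smooth_fun f \<Longrightarrow> smooth_fun g \<Longrightarrow> smooth_fun (\<lambda>x. f x + g x)"
| mult: "smooth_fun f \<Longrightarrow> smooth_fun g \<Longrightarrow> smooth_fun (\<lambda>x. f x * g x)"

lemma smooth_fun_deriv:
  "smooth_fun f \<Longrightarrow> \<exists>D. (\<forall>x. (f has_derivative (\<lambda>h. D h x)) (at x)) \<and> (\<forall>v. smooth_fun (D v))"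
proof (induction rule: smooth_fun.induct)
  case (radial h)
  obtain h' where h': "\<And>t. (h has_real_derivative h' t) (at t)" "smooth_real h'"
    using smooth_real_deriv[OF radial] by blast
  have 1: "((\<lambda>x::'a. h (x \<bullet> x)) has_derivative (\<lambda>v. (2 * h' (x \<bullet> x)) * (x \<bullet> v))) (at x)" for x
  proof -
    have "((\<lambda>x::'a. x \<bullet> x) has_derivative (\<lambda>v. 2 * (x \<bullet> v))) (at x)"
      by (auto intro!: derivative_eq_intros simp: inner_commute)
    from diff_chain_at[OF this h'(1)[unfolded has_field_derivative_def]]
    show ?thesis by (simp add: o_def ac_simps)
  qed
  have "smooth_fun (\<lambda>x::'a. (2 * h' (x \<bullet> x)) * (x \<bullet> v))" for v
    by (intro smooth_fun.intros h')
  then show ?case using 1 by (intro exI[of _ "\<lambda>v x. (2 * h' (x \<bullet> x)) * (x \<bullet> v)"]) auto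
next
  case (inner v)
  show ?case
    by (rule exI[of _ "\<lambda>h x. h \<bullet> v"]) (auto intro!: derivative_eq_intros smooth_fun.intros)
next
  case (const c)
  show ?case
    by (rule exI[of _ "\<lambda>h x. 0"]) (auto intro!: smooth_fun.intros)
next
  case (add f g)
  then obtain D E where D: "\<And>x. (f has_derivative (\<lambda>h. D h x)) (at x)" "\<And>v. smooth_fun (D v)"
    and E: "\<And>x. (g has_derivative (\<lambda>h. E h x)) (at x)" "\<And>v. smooth_fun (E v)" by blast
  show ?case
    by (rule exI[of _ "\<lambda>h x. D h x + E h x"]) (auto intro!: has_derivative_add D E smooth_fun.intros)
next
  case (mult f g)
  then obtain D E where D: "\<And>x. (f has_derivative (\<lambda>h. D h x)) (at x)" "\<And>v. smooth_fun (D v)"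
    and E: "\<And>x. (g has_derivative (\<lambda>h. E h x)) (at x)" "\<And>v. smooth_fun (E v)" by blast
  show ?case
    by (rule exI[of _ "\<lambda>h x. f x * E h x + D h x * g x"])
      (auto intro!: has_derivative_mult D E smooth_fun.intros mult.hyps)
qed

lemma smooth_fun_C_k: "smooth_fun f \<Longrightarrow> C_k k f"
proof (induction k arbitrary: f)
  case 0
  then obtain D where "\<And>x. (f has_derivative (\<lambda>h. D h x)) (at x)" using smooth_fun_deriv by blast
  then have "isCont f x" for x using has_derivative_continuous by blast
  then show ?case unfolding C_k.simps by (simp add: continuous_at_imp_continuous_on)
next
  case (Suc k)
  then obtain D where D: "\<And>x. (f has_derivative (\<lambda>h. D h x)) (at x)" "\<And>v. smooth_fun (D v)"
    using smooth_fun_deriv by blast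
  have e: "frechet_derivative f (at x) = (\<lambda>h. D h x)" for x
    using frechet_derivative_at[OF D(1)] by (rule sym)
  have "f differentiable (at x)" for x
    using D(1) by (rule differentiableI)
  moreover have "C_k k (\<lambda>x. frechet_derivative f (at x) v)" for v
    unfolding e by (rule Suc.IH[OF D(2)])
  ultimately show ?case unfolding C_k.simps by blast
qed

text \<open>The substitution \<open>t = e * ln r\<close>. By the support condition only the compact
  interval from \<open>exp (- 1 / e)\<close> to \<open>exp (1 / e)\<close> matters, which keeps
  \<open>r\<close> away from 0.\<close>

lemma nn_integral_ln_scale:
  fixes k :: "real \<Rightarrow> real"
  assumes k[measurable]: "k \<in> borel_measurable borel" and k0: "\<And>t. 0 \<le> k t"
    and supp: "\<And>t. \<bar>t\<bar> > 1 \<Longrightarrow> k t = 0" and e: "e > 0"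
  shows "ennreal e * (\<integral>\<^sup>+r. ennreal (if 0 < r then k (e * ln r) / r else 0) \<partial>lborel) = (\<integral>\<^sup>+t. ennreal (k t) \<partial>lborel)"
proof -
  define a b where "a = exp (- (1 / e))" and "b = exp (1 / e)"
  have ab: "0 < a" "a \<le> b" using e by (auto simp: a_def b_def)
  have ga: "e * ln a = - 1" and gb: "e * ln b = 1" using e by (simp_all add: a_def b_def)
  have "(\<integral>\<^sup>+t. ennreal (k t) \<partial>lborel) = (\<integral>\<^sup>+t. k t * indicator {e * ln a..e * ln b} t \<partial>lborel)"
    unfolding ga gb by (intro nn_integral_cong) (use supp in \<open>auto split: split_indicator simp: not_le abs_real_def\<close>)
  also have "\<dots> = (\<integral>\<^sup>+r. k (e * ln r) * (e / r) * indicator {a..b} r \<partial>lborel)"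
  proof (rule nn_integral_substitution)
    show "((\<lambda>r. e * ln r) has_real_derivative e / r) (at r)" if "r \<in> {a..b}" for r
      using that ab by (auto intro!: derivative_eq_intros)
    show "continuous_on {a..b} (\<lambda>r. e / r)"
      using ab by (intro continuous_intros) auto
    show "0 \<le> e / r" if "r \<in> {a..b}" for r using that ab e by auto
    show "set_borel_measurable borel {e * ln a..e * ln b} k"
      unfolding set_borel_measurable_def by measurable
  qed (rule ab)
  also have "\<dots> = (\<integral>\<^sup>+r. ennreal e * ennreal (if 0 < r then k (e * ln r) / r else 0) \<partial>lborel)"
  proof (rule nn_integral_cong)
    fix r :: real
    show "ennreal (k (e * ln r) * (e / r) * indicator {a..b} r) = ennreal e * ennreal (if 0 < r then k (e * ln r) / r else 0)"
    proof (cases "r \<in> {a..b}")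
      case True
      then show ?thesis using e ab by (simp add: ennreal_mult'[symmetric] ac_simps)
    next
      case False
      have "k (e * ln r) = 0" if r: "r > 0"
      proof (rule supp)
        consider "r < a" | "b < r" using False by fastforce
        then show "\<bar>e * ln r\<bar> > 1"
        proof cases
          case 1
          then have "ln r < ln a" using r ab by simp
          then have "e * ln r < - 1" using e ga mult_strict_left_mono by metis
          then show ?thesis by simp
        next
          case 2
          then have "ln b < ln r" using r ab by simp
          then have "1 < e * ln r" using e gb mult_strict_left_mono by metis
          then show ?thesis by simp
        qed
      qed
      then show ?thesis using False by simp
    qed
  qed
  also have "\<dots> = ennreal e * (\<integral>\<^sup>+r. ennreal (if 0 < r then k (e * ln r) / r else 0) \<partial>lborel)"
    by (rule nn_integral_cmult) measurable
  finally show ?thesis ..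
qed

text \<open>The power \<open>-N\<close> is the one that cancels the Jacobian down to the dilation
  invariant \<open>dr / r\<close>, so in the variable \<open>e * ln r\<close> only the profile
  \<open>k\<close> remains.\<close>

definition log_radial :: "real \<Rightarrow> (real \<Rightarrow> real) \<Rightarrow> 'a::euclidean_space \<Rightarrow> real" where
  "log_radial e k x = (if x = 0 then 0 else norm x powr (- real DIM('a)) * k (e * ln (norm x)))"

lemma log_radial_measurable [measurable]:
  assumes [measurable]: "k \<in> borel_measurable borel"
  shows "log_radial e k \<in> borel_measurable borel"
  unfolding log_radial_def[abs_def] by measurable

text \<open>On the sphere of radius \<open>r\<close> the integrand is constant, so the inner
  integral of the polar formula is the Gaussian mass and the outer one is logarithmic. The
  proportionality factor depends only on \<open>e\<close> and the dimension, hence is common to the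
  profiles \<open>v^2\<close> and \<open>v'^2\<close> compared below.\<close>

lemma nn_integral_log_radial:
  fixes k :: "real \<Rightarrow> real"
  assumes k[measurable]: "k \<in> borel_measurable borel" and k0: "\<And>t. 0 \<le> k t"
    and supp: "\<And>t. \<bar>t\<bar> > 1 \<Longrightarrow> k t = 0" and e: "e > 0"
  shows "ennreal e * (polar_const DIM('a) (gauss_weight 0) * (\<integral>\<^sup>+x. ennreal (log_radial e k (x::'a::euclidean_space)) \<partial>lborel)) =
    ennreal (\<integral>x. gauss (x::'a) \<partial>lborel) * (\<integral>\<^sup>+t. ennreal (k t) \<partial>lborel)"
proof -
  define G where "G = (\<integral>x. gauss (x::'a) \<partial>lborel)"
  have G: "(\<integral>\<^sup>+x. ennreal (gauss (x::'a)) \<partial>lborel) = ennreal G"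
    unfolding G_def by (rule nn_integral_eq_integral[OF integrable_gauss]) simp
  have "polar_const DIM('a) (gauss_weight 0) * (\<integral>\<^sup>+x. ennreal (log_radial e k (x::'a)) \<partial>lborel) =
    (\<integral>\<^sup>+r. ennreal (pos_power (DIM('a) - 1) r) *
      (\<integral>\<^sup>+x. ennreal (log_radial e k (r *\<^sub>R sgn (x::'a))) * gauss_weight 0 (norm x) \<partial>lborel) \<partial>lborel)"
    by (rule nn_integral_polar[symmetric]) measurable
  also have "\<dots> = (\<integral>\<^sup>+r. ennreal (if 0 < r then k (e * ln r) / r else 0) * ennreal G \<partial>lborel)"
  proof (rule nn_integral_cong)
    fix r :: real
    show "ennreal (pos_power (DIM('a) - 1) r) *
      (\<integral>\<^sup>+x. ennreal (log_radial e k (r *\<^sub>R sgn (x::'a))) * gauss_weight 0 (norm x) \<partial>lborel) =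
      ennreal (if 0 < r then k (e * ln r) / r else 0) * ennreal G"
    proof (cases "r > 0")
      case r: True
      define c where "c = r powr (- real DIM('a)) * k (e * ln r)"
      have c: "pos_power (DIM('a) - 1) r * c = k (e * ln r) / r"
      proof -
        obtain m where m: "DIM('a) = Suc m" using DIM_positive[where 'a='a] by (cases "DIM('a)") auto
        have "r powr (- real DIM('a)) = 1 / r ^ DIM('a)"
          using r by (simp add: powr_minus powr_realpow divide_inverse)
        then show ?thesis using r by (simp add: c_def pos_power_def m)
      qed
      have "(\<integral>\<^sup>+x. ennreal (log_radial e k (r *\<^sub>R sgn (x::'a))) * gauss_weight 0 (norm x) \<partial>lborel) =
        (\<integral>\<^sup>+x. ennreal c * ennreal (gauss (x::'a)) \<partial>lborel)"
      proof (rule nn_integral_cong_AE, rule AE_mp[OF AE_lborel_singleton[of 0]], rule AE_I2, rule impI)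
        fix x :: 'a assume "x \<noteq> 0"
        then have "log_radial e k (r *\<^sub>R sgn x) = c"
          using r by (simp add: log_radial_def c_def norm_sgn sgn_zero_iff)
        then show "ennreal (log_radial e k (r *\<^sub>R sgn x)) * gauss_weight 0 (norm x) = ennreal c * ennreal (gauss x)"
          unfolding gauss_weight_norm by simp
      qed
      also have "\<dots> = ennreal c * ennreal G"
        by (subst nn_integral_cmult) (simp_all add: G)
      finally show ?thesis
        using r k0 c by (simp add: mult.assoc[symmetric] ennreal_mult'[symmetric])
    qed (simp add: pos_power_def)
  qed
  also have "\<dots> = (\<integral>\<^sup>+r. ennreal (if 0 < r then k (e * ln r) / r else 0) \<partial>lborel) * ennreal G"
    by (rule nn_integral_multc) measurable
  finally have "ennreal e * (polar_const DIM('a) (gauss_weight 0) * (\<integral>\<^sup>+x. ennreal (log_radial e k (x::'a)) \<partial>lborel)) =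
    (ennreal e * (\<integral>\<^sup>+r. ennreal (if 0 < r then k (e * ln r) / r else 0) \<partial>lborel)) * ennreal G"
    by (simp add: mult.assoc)
  also have "ennreal e * (\<integral>\<^sup>+r. ennreal (if 0 < r then k (e * ln r) / r else 0) \<partial>lborel) = (\<integral>\<^sup>+t. ennreal (k t) \<partial>lborel)"
    by (rule nn_integral_ln_scale[OF k k0 supp e])
  finally show ?thesis by (simp only: G_def mult.commute)
qed

lemma integrable_bump_poly_sq: "integrable lborel (\<lambda>t. (bump_poly p k t)\<^sup>2)"
proof -
  have cont: "continuous_on UNIV (bump_poly p k)"
    by (intro continuous_at_imp_continuous_on ballI DERIV_isCont[OF has_real_derivative_bump_poly])
  have [measurable]: "bump_poly p k \<in> borel_measurable borel"
    by (rule borel_measurable_continuous_onI[OF cont])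
  have "compact ((\<lambda>t. (bump_poly p k t)\<^sup>2) ` {-1..1})"
    by (intro compact_continuous_image continuous_intros continuous_on_subset[OF cont]) auto
  then obtain B where B: "\<And>t. t \<in> {-1..1} \<Longrightarrow> \<bar>(bump_poly p k t)\<^sup>2\<bar> \<le> B"
    by (fastforce dest!: compact_imp_bounded simp: bounded_iff)
  have B0: "0 \<le> B" using order_trans[OF abs_ge_zero B[of 0]] by simp
  have z: "bump_poly p k t = 0" if "1 < \<bar>t\<bar>" for t using that by (simp add: bump_poly_def)
  show ?thesis
  proof (rule integrable_bounded_support[where B=B and R=1])
    show "\<bar>(bump_poly p k t)\<^sup>2\<bar> \<le> B" for t
    proof (cases "t \<in> {-1..1}")
      case False
      then have "bump_poly p k t = 0" by (intro z) auto
      then show ?thesis using B0 by simp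
    qed (rule B)
  qed (use z in auto)
qed

lemma integral_lborel_odd:
  fixes f :: "'a::euclidean_space \<Rightarrow> real"
  assumes [measurable]: "f \<in> borel_measurable borel" and odd: "\<And>x. f (- x) = - f x"
  shows "(\<integral>x. f x \<partial>lborel) = 0"
proof -
  have "(lborel :: 'a measure) = distr lborel borel (\<lambda>x. - x)"
    using lborel_affine[of "-1" "0::'a"] by (simp add: density_1)
  then have "(\<integral>x. f x \<partial>lborel) = (\<integral>x. f x \<partial>distr lborel borel (\<lambda>x. - x))" by simp
  also have "\<dots> = (\<integral>x. f (- x) \<partial>lborel)" by (rule integral_distr) measurable
  also have "\<dots> = - (\<integral>x. f x \<partial>lborel)" by (simp add: odd)
  finally show ?thesis by simp
qed

text \<open>Pulled back to the punctured ball, the spherical mean is the integral of an odd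
  function, and reflection at the origin preserves Lebesgue measure.\<close>

lemma odd_admissible:
  fixes u :: "real ^ 'n \<Rightarrow> real"
  assumes "u \<in> C0_infinity" and odd: "\<And>x. u (- x) = - u x"
  shows "u \<in> admissible"
  unfolding admissible_def
proof (intro CollectI conjI allI impI)
  fix r :: real
  have "continuous_on UNIV u"
    using assms(1) C_k.simps(1) by (auto simp: C0_infinity_def simp del: C_k.simps)
  then have [measurable]: "(\<lambda>w. u (r *\<^sub>R w)) \<in> borel_measurable borel"
    by (intro borel_measurable_continuous_onI continuous_on_compose2[OF \<open>continuous_on UNIV u\<close>] continuous_intros) auto
  have m: "(\<lambda>x::real ^ 'n. indicator (cball 0 1 - {0}) x * u (r *\<^sub>R sgn x)) \<in> borel_measurable borel"
    by (intro borel_measurable_times borel_measurable_indicator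
        measurable_compose[OF borel_measurable_sgn_vec \<open>(\<lambda>w. u (r *\<^sub>R w)) \<in> borel_measurable borel\<close>]) auto
  have "(\<integral>x. indicator (cball 0 1 - {0}) (x::real ^ 'n) * u (r *\<^sub>R sgn x) \<partial>lborel) = 0"
    by (rule integral_lborel_odd[OF m]) (auto simp: odd sgn_minus split: split_indicator)
  then show "(\<integral>w. u (r *\<^sub>R w) \<partial>sphere_measure) = 0"
    by (subst integral_sphere_measure) auto
qed (rule assms(1))

section \<open>Optimality\<close>

text \<open>Summing over the coordinates $i$ makes the integrands radial.\<close>

lemma test_function_inequality:
  fixes C e :: real and p q :: "real poly" and j k :: nat
  assumes C: "\<forall>u \<in> (admissible :: (real ^ 'n \<Rightarrow> real) set). C * hardy_integral u \<le> dirichlet_integral u"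
    and e: "e > 0"
    and dv: "\<And>t. (bump_poly p k has_real_derivative bump_poly q j t) (at t)"
  shows "C * (\<integral>t. (bump_poly p k t)\<^sup>2 \<partial>lborel) \<le>
    (real CARD('n))\<^sup>2 / 4 * (\<integral>t. (bump_poly p k t)\<^sup>2 \<partial>lborel) + e\<^sup>2 * (\<integral>t. (bump_poly q j t)\<^sup>2 \<partial>lborel)"
proof -
  define N where "N = real CARD('n)"
  let ?I = "Basis :: (real ^ 'n) set"
  define v v' where "v = bump_poly p k" and "v' = bump_poly q j"
  have v0: "v t = 0" "v' t = 0" if "1 < \<bar>t\<bar>" for t
    using that by (simp_all add: v_def v'_def bump_poly_def)
  have vm[measurable]: "v \<in> borel_measurable borel" "v' \<in> borel_measurable borel"
    unfolding v_def v'_def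
    by (intro borel_measurable_continuous_onI continuous_at_imp_continuous_on ballI
        DERIV_isCont[OF has_real_derivative_bump_poly])+
  \<comment> \<open>The half compensates \<open>ln (x \<bullet> x) = 2 * ln (norm x)\<close>: the
    profile seen at \<open>x\<close> is \<open>v (e * ln (norm x))\<close>.\<close>
  define w w' where "w t = v ((e / 2) * t)" and "w' t = v' ((e / 2) * t) * (e / 2)" for t
  have sw: "smooth_real w"
    unfolding w_def[abs_def] v_def by (rule smooth_real_scale[OF smooth_real_bump_poly])
  have dw: "(w has_real_derivative w' t) (at t)" for t
    unfolding w_def[abs_def] w'_def v_def v'_def
    by (rule DERIV_chain2[OF dv]) (auto intro!: derivative_eq_intros)
  have w0: "w t = 0" if "\<bar>t\<bar> > 2 / e" for t
    unfolding w_def by (rule v0) (use that e in \<open>simp add: abs_mult field_simps\<close>)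
  \<comment> \<open>\<open>H\<close> is evaluated at \<open>|x|^2\<close>, so the exponent
    \<open>- N / 4\<close> stands for \<open>|x|^(-N/2)\<close>.\<close>
  define b where "b = - (N / 4)"
  define H where "H s = (if s > 0 then s powr b * w (ln s) else 0)" for s
  define H' where "H' s = (if s > 0 then s powr (b - 1) * (b * w (ln s) + w' (ln s)) else 0)" for s
  have sH: "smooth_real H"
    unfolding H_def[abs_def] by (rule smooth_real_powr_ln(1)[OF sw w0])
  have dH: "(H has_real_derivative H' s) (at s)" for s
    unfolding H_def[abs_def] H'_def by (rule smooth_real_powr_ln(2)[OF sw w0 dw])
  define u where "u i x = H (x \<bullet> x) * (x \<bullet> i)" for i x :: "real ^ 'n"
  define g where "g i x = H (x \<bullet> x) *\<^sub>R i + (2 * H' (x \<bullet> x) * (x \<bullet> i)) *\<^sub>R x" for i x :: "real ^ 'n"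
  have du: "(u i has_derivative (\<lambda>h. g i x \<bullet> h)) (at x)" for i x
  proof -
    have "((\<lambda>x::real ^ 'n. x \<bullet> x) has_derivative (\<lambda>h. 2 * (x \<bullet> h))) (at x)"
      by (auto intro!: derivative_eq_intros simp: inner_commute)
    from diff_chain_at[OF this dH[unfolded has_field_derivative_def]]
    have 1: "((\<lambda>x. H (x \<bullet> x)) has_derivative (\<lambda>h. H' (x \<bullet> x) * (2 * (x \<bullet> h)))) (at x)"
      by (simp add: o_def)
    have 2: "((\<lambda>x. x \<bullet> i) has_derivative (\<lambda>h. h \<bullet> i)) (at x)"
      by (auto intro!: derivative_eq_intros)
    show ?thesis
      unfolding u_def[abs_def]
      by (rule has_derivative_eq_rhs[OF has_derivative_mult[OF 1 2]])
        (auto simp: fun_eq_iff g_def inner_add_left inner_commute algebra_simps)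
  qed
  have gr: "gradient (u i) = g i" for i
  proof
    fix x
    have "gradient (u i) x \<bullet> h = g i x \<bullet> h" for h by (rule inner_gradient[OF du])
    then show "gradient (u i) x = g i x" using vector_eq_rdot by blast
  qed
  have adm: "u i \<in> admissible" for i
  proof (rule odd_admissible)
    have "smooth_fun (u i)" unfolding u_def[abs_def] by (intro smooth_fun.intros sH)
    moreover have "bounded {x. u i x \<noteq> 0}"
    proof (rule boundedI[where B="exp (1 / e)"])
      fix x assume "x \<in> {x. u i x \<noteq> 0}"
      then have x: "x \<noteq> 0" and "w (ln (x \<bullet> x)) \<noteq> 0"
        by (auto simp: u_def H_def split: if_splits)
      then have "ln (x \<bullet> x) \<le> 2 / e" using w0[of "ln (x \<bullet> x)"] by fastforce
      moreover have "ln (x \<bullet> x) = 2 * ln (norm x)"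
        using x by (simp add: power2_norm_eq_inner[symmetric] ln_realpow)
      ultimately have "ln (norm x) \<le> 1 / e" by simp
      then show "norm x \<le> exp (1 / e)" using x by (simp add: ln_le_cancel_iff[symmetric] del: ln_le_cancel_iff)
    qed
    ultimately show "u i \<in> C0_infinity"
      by (simp add: C0_infinity_def smooth_fun_C_k compact_closure)
    show "u i (- x) = - u i x" for x by (simp add: u_def)
  qed
  have "\<exists>R. compact_C1 (u i) (g i) R" for i
    using C0_infinity_compact_C1[of "u i"] adm[of i] admissible_zero[OF adm]
    unfolding gr by (auto simp: admissible_def)
  then obtain R where cc: "\<And>i. compact_C1 (u i) (g i) (R i)" by metis
  define A :: "real ^ 'n \<Rightarrow> real" where "A = log_radial e (\<lambda>t. (v t)\<^sup>2)"
  define B :: "real ^ 'n \<Rightarrow> real" where "B = log_radial e (\<lambda>t. (v' t)\<^sup>2)"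
  define Q where "Q i = compact_C1.quot (u i)" for i
  define T where "T i = compact_C1.tang (g i)" for i
  define E where "E i x = (compact_C1.remainder (u i) (g i) x)\<^sup>2" for i x
  have parseval: "(\<Sum>i\<in>?I. (x \<bullet> i)\<^sup>2) = (norm x)\<^sup>2" for x :: "real ^ 'n"
    unfolding power2_norm_eq_inner euclidean_inner[of x x] by (simp add: power2_eq_square)
  \<comment> \<open>The expression in \<open>HE\<close> is, up to the angular factor
    \<open>(x \<bullet> i) / |x|\<close>, the remainder of \<open>u i\<close>. By the choice of
    \<open>b\<close> the terms in \<open>v\<close> itself cancel, and only \<open>v'\<close> with
    its factor \<open>e\<close> is left.\<close>
  have H2: "(H (x \<bullet> x))\<^sup>2 = A x" and
    HE: "(N / 2 * H (x \<bullet> x) + 2 * H' (x \<bullet> x) * (norm x)\<^sup>2)\<^sup>2 = e\<^sup>2 * B x" if x: "x \<noteq> 0" for x :: "real ^ 'n"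
  proof -
    define r where "r = norm x"
    have r: "r > 0" using x by (simp add: r_def)
    have s: "x \<bullet> x = r\<^sup>2" by (simp add: r_def power2_norm_eq_inner)
    have s0: "r\<^sup>2 > 0" using r by simp
    have ln: "ln (r\<^sup>2) = 2 * ln r" using r by (simp add: ln_realpow)
    have pw: "(r\<^sup>2) powr b = r powr (- N / 2)"
      using r by (simp add: b_def powr_powr flip: powr_numeral)
    have sq: "(r powr (- N / 2))\<^sup>2 = r powr (- N)"
      using r by (simp add: power2_eq_square flip: powr_add)
    have h: "H (r\<^sup>2) = r powr (- N / 2) * v (e * ln r)"
      using s0 by (simp add: H_def pw w_def ln)
    show "(H (x \<bullet> x))\<^sup>2 = A x"
      unfolding s h power_mult_distrib sq using x by (simp add: A_def log_radial_def r_def N_def)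
    have h': "H' (r\<^sup>2) * r\<^sup>2 = r powr (- N / 2) * (b * v (e * ln r) + v' (e * ln r) * (e / 2))"
      using s0 by (simp add: H'_def powr_diff pw w_def w'_def ln)
    have "N / 2 * H (r\<^sup>2) + 2 * H' (r\<^sup>2) * r\<^sup>2 = N / 2 * H (r\<^sup>2) + 2 * (H' (r\<^sup>2) * r\<^sup>2)" by simp
    also have "\<dots> = r powr (- N / 2) * (e * v' (e * ln r))"
      unfolding h h' by (simp add: b_def algebra_simps)
    finally show "(N / 2 * H (x \<bullet> x) + 2 * H' (x \<bullet> x) * (norm x)\<^sup>2)\<^sup>2 = e\<^sup>2 * B x"
      unfolding s r_def[symmetric] using x
      by (simp only: power_mult_distrib sq) (simp add: B_def log_radial_def r_def N_def)
  qed
  have Q: "Q i x = A x * (x \<bullet> i)\<^sup>2 / (norm x)\<^sup>2" and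
    T: "T i x = A x * (1 - (x \<bullet> i)\<^sup>2 / (norm x)\<^sup>2)" and
    E: "E i x = (x \<bullet> i)\<^sup>2 / (norm x)\<^sup>2 * (e\<^sup>2 * B x)" if i: "i \<in> ?I" and x: "x \<noteq> 0" for i x
  proof -
    interpret compact_C1 "u i" "g i" "R i" by (rule cc)
    define r h h' y where "r = norm x" and "h = H (x \<bullet> x)" and "h' = H' (x \<bullet> x)" and "y = x \<bullet> i"
    have r: "r > 0" using x by (simp add: r_def)
    have xx: "x \<bullet> x = r * r" by (simp add: r_def power2_norm_eq_inner[symmetric] power2_eq_square)
    have ii: "i \<bullet> i = 1" using i by (simp add: inner_Basis)
    have gx: "g i x = h *\<^sub>R i + (2 * h' * y) *\<^sub>R x" by (simp add: g_def h_def h'_def y_def)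
    have ux: "u i x = h * y" by (simp add: u_def h_def y_def)
    have rad: "rad x = y * (h / r + 2 * h' * r)"
      using r by (simp add: rad_def gx sgn_div_norm r_def[symmetric] inner_add_left xx
          y_def inner_commute[of i x] field_simps)
    have gg: "(norm (g i x))\<^sup>2 = h * h + 4 * h * h' * y * y + 4 * h' * h' * y * y * r * r"
      unfolding gx power2_norm_eq_inner
      by (simp add: inner_add_left inner_add_right xx ii y_def inner_commute[of i x] algebra_simps)
    show "Q i x = A x * (x \<bullet> i)\<^sup>2 / (norm x)\<^sup>2"
      by (simp add: Q_def quot_def ux H2[OF x, symmetric] h_def[symmetric] y_def[symmetric] power_mult_distrib)
    show "T i x = A x * (1 - (x \<bullet> i)\<^sup>2 / (norm x)\<^sup>2)"
      unfolding T_def tang_def gg rad H2[OF x, symmetric] h_def[symmetric] y_def[symmetric] r_def[symmetric]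
      using r by (simp add: field_simps power2_eq_square)
    have "remainder x = y / r * (N / 2 * h + 2 * h' * r\<^sup>2)"
      using r by (simp add: remainder_def rad ux r_def[symmetric] N_def field_simps power2_eq_square)
    then show "E i x = (x \<bullet> i)\<^sup>2 / (norm x)\<^sup>2 * (e\<^sup>2 * B x)"
      unfolding E_def HE[OF x, symmetric]
      by (simp add: h_def h'_def y_def r_def power_mult_distrib power_divide)
  qed
  have z: "A 0 = 0" "B 0 = 0" by (simp_all add: A_def B_def log_radial_def)
  \<comment> \<open>Since \<open>H 0 = 0\<close>, and \<open>sgn 0\<close> and division by 0 give 0,
    all these functions vanish at the origin; the sums below then hold at every point and may be
    rewritten inside integrals.\<close>
  have z': "Q i 0 = 0" "T i 0 = 0" "E i 0 = 0" for i
    using cc[of i] unfolding Q_def T_def E_def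
    by (simp_all add: compact_C1.quot_def compact_C1.tang_def compact_C1.rad_def compact_C1.remainder_def g_def u_def H_def)
  have card: "(\<Sum>i\<in>?I. (1::real)) = N" by (simp add: N_def)
  \<comment> \<open>Coordinate functions restrict to first spherical harmonics, for which the
    tangential inequality is an equality: this is the factor \<open>N - 1\<close>. The angular
    factors \<open>(x \<bullet> i)^2 / |x|^2\<close> add up to 1.\<close>
  have sumQ: "(\<Sum>i\<in>?I. Q i x) = A x" and sumT: "(\<Sum>i\<in>?I. T i x) = (N - 1) * A x" and
    sumE: "(\<Sum>i\<in>?I. E i x) = e\<^sup>2 * B x" for x
  proof -
    have n: "(\<Sum>i\<in>?I. (x \<bullet> i)\<^sup>2 / (norm x)\<^sup>2) = 1" if "x \<noteq> 0"
      using that by (simp add: sum_divide_distrib[symmetric] parseval)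
    show "(\<Sum>i\<in>?I. Q i x) = A x"
    proof (cases "x = 0")
      case False
      have "(\<Sum>i\<in>?I. Q i x) = A x * (\<Sum>i\<in>?I. (x \<bullet> i)\<^sup>2 / (norm x)\<^sup>2)"
        unfolding sum_distrib_left by (rule sum.cong) (simp_all add: Q False)
      then show ?thesis using n False by simp
    qed (simp add: z z')
    show "(\<Sum>i\<in>?I. T i x) = (N - 1) * A x"
    proof (cases "x = 0")
      case False
      have "(\<Sum>i\<in>?I. T i x) = A x * (\<Sum>i\<in>?I. 1 - (x \<bullet> i)\<^sup>2 / (norm x)\<^sup>2)"
        unfolding sum_distrib_left by (rule sum.cong) (simp_all add: T False)
      then show ?thesis using n False by (simp only: sum_subtractf card) (simp add: mult.commute)
    qed (simp add: z z')
    show "(\<Sum>i\<in>?I. E i x) = e\<^sup>2 * B x"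
    proof (cases "x = 0")
      case False
      have "(\<Sum>i\<in>?I. E i x) = (\<Sum>i\<in>?I. (x \<bullet> i)\<^sup>2 / (norm x)\<^sup>2) * (e\<^sup>2 * B x)"
        unfolding sum_distrib_right by (rule sum.cong) (simp_all add: E False)
      then show ?thesis using n False by simp
    qed (simp add: z z')
  qed
  have iQ: "integrable lborel (Q i)" and iT: "integrable lborel (T i)" and iE: "integrable lborel (E i)" for i
    unfolding Q_def T_def E_def[abs_def]
    using compact_C1.integrable_quot[OF cc] compact_C1.integrable_tang[OF cc] compact_C1.integrable_remainder[OF cc] by auto
  \<comment> \<open>No direct estimate of \<open>A\<close> or \<open>B\<close> is made:
    integrability is inherited from the summands through these identities, for \<open>B\<close>
    after cancelling \<open>e^2\<close>.\<close>
  have iA: "integrable lborel A"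
    using Bochner_Integration.integrable_sum[of ?I lborel Q] iQ by (simp add: sumQ)
  have iB: "integrable lborel B"
    using Bochner_Integration.integrable_sum[of ?I lborel E] iE e by (simp add: sumE)
  define a where "a = (\<integral>x. A x \<partial>lborel)"
  define c where "c = (\<integral>x. B x \<partial>lborel)"
  have SQ: "(\<Sum>i\<in>?I. (\<integral>x. Q i x \<partial>lborel)) = a"
    using iQ by (subst Bochner_Integration.integral_sum[symmetric]) (simp_all add: sumQ a_def)
  have ST: "(\<Sum>i\<in>?I. (\<integral>x. T i x \<partial>lborel)) = (N - 1) * a"
    using iT by (subst Bochner_Integration.integral_sum[symmetric]) (simp_all add: sumT a_def)
  have SE: "(\<Sum>i\<in>?I. (\<integral>x. E i x \<partial>lborel)) = e\<^sup>2 * c"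
    using iE by (subst Bochner_Integration.integral_sum[symmetric]) (simp_all add: sumE c_def)
  have ineq: "C * (\<integral>x. Q i x \<partial>lborel) \<le>
    (\<integral>x. T i x \<partial>lborel) + ((N - 2) / 2)\<^sup>2 * (\<integral>x. Q i x \<partial>lborel) + (\<integral>x. E i x \<partial>lborel)" for i
  proof -
    interpret compact_C1 "u i" "g i" "R i" by (rule cc)
    have "C * hardy_integral (u i) \<le> dirichlet_integral (u i)" using C adm by blast
    moreover have "hardy_integral (u i) = (\<integral>x. Q i x \<partial>lborel)"
      by (simp add: hardy_integral_def Q_def quot_def[abs_def])
    ultimately show ?thesis
      using dirichlet_split by (simp add: dirichlet_integral_def gr T_def E_def Q_def N_def)
  qed
  have "(\<Sum>i\<in>?I. C * (\<integral>x. Q i x \<partial>lborel)) \<le> (\<Sum>i\<in>?I. (\<integral>x. T i x \<partial>lborel) +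
      ((N - 2) / 2)\<^sup>2 * (\<integral>x. Q i x \<partial>lborel) + (\<integral>x. E i x \<partial>lborel))"
    by (rule sum_mono) (rule ineq)
  then have "C * a \<le> (N - 1) * a + ((N - 2) / 2)\<^sup>2 * a + e\<^sup>2 * c"
    by (simp only: sum.distrib sum_distrib_left[symmetric] SQ ST SE)
  also have "(N - 1) * a + ((N - 2) / 2)\<^sup>2 * a = N\<^sup>2 / 4 * a"
    by (simp add: power2_eq_square field_simps)
  finally have main: "C * a \<le> N\<^sup>2 / 4 * a + e\<^sup>2 * c" .
  define G where "G = (\<integral>x. gauss (x::real ^ 'n) \<partial>lborel)"
  define \<kappa> where "\<kappa> = enn2real (polar_const DIM(real ^ 'n) (gauss_weight 0))"
  have \<kappa>: "polar_const DIM(real ^ 'n) (gauss_weight 0) = ennreal \<kappa>"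
    unfolding \<kappa>_def using polar_const_gauss(3)[where 'a="real ^ 'n"] by (simp add: less_top)
  have \<kappa>0: "\<kappa> \<ge> 0" by (simp add: \<kappa>_def)
  have G: "G > 0" unfolding G_def by (rule integral_gauss_pos)
  \<comment> \<open>Multiplying \<open>main\<close> by \<open>e * \<kappa>\<close> turns
    \<open>a\<close> and \<open>c\<close> into the one-dimensional integrals of \<open>v^2\<close>
    and \<open>v'^2\<close> with the common factor \<open>G\<close>, which cancels.\<close>
  have scal: "e * (\<kappa> * (\<integral>x. log_radial e (\<lambda>t. (f t)\<^sup>2) (x :: real ^ 'n) \<partial>lborel)) = G * (\<integral>t. (f t)\<^sup>2 \<partial>lborel)"
    if f[measurable]: "f \<in> borel_measurable borel" and f0: "\<And>t. 1 < \<bar>t\<bar> \<Longrightarrow> f t = 0"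
      and i1: "integrable lborel (\<lambda>t. (f t)\<^sup>2)"
      and i2: "integrable lborel (log_radial e (\<lambda>t. (f t)\<^sup>2) :: real ^ 'n \<Rightarrow> real)" for f :: "real \<Rightarrow> real"
  proof -
    have nn: "0 \<le> log_radial e (\<lambda>t. (f t)\<^sup>2) (x :: real ^ 'n)" for x by (simp add: log_radial_def)
    have "ennreal e * (ennreal \<kappa> * (\<integral>\<^sup>+x. ennreal (log_radial e (\<lambda>t. (f t)\<^sup>2) (x :: real ^ 'n)) \<partial>lborel)) =
      ennreal G * (\<integral>\<^sup>+t. ennreal ((f t)\<^sup>2) \<partial>lborel)"
      unfolding \<kappa>[symmetric] G_def by (rule nn_integral_log_radial) (use f0 e in auto)
    then have "ennreal (e * (\<kappa> * (\<integral>x. log_radial e (\<lambda>t. (f t)\<^sup>2) (x :: real ^ 'n) \<partial>lborel))) = ennreal (G * (\<integral>t. (f t)\<^sup>2 \<partial>lborel))"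
      using e G \<kappa>0 nn
      by (simp add: nn_integral_eq_integral[OF i1] nn_integral_eq_integral[OF i2] ennreal_mult integral_nonneg_AE)
    then show ?thesis
      using e G \<kappa>0 nn by (subst (asm) ennreal_inj) (auto intro!: mult_nonneg_nonneg integral_nonneg_AE)
  qed
  have sa: "e * (\<kappa> * a) = G * (\<integral>t. (v t)\<^sup>2 \<partial>lborel)"
    unfolding a_def A_def
    by (rule scal[OF vm(1) v0(1) _ iA[unfolded A_def]]) (simp_all add: v_def integrable_bump_poly_sq)
  have sc: "e * (\<kappa> * c) = G * (\<integral>t. (v' t)\<^sup>2 \<partial>lborel)"
    unfolding c_def B_def
    by (rule scal[OF vm(2) v0(2) _ iB[unfolded B_def]]) (simp_all add: v'_def integrable_bump_poly_sq)
  have "e * \<kappa> * (C * a) \<le> e * \<kappa> * (N\<^sup>2 / 4 * a + e\<^sup>2 * c)"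
    using main e \<kappa>0 by (intro mult_left_mono) auto
  also have "\<dots> = N\<^sup>2 / 4 * (e * (\<kappa> * a)) + e\<^sup>2 * (e * (\<kappa> * c))" by (simp add: algebra_simps)
  also have "e * \<kappa> * (C * a) = C * (e * (\<kappa> * a))" by simp
  finally have "G * (C * (\<integral>t. (v t)\<^sup>2 \<partial>lborel)) \<le> G * (N\<^sup>2 / 4 * (\<integral>t. (v t)\<^sup>2 \<partial>lborel) + e\<^sup>2 * (\<integral>t. (v' t)\<^sup>2 \<partial>lborel))"
    unfolding sa sc by (simp add: algebra_simps)
  then show ?thesis using G unfolding v_def v'_def N_def by simp
qed

lemma Hardy_constant_le:
  assumes C: "\<forall>u \<in> (admissible :: (real ^ 'n \<Rightarrow> real) set). C * hardy_integral u \<le> dirichlet_integral u"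
  shows "C \<le> (real CARD('n))\<^sup>2 / 4"
proof -
  \<comment> \<open>The standard bump function \<open>exp (- 1 / (1 - t^2))\<close>; any nonzero
    member of the family would do.\<close>
  define v where "v = bump_poly 1 0"
  obtain q j where dv: "\<And>t. (bump_poly 1 0 has_real_derivative bump_poly q j t) (at t)"
    using has_real_derivative_bump_poly by (rule that)
  define V V' where "V = (\<integral>t. (v t)\<^sup>2 \<partial>lborel)" and "V' = (\<integral>t. (bump_poly q j t)\<^sup>2 \<partial>lborel)"
  have V': "V' \<ge> 0" by (simp add: V'_def)
  have V: "V > 0"
  proof -
    have "V \<noteq> 0"
    proof
      assume "V = 0"
      then have "AE t in lborel. (v t)\<^sup>2 = 0"
        unfolding V_def using integrable_bump_poly_sq[of 1 0]
        by (subst (asm) integral_nonneg_eq_0_iff_AE) (auto simp: v_def)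
      then have "AE t in lborel. t \<notin> {-1<..<1::real}"
        by eventually_elim (auto simp: v_def bump_poly_def abs_less_iff split: if_splits)
      then have "emeasure lborel {-1<..<1::real} = 0"
        by (subst (asm) AE_iff_measurable[where N="{-1<..<1}"]) auto
      then show False by simp
    qed
    then show ?thesis by (simp add: V_def less_le)
  qed
  have "C * V \<le> (real CARD('n))\<^sup>2 / 4 * V"
  proof (rule field_le_epsilon)
    fix d :: real assume d: "d > 0"
    \<comment> \<open>Makes \<open>e^2 * V'\<close> at most \<open>d\<close>; the 1 keeps the
      denominator positive.\<close>
    define e where "e = sqrt (d / (V' + 1))"
    have e: "e > 0" using d V' by (simp add: e_def)
    have "C * V \<le> (real CARD('n))\<^sup>2 / 4 * V + e\<^sup>2 * V'"
      using test_function_inequality[OF C e dv] by (simp add: V_def V'_def v_def)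
    moreover have "e\<^sup>2 * V' \<le> d"
    proof -
      have "e\<^sup>2 * V' = d * (V' / (V' + 1))" using d V' by (simp add: e_def)
      also have "\<dots> \<le> d * 1" using d V' by (intro mult_left_mono) auto
      finally show ?thesis by simp
    qed
    ultimately show "C * V \<le> (real CARD('n))\<^sup>2 / 4 * V + d" by linarith
  qed
  then show ?thesis using V by simp
qed

section \<open>Conclusion for admissible functions\<close>

lemma admissible_Hardy:
  fixes u :: "real ^ 'n \<Rightarrow> real"
  assumes u: "u \<in> admissible"
  shows "integrable lborel (\<lambda>x. \<bar>u x\<bar>\<^sup>2 / (norm x)\<^sup>2)"
    and "integrable lborel (\<lambda>x. (norm (gradient u x))\<^sup>2)"
    and "(real CARD('n))\<^sup>2 / 4 * hardy_integral u \<le> dirichlet_integral u"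
    and "(real CARD('n))\<^sup>2 / 4 * hardy_integral u = dirichlet_integral u \<Longrightarrow> u = (\<lambda>x. 0)"
proof -
  have uC: "u \<in> C0_infinity" and mean: "\<And>r. r \<ge> 0 \<Longrightarrow> (\<integral>w. u (r *\<^sub>R w) \<partial>sphere_measure) = 0"
    using u by (auto simp: admissible_def)
  obtain R where "compact_C1 u (gradient u) R"
    using C0_infinity_compact_C1[OF uC admissible_zero[OF u]] by blast
  then interpret compact_C1 u "gradient u" R .
  have quot: "\<bar>u x\<bar>\<^sup>2 / (norm x)\<^sup>2 = quot x" for x by (simp add: quot_def)
  show "integrable lborel (\<lambda>x. \<bar>u x\<bar>\<^sup>2 / (norm x)\<^sup>2)"
    unfolding quot using integrable_quot by simp
  show "integrable lborel (\<lambda>x. (norm (gradient u x))\<^sup>2)"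
    by (rule integrable_grad)
  have mean0: "(\<integral>x. u (r *\<^sub>R sgn x) * norm x * gauss x \<partial>lborel) = 0" if "r > 0" for r
    by (rule sphere_mean_zero_gauss[of "\<lambda>w. u (r *\<^sub>R w)"])
      (use that mean in \<open>auto intro!: continuous_on_compose2[OF cont_u] continuous_intros\<close>)
  have main: "(real CARD('n))\<^sup>2 / 4 * hardy_integral u + (\<integral>x. (remainder x)\<^sup>2 \<partial>lborel) \<le> dirichlet_integral u"
    unfolding hardy_integral_def dirichlet_integral_def quot using Hardy_with_remainder[OF mean0] by simp
  have rem: "0 \<le> (\<integral>x. (remainder x)\<^sup>2 \<partial>lborel)" by simp
  show "(real CARD('n))\<^sup>2 / 4 * hardy_integral u \<le> dirichlet_integral u"
    using main rem by linarith
  show "u = (\<lambda>x. 0)" if "(real CARD('n))\<^sup>2 / 4 * hardy_integral u = dirichlet_integral u"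
    by (rule remainder_zero_imp_zero) (use main rem that in linarith)
qed

theorem proposition3:
  assumes "CARD('n::finite) \<ge> 2"
  shows
    "(\<forall>u \<in> (admissible :: (real ^ 'n \<Rightarrow> real) set).
        integrable lborel (\<lambda>x. \<bar>u x\<bar>\<^sup>2 / (norm x)\<^sup>2) \<and>
        integrable lborel (\<lambda>x. (norm (gradient u x))\<^sup>2) \<and>
        (real CARD('n))\<^sup>2 / 4 * hardy_integral u \<le> dirichlet_integral u) \<and>
     (\<forall>C::real. (\<forall>u \<in> (admissible :: (real ^ 'n \<Rightarrow> real) set).
        C * hardy_integral u \<le> dirichlet_integral u) \<longrightarrow> C \<le> (real CARD('n))\<^sup>2 / 4) \<and>
     (\<forall>u \<in> (admissible :: (real ^ 'n \<Rightarrow> real) set). u \<noteq> (\<lambda>x. 0) \<longrightarrow>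
        (real CARD('n))\<^sup>2 / 4 * hardy_integral u \<noteq> dirichlet_integral u)"
proof (intro conjI ballI allI impI)
  fix C :: real
  assume "\<forall>u \<in> (admissible :: (real ^ 'n \<Rightarrow> real) set). C * hardy_integral u \<le> dirichlet_integral u"
  then show "C \<le> (real CARD('n))\<^sup>2 / 4" by (rule Hardy_constant_le)
next
  fix u :: "real ^ 'n \<Rightarrow> real"
  assume "u \<in> admissible" and "u \<noteq> (\<lambda>x. 0)"
  then show "(real CARD('n))\<^sup>2 / 4 * hardy_integral u \<noteq> dirichlet_integral u"
    using admissible_Hardy(4) by blast
qed (rule admissible_Hardy; assumption)+

end
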